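(* Let $X$ be a complex Banach space and let $T \in \mathcal{W}_X$. Suppose that (C1) for some integer $N \ge 1$ (for instance $N=1$), the $N$-th power $T^N\in\mathcal{W}_X$ of $T$ with respect to the product $*$ of $\mathcal{W}_X$ satisfies $\lim_{\delta\to0}\|T^N(\rho)-T^N(\rho-\delta)\|_{\mathcal{W}_X}=0$; (C2) $\lim_{R\to\infty}\|T\chi_{|\rho|\ge R}\|_{\mathcal{W}_X}=0$. If $I+\hat T(\lambda)$ is an invertible element of $\mathcal{B}(X)$ for every $\lambda\in\mathbb{R}$, then $\mathbf{1}+T$ possesses an inverse in $\overline{\mathcal{W}}_X$ of the form $\mathbf{1}+S$ with $S\in\mathcal{W}_X$.
   Context: $\mathcal{B}(X)$ is the algebra of bounded linear operators on $X$, with identity $I$. $L^1(\mathbb{R};X)$ is the Bochner space (the norm-closure of the $X$-valued simple functions). $\mathcal{W}_X$ is the Banach space of bounded linear maps $T:X\to L^1(\mathbb{R};X)$ with the operator norm $\|T\|_{\mathcal{W}_X}=\sup_{\|f\|_X\le1}\int_{\mathbb{R}}\|(Tf)(\rho)\|_X\,d\rho$. One writes $T(\rho)f:=(Tf)(\rho)$, although the individual $T(\rho)$ need not be bounded operators on $X$. Translation and truncation: $T(\rho-\delta)$ denotes the element of $\mathcal{W}_X$ given by $f\mapsto (Tf)(\cdot-\delta)$, and $T\chi_{|\rho|\ge R}$ the element $f\mapsto \chi_{\{|\rho|\ge R\}}\,(Tf)(\rho)$. Product: $\mathcal{W}_X$ is an algebra under $$(S*T)(\rho)f=\int_{\mathbb{R}}S(\rho-\sigma)\,T(\sigma)f\,d\sigma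 .$$ Precisely, $S\in\mathcal{W}_X$ acts on simple functions $g=\sum_j\chi_{E_j}x_j$ (with $E_j\subset\mathbb{R}$ of finite measure, $x_j\in X$) by $S*g=\sum_j\chi_{E_j}*(Sx_j)$, this extends by continuity to a bounded operator on $L^1(\mathbb{R};X)$, and $(S*T)f:=S*(Tf)$. Powers $T^N$ are taken with respect to $*$. Fourier transform: $\hat T(\lambda)f=\int_{\mathbb{R}}e^{-i\lambda\rho}\,T(\rho)f\,d\rho$, so that $\hat T(\lambda)\in\mathcal{B}(X)$ for each $\lambda\in\mathbb{R}$. $\overline{\mathcal{W}}_X$ is the unital algebra obtained by adjoining to $\mathcal{W}_X$ the complex multiples of an identity element $\mathbf{1}$, with norm $\|z\mathbf{1}+T\|_{\overline{\mathcal{W}}_X}=|z|+\|T\|_{\mathcal{W}_X}$. An inverse means a two-sided inverse in this algebra. *)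

theory Defs
  imports "HOL-Analysis.Analysis"
begin

section \<open>Complex Banach spaces\<close>

class complex_normed_vector = real_normed_vector +
  fixes scaleC :: "complex \<Rightarrow> 'a \<Rightarrow> 'a" (infixr \<open>*\<^sub>C\<close> 75)
  assumes scaleC_add_right: "a *\<^sub>C (x + y) = a *\<^sub>C x + a *\<^sub>C y"
    and scaleC_add_left: "(a + b) *\<^sub>C x = a *\<^sub>C x + b *\<^sub>C x"
    and scaleC_scaleC: "a *\<^sub>C b *\<^sub>C x = (a * b) *\<^sub>C x"
    and scaleC_of_real: "complex_of_real r *\<^sub>C x = r *\<^sub>R x"
    and norm_scaleC: "norm (a *\<^sub>C x) = cmod a * norm x"

class cbanach = complex_normed_vector + complete_space

definition bounded_clinear :: "('a::complex_normed_vector \<Rightarrow> 'b::complex_normed_vector) \<Rightarrow> bool" where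
  "bounded_clinear A \<longleftrightarrow> bounded_linear A \<and> (\<forall>c x. A (c *\<^sub>C x) = c *\<^sub>C A x)"

definition invertible_op :: "('a::complex_normed_vector \<Rightarrow> 'a) \<Rightarrow> bool" where
  "invertible_op A \<longleftrightarrow>
     bounded_clinear A \<and> (\<exists>B. bounded_clinear B \<and> A \<circ> B = id \<and> B \<circ> A = id)"

lemma bounded_linear_scaleC: "bounded_linear ((*\<^sub>C) (a::complex) :: 'a \<Rightarrow> 'a::complex_normed_vector)"
proof (rule bounded_linear_intro[where K = "cmod a"])
  fix x y :: 'a and r :: real
  show "a *\<^sub>C (x + y) = a *\<^sub>C x + a *\<^sub>C y" by (rule scaleC_add_right)
  show "a *\<^sub>C r *\<^sub>R x = r *\<^sub>R a *\<^sub>C x"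
    by (simp add: scaleC_of_real[symmetric] scaleC_scaleC mult.commute)
  show "norm (a *\<^sub>C x) \<le> norm x * cmod a" by (simp add: norm_scaleC mult.commute)
qed


section \<open>Bochner integrable functions on the real line\<close>

text \<open>
  The library's Bochner integral is restricted to second countable (that is, separable) range
  spaces, so its definition is repeated here for arbitrary normed spaces.  Without separability,
  sums of Borel functions need not be Borel, hence measurability is replaced by strong
  measurability: a function is required to be an everywhere pointwise limit of simple functions.
  Since only classes modulo null sets matter, this loses nothing: if simple functions converge to
  a function in the integral norm, a subsequence converges almost everywhere, and the limit can be
  put to zero on a Borel null set.
\<close>

definition strongly_measurable :: "(real \<Rightarrow> 'a::real_normed_vector) \<Rightarrow> bool" where
  "strongly_measurable f \<longleftrightarrow>
     (\<exists>s. (\<forall>n. simple_function lborel (s n)) \<and> (\<forall>x. (\<lambda>n. s n x) \<longlonglongrightarrow> f x))"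

definition approx_seq :: "(nat \<Rightarrow> real \<Rightarrow> 'a::real_normed_vector) \<Rightarrow> (real \<Rightarrow> 'a) \<Rightarrow> bool" where
  "approx_seq s f \<longleftrightarrow> (\<forall>n. Bochner_Integration.simple_bochner_integrable lborel (s n)) \<and>
     (\<lambda>n. \<integral>\<^sup>+x. ennreal (norm (f x - s n x)) \<partial>lborel) \<longlonglongrightarrow> 0"

definition L1_fun :: "(real \<Rightarrow> 'a::real_normed_vector) \<Rightarrow> bool" where
  "L1_fun f \<longleftrightarrow> strongly_measurable f \<and> (\<exists>s. approx_seq s f)"

definition bochner_integral :: "(real \<Rightarrow> 'a::real_normed_vector) \<Rightarrow> 'a" where
  "bochner_integral f =
     (THE y. \<exists>s. approx_seq s f \<and> (\<lambda>n. Bochner_Integration.simple_bochner_integral lborel (s n)) \<longlonglongrightarrow> y)"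

lemma strongly_measurable_borel: "strongly_measurable f \<Longrightarrow> f \<in> borel_measurable lborel"
proof -
  assume "strongly_measurable f"
  then obtain s where s: "\<And>n. simple_function lborel (s n)" "\<And>x. (\<lambda>n. s n x) \<longlonglongrightarrow> f x"
    unfolding strongly_measurable_def by blast
  show ?thesis
    by (rule borel_measurable_LIMSEQ_metric[OF borel_measurable_simple_function[OF s(1)] s(2)])
qed

lemma strongly_measurable_simple: "simple_function lborel f \<Longrightarrow> strongly_measurable f"
  unfolding strongly_measurable_def by (intro exI[where x = "\<lambda>_. f"]) auto

lemma strongly_measurable_compose2:
  assumes "strongly_measurable f" "strongly_measurable g"
    and p: "\<And>x y a b. x \<longlonglongrightarrow> a \<Longrightarrow> y \<longlonglongrightarrow> b \<Longrightarrow> (\<lambda>n::nat. p (x n) (y n)) \<longlonglongrightarrow> p a b"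
  shows "strongly_measurable (\<lambda>x. p (f x) (g x))"
proof -
  obtain s t where "\<And>n. simple_function lborel (s n)" "\<And>x. (\<lambda>n. s n x) \<longlonglongrightarrow> f x"
    "\<And>n. simple_function lborel (t n)" "\<And>x. (\<lambda>n. t n x) \<longlonglongrightarrow> g x"
    using assms unfolding strongly_measurable_def by metis
  then show ?thesis unfolding strongly_measurable_def
    by (intro exI[where x = "\<lambda>n x. p (s n x) (t n x)"]) (auto intro: p simple_function_compose2)
qed

lemma borel_measurable_norm_diff:
  assumes "strongly_measurable f" "strongly_measurable g"
  shows "(\<lambda>x. norm (f x - g x)) \<in> borel_measurable lborel"
proof -
  have "strongly_measurable (\<lambda>x. f x - g x)"
    using assms by (rule strongly_measurable_compose2) (rule tendsto_diff)
  from strongly_measurable_borel[OF this] show ?thesis by measurable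
qed

lemma sbi_simple: "Bochner_Integration.simple_bochner_integrable M f \<Longrightarrow> simple_function M f"
  by (rule simple_bochner_integrable.cases)

lemma borel_measurable_norm_diff_sbi:
  assumes "strongly_measurable f" "Bochner_Integration.simple_bochner_integrable lborel s"
  shows "(\<lambda>x. norm (f x - s x)) \<in> borel_measurable lborel"
  using assms(1) strongly_measurable_simple[OF sbi_simple[OF assms(2)]]
  by (rule borel_measurable_norm_diff)

lemma approx_seq_dominated:
  assumes "\<And>n. Bochner_Integration.simple_bochner_integrable lborel (u n)"
    and f: "strongly_measurable f" and s: "approx_seq s f"
    and g: "strongly_measurable g" and t: "approx_seq t g"
    and le: "\<And>n x. norm (h x - u n x) \<le> K * norm (f x - s n x) + norm (g x - t n x)"
    and K: "0 \<le> K"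
  shows "approx_seq u h"
  unfolding approx_seq_def
proof (intro conjI allI)
  show "(\<lambda>n. \<integral>\<^sup>+x. ennreal (norm (h x - u n x)) \<partial>lborel) \<longlonglongrightarrow> 0" (is "?h \<longlonglongrightarrow> 0")
  proof (rule tendsto_sandwich)
    let ?r = "\<lambda>n. ennreal K * (\<integral>\<^sup>+x. ennreal (norm (f x - s n x)) \<partial>lborel)
                + (\<integral>\<^sup>+x. ennreal (norm (g x - t n x)) \<partial>lborel)"
    show "\<forall>\<^sub>F n in sequentially. 0 \<le> ?h n" "(\<lambda>_. 0) \<longlonglongrightarrow> (0::ennreal)" by auto
    have [measurable]: "(\<lambda>x. norm (f x - s n x)) \<in> borel_measurable lborel"
      "(\<lambda>x. norm (g x - t n x)) \<in> borel_measurable lborel" for n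
      using f g s t unfolding approx_seq_def by (blast intro: borel_measurable_norm_diff_sbi)+
    show "\<forall>\<^sub>F n in sequentially. ?h n \<le> ?r n"
    proof (intro always_eventually allI)
      fix n
      have "?h n \<le> (\<integral>\<^sup>+x. ennreal K * ennreal (norm (f x - s n x))
                    + ennreal (norm (g x - t n x)) \<partial>lborel)"
        using le K by (intro nn_integral_mono) (simp flip: ennreal_plus ennreal_mult)
      also have "\<dots> = ?r n"
        by (subst nn_integral_add) (auto simp: nn_integral_cmult)
      finally show "?h n \<le> ?r n" .
    qed
    have "(\<lambda>n. ennreal K * (\<integral>\<^sup>+x. ennreal (norm (f x - s n x)) \<partial>lborel)) \<longlonglongrightarrow> ennreal K * 0"
      using s unfolding approx_seq_def by (intro ennreal_tendsto_cmult) auto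
    moreover have "(\<lambda>n. \<integral>\<^sup>+x. ennreal (norm (g x - t n x)) \<partial>lborel) \<longlonglongrightarrow> 0"
      using t unfolding approx_seq_def by auto
    ultimately show "?r \<longlonglongrightarrow> 0" using tendsto_add by fastforce
  qed
qed (use assms in auto)

lemma approx_seq_dominated1:
  assumes "\<And>n. Bochner_Integration.simple_bochner_integrable lborel (u n)"
    and "strongly_measurable f" "approx_seq s f"
    and "\<And>n x. norm (h x - u n x) \<le> K * norm (f x - s n x)" "0 \<le> K"
  shows "approx_seq u h"
proof (rule approx_seq_dominated[where f = f and g = "\<lambda>_. 0::real" and s = s
      and t = "\<lambda>_ _. 0" and K = K])
  show "strongly_measurable (\<lambda>_. 0::real)" by (simp add: strongly_measurable_simple)
  show "approx_seq (\<lambda>_ _. 0::real) (\<lambda>_. 0)"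
    by (simp add: approx_seq_def simple_bochner_integrable.simps)
qed (use assms in auto)

lemma L1_fun_zero: "L1_fun (\<lambda>_. 0)"
  unfolding L1_fun_def approx_seq_def
  by (auto intro!: strongly_measurable_simple exI[where x = "\<lambda>_ _. 0"]
      simp: simple_bochner_integrable.simps)

lemma L1_fun_add:
  assumes "L1_fun f" "L1_fun g"
  shows "L1_fun (\<lambda>x. f x + g x)"
proof -
  obtain s t where st: "approx_seq s f" "approx_seq t g"
    using assms unfolding L1_fun_def by blast
  have fg: "strongly_measurable f" "strongly_measurable g"
    using assms unfolding L1_fun_def by auto
  have "Bochner_Integration.simple_bochner_integrable lborel (\<lambda>x. s n x + t n x)" for n
    using st unfolding approx_seq_def
    by (intro simple_bochner_integrable_compose2[where p = "(+)"]) auto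
  then have "approx_seq (\<lambda>n x. s n x + t n x) (\<lambda>x. f x + g x)"
    by (rule approx_seq_dominated[where K = 1, OF _ fg(1) st(1) fg(2) st(2)])
      (auto intro: norm_diff_triangle_ineq)
  moreover have "strongly_measurable (\<lambda>x. f x + g x)"
    using assms unfolding L1_fun_def
    by (intro strongly_measurable_compose2[of f g "(+)"] tendsto_add) auto
  ultimately show ?thesis unfolding L1_fun_def by blast
qed

lemma L1_fun_bounded_linear:
  assumes "L1_fun f" and A: "bounded_linear A"
  shows "L1_fun (\<lambda>x. A (f x))"
proof -
  interpret A: bounded_linear A by fact
  obtain s where s: "approx_seq s f"
    using assms unfolding L1_fun_def by blast
  obtain K where K: "0 \<le> K" "\<And>x. norm (A x) \<le> norm x * K" using A.nonneg_bounded by blast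
  have f: "strongly_measurable f"
    using assms unfolding L1_fun_def by auto
  have "Bochner_Integration.simple_bochner_integrable lborel (\<lambda>x. A (s n x))" for n
    using s unfolding approx_seq_def
    by (intro simple_bochner_integrable_compose2[where p = "\<lambda>x y. A x"]) (auto simp: A.zero)
  then have "approx_seq (\<lambda>n x. A (s n x)) (\<lambda>x. A (f x))"
    using K by (intro approx_seq_dominated1[OF _ f s, where K = K])
      (auto simp: mult.commute simp flip: A.diff)
  moreover have "strongly_measurable (\<lambda>x. A (f x))"
    using assms unfolding L1_fun_def
    by (intro strongly_measurable_compose2[of f f "\<lambda>x y. A x"] A.tendsto) auto
  ultimately show ?thesis unfolding L1_fun_def by blast
qed

lemma L1_fun_indicator:
  assumes "L1_fun f" and E[measurable]: "E \<in> sets borel"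
  shows "L1_fun (\<lambda>x. indicator E x *\<^sub>R f x)"
proof -
  obtain s where s: "approx_seq s f"
    using assms unfolding L1_fun_def by blast
  have E_simple: "simple_function lborel (indicator E :: real \<Rightarrow> real)"
    by (rule simple_function_indicator) simp
  have "Bochner_Integration.simple_bochner_integrable lborel (\<lambda>x. indicator E x *\<^sub>R s n x)" for n
  proof
    have sn: "Bochner_Integration.simple_bochner_integrable lborel (s n)" using s unfolding approx_seq_def by blast
    show "simple_function lborel (\<lambda>x. indicator E x *\<^sub>R s n x)"
      by (rule simple_function_compose2[OF E_simple sbi_simple[OF sn]])
    have "{x. s n x \<noteq> 0} \<in> sets lborel"
      using simple_functionD(2)[OF sbi_simple[OF sn], of "- {0}"] by (simp add: vimage_def)
    then have "emeasure lborel {x. indicator E x *\<^sub>R s n x \<noteq> 0} \<le> emeasure lborel {x. s n x \<noteq> 0}"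
      by (intro emeasure_mono) auto
    then show "emeasure lborel {x \<in> space lborel. indicator E x *\<^sub>R s n x \<noteq> 0} \<noteq> \<infinity>"
      using sn by (auto simp: simple_bochner_integrable.simps top_unique)
  qed
  then have "approx_seq (\<lambda>n x. indicator E x *\<^sub>R s n x) (\<lambda>x. indicator E x *\<^sub>R f x)"
    using assms by (intro approx_seq_dominated1[OF _ _ s, where K = 1])
      (auto simp: L1_fun_def indicator_def)
  moreover have "strongly_measurable (\<lambda>x. indicator E x *\<^sub>R f x)"
    using assms unfolding L1_fun_def
    by (intro strongly_measurable_compose2[OF strongly_measurable_simple[OF E_simple],
          where p = "(*\<^sub>R)"] tendsto_scaleR) auto
  ultimately show ?thesis unfolding L1_fun_def by blast
qed

lemma lborel_translate: "distr lborel borel (\<lambda>x::real. x - d) = lborel"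
proof -
  have "(\<lambda>x::real. x - d) = (+) (- d)" by auto
  then show ?thesis using lborel_distr_plus[of "- d"] by simp
qed

lemma simple_function_translate:
  assumes "simple_function lborel (s :: real \<Rightarrow> _)"
  shows "simple_function lborel (\<lambda>x. s (x - d))"
  unfolding simple_function_def
proof (intro conjI ballI)
  have "finite (range s)" using simple_functionD(1)[OF assms] by simp
  then show "finite ((\<lambda>x. s (x - d)) ` space lborel)"
    by (rule rev_finite_subset) auto
  fix y
  have "s -` {y} \<in> sets borel" using simple_functionD(2)[OF assms, of "{y}"] by simp
  then have "(\<lambda>x. x - d) -` (s -` {y}) \<inter> space lborel \<in> sets lborel"
    by (intro measurable_sets[where A = borel]) auto
  then show "(\<lambda>x. s (x - d)) -` {y} \<inter> space lborel \<in> sets lborel"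
    by (simp add: vimage_def)
qed

lemma L1_fun_translate:
  assumes "L1_fun f"
  shows "L1_fun (\<lambda>x. f (x - d))"
proof -
  obtain s where s: "approx_seq s f" and f: "strongly_measurable f"
    using assms unfolding L1_fun_def by blast
  have "Bochner_Integration.simple_bochner_integrable lborel (\<lambda>x. s n (x - d))" for n
  proof
    have sn: "Bochner_Integration.simple_bochner_integrable lborel (s n)" using s unfolding approx_seq_def by blast
    then show "simple_function lborel (\<lambda>x. s n (x - d))"
      by (intro simple_function_translate sbi_simple)
    have B: "{x. s n x \<noteq> 0} \<in> sets borel"
      using simple_functionD(2)[OF sbi_simple[OF sn], of "- {0}"] by (simp add: vimage_def)
    have "emeasure lborel {x. s n x \<noteq> 0} = emeasure (distr lborel borel (\<lambda>x. x - d)) {x. s n x \<noteq> 0}"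
      by (simp add: lborel_translate)
    also have "\<dots> = emeasure lborel {x. s n (x - d) \<noteq> 0}"
      using B by (subst emeasure_distr) (auto simp: vimage_def)
    finally show "emeasure lborel {x \<in> space lborel. s n (x - d) \<noteq> 0} \<noteq> \<infinity>"
      using sn by (auto simp: simple_bochner_integrable.simps)
  qed
  moreover have "(\<integral>\<^sup>+x. ennreal (norm (f (x - d) - s n (x - d))) \<partial>lborel)
      = (\<integral>\<^sup>+x. ennreal (norm (f x - s n x)) \<partial>lborel)" for n
  proof -
    have m: "(\<lambda>x. norm (f x - s n x)) \<in> borel_measurable lborel"
      using f s unfolding approx_seq_def by (blast intro: borel_measurable_norm_diff_sbi)
    have "(\<integral>\<^sup>+x. ennreal (norm (f x - s n x)) \<partial>lborel)
        = (\<integral>\<^sup>+x. ennreal (norm (f x - s n x)) \<partial>distr lborel borel (\<lambda>x. x - d))"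
      by (simp add: lborel_translate)
    also have "\<dots> = (\<integral>\<^sup>+x. ennreal (norm (f (x - d) - s n (x - d))) \<partial>lborel)"
      using m by (subst nn_integral_distr) auto
    finally show ?thesis by simp
  qed
  ultimately have "approx_seq (\<lambda>n x. s n (x - d)) (\<lambda>x. f (x - d))"
    using s unfolding approx_seq_def by simp
  moreover have "strongly_measurable (\<lambda>x. f (x - d))"
  proof -
    obtain u where u: "\<And>n. simple_function lborel (u n)" "\<And>x. (\<lambda>n. u n x) \<longlonglongrightarrow> f x"
      using f unfolding strongly_measurable_def by blast
    then show ?thesis unfolding strongly_measurable_def
      by (intro exI[where x = "\<lambda>n x. u n (x - d)"]) (auto intro: simple_function_translate)
  qed
  ultimately show ?thesis unfolding L1_fun_def by blast
qed

lemma L1_fun_integrable_norm: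
  assumes "L1_fun f"
  shows "integrable lborel (\<lambda>x. norm (f x))"
proof (rule integrableI_bounded)
  obtain s where s: "approx_seq s f" and f: "strongly_measurable f"
    using assms unfolding L1_fun_def by blast
  show "(\<lambda>x. norm (f x)) \<in> borel_measurable lborel"
    using strongly_measurable_borel[OF f] by measurable
  have "\<forall>\<^sub>F n in sequentially. (\<integral>\<^sup>+x. ennreal (norm (f x - s n x)) \<partial>lborel) < 1"
    using s unfolding approx_seq_def by (intro order_tendstoD) auto
  then obtain n where n: "(\<integral>\<^sup>+x. ennreal (norm (f x - s n x)) \<partial>lborel) < 1"
    by (auto simp: eventually_sequentially)
  have sn: "Bochner_Integration.simple_bochner_integrable lborel (s n)" using s unfolding approx_seq_def by blast
  then have "Bochner_Integration.simple_bochner_integrable lborel (\<lambda>x. norm (s n x))"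
    by (intro simple_bochner_integrable_compose2[where p = "\<lambda>x y. norm x"]) auto
  then have fin: "(\<integral>\<^sup>+x. ennreal (norm (s n x)) \<partial>lborel) < \<infinity>"
    using simple_bochner_integral_eq_nn_integral[of lborel "\<lambda>x. norm (s n x)"]
    by (metis ennreal_less_top infinity_ennreal_def norm_ge_zero)
  have [measurable]: "(\<lambda>x. norm (f x - s n x)) \<in> borel_measurable lborel"
    using f sn by (rule borel_measurable_norm_diff_sbi)
  have [measurable]: "s n \<in> borel_measurable lborel"
    using sn by (intro borel_measurable_simple_function sbi_simple)
  have "(\<integral>\<^sup>+x. ennreal (norm (norm (f x))) \<partial>lborel)
      \<le> (\<integral>\<^sup>+x. ennreal (norm (f x - s n x)) + ennreal (norm (s n x)) \<partial>lborel)"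
    by (intro nn_integral_mono)
      (simp add: norm_triangle_sub add.commute flip: ennreal_plus)
  also have "\<dots> = (\<integral>\<^sup>+x. ennreal (norm (f x - s n x)) \<partial>lborel)
      + (\<integral>\<^sup>+x. ennreal (norm (s n x)) \<partial>lborel)"
    by (rule nn_integral_add) auto
  also have "\<dots> < \<infinity>" using n fin by (auto simp: ennreal_add_less_top intro: less_trans)
  finally show "(\<integral>\<^sup>+x. ennreal (norm (norm (f x))) \<partial>lborel) < \<infinity>" .
qed

lemma bochner_integral_cong_AE:
  assumes "AE x in lborel. f x = g x"
  shows "bochner_integral f = bochner_integral g"
proof -
  have "(\<integral>\<^sup>+x. ennreal (norm (f x - s n x)) \<partial>lborel)
      = (\<integral>\<^sup>+x. ennreal (norm (g x - s n x)) \<partial>lborel)" for s and n :: nat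
    using assms by (intro nn_integral_cong_AE) auto
  then show ?thesis unfolding bochner_integral_def approx_seq_def by simp
qed


section \<open>The space of Bochner integrable functions modulo null sets\<close>

definition L1_rel :: "(real \<Rightarrow> 'a::real_normed_vector) \<Rightarrow> (real \<Rightarrow> 'a) \<Rightarrow> bool" where
  "L1_rel f g \<longleftrightarrow> L1_fun f \<and> L1_fun g \<and> (AE x in lborel. f x = g x)"

quotient_type (overloaded) 'a L1 = "real \<Rightarrow> 'a::real_normed_vector" / partial: L1_rel
proof (rule part_equivpI)
  show "\<exists>f. L1_rel f f" using L1_fun_zero unfolding L1_rel_def by auto
  show "symp L1_rel" by (auto simp: symp_def L1_rel_def elim: eventually_mono)
  show "transp L1_rel" by (auto simp: transp_def L1_rel_def elim: eventually_elim2)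
qed

instantiation L1 :: (real_normed_vector) real_normed_vector
begin

lift_definition zero_L1 :: "'a L1" is "\<lambda>_. 0"
  by (simp add: L1_rel_def L1_fun_zero)

lift_definition plus_L1 :: "'a L1 \<Rightarrow> 'a L1 \<Rightarrow> 'a L1" is "\<lambda>f g x. f x + g x"
  by (auto simp: L1_rel_def L1_fun_add elim: eventually_elim2)

lift_definition uminus_L1 :: "'a L1 \<Rightarrow> 'a L1" is "\<lambda>f x. - f x"
  by (auto simp: L1_rel_def intro: L1_fun_bounded_linear[OF _ bounded_linear_minus[OF bounded_linear_ident]])

definition minus_L1 :: "'a L1 \<Rightarrow> 'a L1 \<Rightarrow> 'a L1" where "minus_L1 f g = f + - g"

lift_definition scaleR_L1 :: "real \<Rightarrow> 'a L1 \<Rightarrow> 'a L1" is "\<lambda>r f x. r *\<^sub>R f x"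
  by (auto simp: L1_rel_def intro: L1_fun_bounded_linear[OF _ bounded_linear_scaleR_right])

lift_definition norm_L1 :: "'a L1 \<Rightarrow> real" is "\<lambda>f. \<integral>x. norm (f x) \<partial>lborel"
proof -
  fix f g :: "real \<Rightarrow> 'a"
  assume "L1_rel f g"
  then have fg: "L1_fun f" "L1_fun g" "AE x in lborel. f x = g x" by (auto simp: L1_rel_def)
  show "(\<integral>x. norm (f x) \<partial>lborel) = (\<integral>x. norm (g x) \<partial>lborel)"
    using fg(3) by (intro integral_cong_AE borel_measurable_integrable L1_fun_integrable_norm fg)
      (auto elim: eventually_mono)
qed

definition sgn_L1 :: "'a L1 \<Rightarrow> 'a L1" where "sgn_L1 f = inverse (norm f) *\<^sub>R f"

definition dist_L1 :: "'a L1 \<Rightarrow> 'a L1 \<Rightarrow> real" where "dist_L1 f g = norm (f - g)"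

definition uniformity_L1 :: "('a L1 \<times> 'a L1) filter" where
  "uniformity_L1 = (INF e\<in>{0 <..}. principal {(x, y). dist x y < e})"

definition open_L1 :: "'a L1 set \<Rightarrow> bool" where
  "open_L1 U = (\<forall>x\<in>U. \<forall>\<^sub>F (x', y) in uniformity. x' = x \<longrightarrow> y \<in> U)"

instance
proof
  fix f g h :: "'a L1" and r q :: real and U :: "'a L1 set"
  note simps = L1_rel_def L1_fun_add L1_fun_zero
    L1_fun_bounded_linear[OF _ bounded_linear_scaleR_right]
    L1_fun_bounded_linear[OF _ bounded_linear_minus[OF bounded_linear_ident]]
  show "f + g + h = f + (g + h)" by transfer (auto simp: simps add.assoc)
  show "f + g = g + f" by transfer (auto simp: simps add.commute)
  show "0 + f = f" by transfer (auto simp: simps)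
  show "- f + f = 0" by transfer (auto simp: simps)
  show "f - g = f + - g" by (simp add: minus_L1_def)
  show "r *\<^sub>R (f + g) = r *\<^sub>R f + r *\<^sub>R g" by transfer (auto simp: simps scaleR_add_right)
  show "(r + q) *\<^sub>R f = r *\<^sub>R f + q *\<^sub>R f" by transfer (auto simp: simps scaleR_add_left)
  show "r *\<^sub>R q *\<^sub>R f = (r * q) *\<^sub>R f" by transfer (auto simp: simps)
  show "1 *\<^sub>R f = f" by transfer (auto simp: simps)
  show "norm f = 0 \<longleftrightarrow> f = 0"
    by transfer (auto simp: L1_rel_def L1_fun_zero L1_fun_integrable_norm integral_nonneg_eq_0_iff_AE)
  show "norm (f + g) \<le> norm f + norm g"
  proof transfer
    fix f g :: "real \<Rightarrow> 'a"
    assume "L1_rel f f" "L1_rel g g"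
    then have fg: "L1_fun f" "L1_fun g" by (auto simp: L1_rel_def)
    have "(\<integral>x. norm (f x + g x) \<partial>lborel) \<le> (\<integral>x. norm (f x) + norm (g x) \<partial>lborel)"
      using fg by (intro integral_mono Bochner_Integration.integrable_add)
        (auto simp: L1_fun_integrable_norm L1_fun_add norm_triangle_ineq)
    also have "\<dots> = (\<integral>x. norm (f x) \<partial>lborel) + (\<integral>x. norm (g x) \<partial>lborel)"
      using fg by (intro Bochner_Integration.integral_add) (auto simp: L1_fun_integrable_norm)
    finally show "(\<integral>x. norm (f x + g x) \<partial>lborel)
        \<le> (\<integral>x. norm (f x) \<partial>lborel) + (\<integral>x. norm (g x) \<partial>lborel)" .
  qed
  show "norm (r *\<^sub>R f) = \<bar>r\<bar> * norm f" by transfer simp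
qed (simp_all add: sgn_L1_def dist_L1_def uniformity_L1_def open_L1_def)

end

instantiation L1 :: (complex_normed_vector) complex_normed_vector
begin

lift_definition scaleC_L1 :: "complex \<Rightarrow> 'a L1 \<Rightarrow> 'a L1" is "\<lambda>c f x. c *\<^sub>C f x"
  by (auto simp: L1_rel_def intro: L1_fun_bounded_linear[OF _ bounded_linear_scaleC])

instance
proof
  fix f g :: "'a L1" and r :: real and a b :: complex
  note simps = L1_rel_def L1_fun_add L1_fun_bounded_linear[OF _ bounded_linear_scaleC]
    L1_fun_bounded_linear[OF _ bounded_linear_scaleR_right]
  show "a *\<^sub>C (f + g) = a *\<^sub>C f + a *\<^sub>C g" by transfer (auto simp: simps scaleC_add_right)
  show "(a + b) *\<^sub>C f = a *\<^sub>C f + b *\<^sub>C f" by transfer (auto simp: simps scaleC_add_left)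
  show "a *\<^sub>C b *\<^sub>C f = (a * b) *\<^sub>C f" by transfer (auto simp: simps scaleC_scaleC)
  show "complex_of_real r *\<^sub>C f = r *\<^sub>R f" by transfer (auto simp: simps scaleC_of_real)
  show "norm (a *\<^sub>C f) = cmod a * norm f" by transfer (simp add: norm_scaleC)
qed

end

lift_definition L1_translate :: "real \<Rightarrow> 'a::real_normed_vector L1 \<Rightarrow> 'a L1"
  is "\<lambda>d f x. f (x - d)"
proof -
  fix d and f g :: "real \<Rightarrow> 'a"
  assume fg: "L1_rel f g"
  then obtain N where N: "N \<in> null_sets lborel" "{x. f x \<noteq> g x} \<subseteq> N"
    by (auto simp: L1_rel_def elim!: AE_E simp: null_sets_def)
  have "AE x in distr lborel borel (\<lambda>x. x - d). x \<notin> N"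
    unfolding lborel_translate using N by (rule_tac AE_not_in)
  then have "AE x in lborel. x - d \<notin> N"
    using N by (subst (asm) AE_distr_iff) auto
  then have "AE x in lborel. f (x - d) = g (x - d)"
    using N by (auto elim!: eventually_mono)
  with fg show "L1_rel (\<lambda>x. f (x - d)) (\<lambda>x. g (x - d))"
    by (auto simp: L1_rel_def L1_fun_translate)
qed

lift_definition L1_tail :: "real \<Rightarrow> 'a::real_normed_vector L1 \<Rightarrow> 'a L1"
  is "\<lambda>R f x. indicator {x. \<bar>x\<bar> \<ge> R} x *\<^sub>R f x"
  by (auto simp: L1_rel_def intro!: L1_fun_indicator)

lift_definition L1_fourier :: "real \<Rightarrow> 'a::complex_normed_vector L1 \<Rightarrow> 'a"
  is "\<lambda>l f. bochner_integral (\<lambda>x. exp (- \<i> * of_real l * of_real x) *\<^sub>C f x)"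
  by (auto simp: L1_rel_def intro!: bochner_integral_cong_AE)

definition L1_indicator :: "real set \<Rightarrow> 'a::real_normed_vector \<Rightarrow> 'a L1" where
  "L1_indicator E v = abs_L1 (\<lambda>x. indicator E x *\<^sub>R v)"

definition indicator_conv :: "real set \<Rightarrow> 'a::real_normed_vector L1 \<Rightarrow> 'a L1" where
  "indicator_conv E h =
     abs_L1 (\<lambda>x. bochner_integral (\<lambda>y. indicator E (x - y) *\<^sub>R rep_L1 h y))"


section \<open>The algebra of bounded operators into the space of integrable functions\<close>

text \<open>The norm on this space is the library's operator norm \<^const>\<open>onorm\<close>.\<close>

definition wiener :: "('a::complex_normed_vector \<Rightarrow> 'a L1) set" where
  "wiener = {T. bounded_clinear T}"

text \<open>
  The action of an element \<open>S\<close> on integrable functions: the unique bounded operator that maps the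
  function \<open>\<chi>\<^sub>E v\<close> to the convolution of \<open>\<chi>\<^sub>E\<close> and \<open>S v\<close>.
\<close>

definition wiener_act :: "('a::complex_normed_vector \<Rightarrow> 'a L1) \<Rightarrow> 'a L1 \<Rightarrow> 'a L1" where
  "wiener_act S = (THE A. bounded_clinear A \<and>
     (\<forall>E\<in>fmeasurable lborel. \<forall>v. A (L1_indicator E v) = indicator_conv E (S v)))"

definition wiener_mult ::
  "('a::complex_normed_vector \<Rightarrow> 'a L1) \<Rightarrow> ('a \<Rightarrow> 'a L1) \<Rightarrow> 'a \<Rightarrow> 'a L1" (infixl \<open>\<star>\<close> 70) where
  "S \<star> T = (\<lambda>v. wiener_act S (T v))"

text \<open>The algebra has no unit, so powers are meaningful for positive exponents only.\<close>

definition wiener_power :: "('a::complex_normed_vector \<Rightarrow> 'a L1) \<Rightarrow> nat \<Rightarrow> 'a \<Rightarrow> 'a L1" where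
  "wiener_power T N = ((\<star>) T ^^ (N - 1)) T"

definition wiener_fourier :: "('a::complex_normed_vector \<Rightarrow> 'a L1) \<Rightarrow> real \<Rightarrow> 'a \<Rightarrow> 'a" where
  "wiener_fourier T l = (\<lambda>v. L1_fourier l (T v))"

text \<open>The unitization: the pair \<open>(z, T)\<close> with \<open>T \<in> wiener\<close> stands for \<open>z\<one> + T\<close>.\<close>

type_synonym 'a wiener_unit = "complex \<times> ('a \<Rightarrow> 'a L1)"

definition unit_one :: "'a::complex_normed_vector wiener_unit" where
  "unit_one = (1, \<lambda>_. 0)"

fun unit_mult :: "'a::complex_normed_vector wiener_unit \<Rightarrow> 'a wiener_unit \<Rightarrow> 'a wiener_unit" where
  "unit_mult (z, S) (w, T) = (z * w, \<lambda>v. z *\<^sub>C T v + w *\<^sub>C S v + (S \<star> T) v)"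

end

(*
An element S of the algebra acts on L^1(R;X) as the bounded operator conv_op S, which commutes with
translations, and 1 + T is invertible as soon as I + conv_op T has an inverse Q commuting with
translations and complex scalars: the inverse is then 1 + S with S = -Q o T.  One-sided inverses are
found in the commutant of the translations in B(L^1(R;X)); applying the argument to the opposite
algebra gives the other side, and the two inverses coincide.

If I + conv_op T had no left inverse, it would lie in a maximal left ideal J.  The translations U_t
are central isometries, so (as in the Gelfand-Mazur theorem) U_t = c(t) modulo J for some character c
of modulus 1.  Let C_tau be convolution with the indicator function of [0,tau).
  - If some C_tau is not in J, then c is continuous because t |-> U_t C_tau is norm continuous, so
    c(t) = exp(-i l t).  By (C2), C_tau conv_op(T) is a norm limit of sums of U_{s_j} C_tau B_j, where
    B_j is the integral of T over a short interval at s_j; hence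
    C_tau conv_op(T) = C_tau That(l) modulo J, so (I + That(l)) C_tau lies in J, and so does C_tau.
  - If all C_tau lie in J, then (C1) puts P = (-conv_op T)^N into J.  Also I - P is a multiple of
    I + conv_op T, hence in J, and I would be in J.
This replaces the usual partition of unity in frequency space.
*)
theory Submission
  imports Defs
begin

text \<open>The values of T need not commute, so Gelfand theory of commutative algebras does not
  apply; what survives is that central elements act as scalars on the simple module attached to a
  maximal left ideal. A left ideal absorbs factors only from the left, and this shapes every
  computation modulo J: whatever is moved across another factor must be central or be known to
  commute with it. The commutant in B(L^1(R;X)) replaces the unitization because nothing has to be
  known about the form of an inverse Q found there: -Q o T maps X boundedly into L^1 for any Q, and
  commutation with translations identifies its convolution operator with -Q o conv_op T. Ideals
  containing every C_tau lie at infinity: c may then be discontinuous, and invertibility of I +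
  That(l) says nothing about them; (C1) is what excludes them. Since X may be nonseparable,
  measurability means approximation by simple functions, and integrals are compared through such
  approximations.\<close>

instance cbanach \<subseteq> banach ..

subsection \<open>The Bochner integral\<close>

abbreviation sbi :: "(real \<Rightarrow> 'a::real_normed_vector) \<Rightarrow> bool" where
  "sbi \<equiv> Bochner_Integration.simple_bochner_integrable lborel"

abbreviation sint :: "(real \<Rightarrow> 'a::real_normed_vector) \<Rightarrow> 'a" where
  "sint \<equiv> Bochner_Integration.simple_bochner_integral lborel"

lemma approx_seq_sbi: "approx_seq s f \<Longrightarrow> sbi (s n)"
  by (simp add: approx_seq_def)

lemma L1_fun_strongly_measurable: "L1_fun f \<Longrightarrow> strongly_measurable f"
  by (simp add: L1_fun_def)

lemma norm_sint_le_nn_integral: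
  assumes "sbi s"
  shows "ennreal (norm (sint s)) \<le> (\<integral>\<^sup>+x. ennreal (norm (s x)) \<partial>lborel)"
proof -
  have "sbi (\<lambda>x. norm (s x))"
    using assms by (intro simple_bochner_integrable_compose2[where p = "\<lambda>x y. norm x"]) auto
  then have "ennreal (sint (\<lambda>x. norm (s x))) = (\<integral>\<^sup>+x. ennreal (norm (s x)) \<partial>lborel)"
    by (intro simple_bochner_integral_eq_nn_integral) auto
  then show ?thesis
    using simple_bochner_integral_norm_bound[OF assms] by (metis ennreal_leI)
qed

text \<open>The triangle inequality through f. It serves twice: integrals along one approximating
  sequence are Cauchy, and two sequences for the same f have the same limit.\<close>

lemma norm_sint_diff_le:
  assumes f: "strongly_measurable f" and s: "sbi s" and t: "sbi t"
  shows "ennreal (norm (sint s - sint t))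
    \<le> (\<integral>\<^sup>+x. ennreal (norm (f x - s x)) \<partial>lborel) + (\<integral>\<^sup>+x. ennreal (norm (f x - t x)) \<partial>lborel)"
proof -
  have [measurable]: "(\<lambda>x. norm (f x - s x)) \<in> borel_measurable lborel"
    "(\<lambda>x. norm (f x - t x)) \<in> borel_measurable lborel"
    using borel_measurable_norm_diff_sbi f s t by blast+
  have "sbi (\<lambda>x. s x - t x)"
    using s t by (intro simple_bochner_integrable_compose2[where p = "(-)"]) auto
  from norm_sint_le_nn_integral[OF this]
  have "ennreal (norm (sint s - sint t)) \<le> (\<integral>\<^sup>+x. ennreal (norm (s x - t x)) \<partial>lborel)"
    using s t by (simp add: simple_bochner_integral_diff)
  also have "\<dots> \<le> (\<integral>\<^sup>+x. ennreal (norm (f x - s x)) + ennreal (norm (f x - t x)) \<partial>lborel)"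
  proof (intro nn_integral_mono)
    fix x
    have "norm (s x - t x) \<le> norm (f x - s x) + norm (f x - t x)"
      using norm_triangle_ineq[of "s x - f x" "f x - t x"] by (simp add: norm_minus_commute)
    then show "ennreal (norm (s x - t x)) \<le> ennreal (norm (f x - s x)) + ennreal (norm (f x - t x))"
      by (simp flip: ennreal_plus)
  qed
  also have "\<dots> = (\<integral>\<^sup>+x. ennreal (norm (f x - s x)) \<partial>lborel) + (\<integral>\<^sup>+x. ennreal (norm (f x - t x)) \<partial>lborel)"
    by (rule nn_integral_add) auto
  finally show ?thesis .
qed

lemma approx_seq_convergent:
  fixes f :: "real \<Rightarrow> 'a::banach"
  assumes f: "strongly_measurable f" and s: "approx_seq s f"
  shows "convergent (\<lambda>n. sint (s n))"
proof (rule Cauchy_convergent, rule metric_CauchyI)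
  fix e :: real assume e: "0 < e"
  have "\<forall>\<^sub>F n in sequentially. (\<integral>\<^sup>+x. ennreal (norm (f x - s n x)) \<partial>lborel) < ennreal (e/2)"
    using s e order_tendstoD(2)[of _ 0 sequentially "ennreal (e/2)"]
    unfolding approx_seq_def by simp
  then obtain N where N: "\<And>n. n \<ge> N \<Longrightarrow> (\<integral>\<^sup>+x. ennreal (norm (f x - s n x)) \<partial>lborel) < ennreal (e/2)"
    by (auto simp: eventually_sequentially)
  show "\<exists>M. \<forall>m\<ge>M. \<forall>n\<ge>M. dist (sint (s m)) (sint (s n)) < e"
  proof (intro exI allI impI)
    fix m n assume "m \<ge> N" "n \<ge> N"
    have "ennreal (norm (sint (s m) - sint (s n))) \<le> (\<integral>\<^sup>+x. ennreal (norm (f x - s m x)) \<partial>lborel)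
        + (\<integral>\<^sup>+x. ennreal (norm (f x - s n x)) \<partial>lborel)"
      using f approx_seq_sbi[OF s] by (intro norm_sint_diff_le) auto
    also have "\<dots> < ennreal (e/2) + ennreal (e/2)"
      using N \<open>m \<ge> N\<close> \<open>n \<ge> N\<close> by (intro add_strict_mono) auto
    also have "\<dots> = ennreal e" using e by (simp flip: ennreal_plus)
    finally show "dist (sint (s m)) (sint (s n)) < e"
      using e by (simp add: dist_norm ennreal_less_iff)
  qed
qed

lemma approx_seq_unique:
  assumes f: "strongly_measurable f" and s: "approx_seq s f" "approx_seq t f"
    and lim: "(\<lambda>n. sint (s n)) \<longlonglongrightarrow> y" "(\<lambda>n. sint (t n)) \<longlonglongrightarrow> z"
  shows "y = z"
proof -
  have "(\<lambda>n. (\<integral>\<^sup>+x. ennreal (norm (f x - s n x)) \<partial>lborel)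
      + (\<integral>\<^sup>+x. ennreal (norm (f x - t n x)) \<partial>lborel)) \<longlonglongrightarrow> 0 + 0"
    using s unfolding approx_seq_def by (intro tendsto_add) auto
  then have 0: "(\<lambda>n. (\<integral>\<^sup>+x. ennreal (norm (f x - s n x)) \<partial>lborel)
      + (\<integral>\<^sup>+x. ennreal (norm (f x - t n x)) \<partial>lborel)) \<longlonglongrightarrow> 0" by simp
  have "(\<lambda>n. ennreal (norm (sint (s n) - sint (t n)))) \<longlonglongrightarrow> 0"
    by (rule tendsto_sandwich[OF _ _ tendsto_const 0])
      (simp_all add: norm_sint_diff_le f approx_seq_sbi[OF s(1)] approx_seq_sbi[OF s(2)])
  then have "(\<lambda>n. norm (sint (s n) - sint (t n))) \<longlonglongrightarrow> 0"
    by (simp add: ennreal_tendsto_0_iff)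
  then have "(\<lambda>n. sint (s n) - sint (t n)) \<longlonglongrightarrow> 0"
    by (rule tendsto_norm_zero_cancel)
  moreover have "(\<lambda>n. sint (s n) - sint (t n)) \<longlonglongrightarrow> y - z"
    using lim by (rule tendsto_diff)
  ultimately show ?thesis using LIMSEQ_unique by fastforce
qed

text \<open>Evaluates the definite description in \<open>bochner_integral\<close>: independence of
  the approximating sequence is its uniqueness part, and a convergent sequence of simple integrals
  is the witness.\<close>

lemma bochner_integral_eqI:
  assumes "strongly_measurable f" "approx_seq s f" "(\<lambda>n. sint (s n)) \<longlonglongrightarrow> y"
  shows "bochner_integral f = y"
  unfolding bochner_integral_def using assms approx_seq_unique by (intro the_equality) blast+

lemma bochner_integral_limit:
  fixes f :: "real \<Rightarrow> 'a::banach"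
  assumes "strongly_measurable f" "approx_seq s f"
  shows "(\<lambda>n. sint (s n)) \<longlonglongrightarrow> bochner_integral f"
  using approx_seq_convergent[OF assms] bochner_integral_eqI[OF assms]
  by (auto simp: convergent_def)

lemma approx_seq_const: "sbi s \<Longrightarrow> approx_seq (\<lambda>_. s) s"
  by (simp add: approx_seq_def)

lemma L1_fun_sbi: "sbi s \<Longrightarrow> L1_fun s"
  unfolding L1_fun_def using approx_seq_const sbi_simple strongly_measurable_simple by blast

lemma bochner_integral_sbi: "sbi s \<Longrightarrow> bochner_integral s = sint s"
  by (rule bochner_integral_eqI[OF strongly_measurable_simple[OF sbi_simple] approx_seq_const]) auto

lemma bochner_integral_add:
  fixes f g :: "real \<Rightarrow> 'a::banach"
  assumes "L1_fun f" "L1_fun g"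
  shows "bochner_integral (\<lambda>x. f x + g x) = bochner_integral f + bochner_integral g"
proof -
  obtain s t where st: "approx_seq s f" "approx_seq t g"
    using assms unfolding L1_fun_def by blast
  have fg: "strongly_measurable f" "strongly_measurable g"
    using assms unfolding L1_fun_def by auto
  have "sbi (\<lambda>x. s n x + t n x)" for n
    using st unfolding approx_seq_def
    by (intro simple_bochner_integrable_compose2[where p = "(+)"]) auto
  then have "approx_seq (\<lambda>n x. s n x + t n x) (\<lambda>x. f x + g x)"
    by (rule approx_seq_dominated[where K = 1, OF _ fg(1) st(1) fg(2) st(2)])
      (auto intro: norm_diff_triangle_ineq)
  moreover have "(\<lambda>n. sint (\<lambda>x. s n x + t n x)) \<longlonglongrightarrow> bochner_integral f + bochner_integral g"
    using approx_seq_sbi[OF st(1)] approx_seq_sbi[OF st(2)]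
      bochner_integral_limit[OF fg(1) st(1)] bochner_integral_limit[OF fg(2) st(2)]
    by (simp add: simple_bochner_integral_add tendsto_add)
  ultimately show ?thesis
    using L1_fun_strongly_measurable[OF L1_fun_add[OF assms]] by (intro bochner_integral_eqI)
qed

lemma bochner_integral_bounded_linear:
  fixes f :: "real \<Rightarrow> 'a::banach"
  assumes "L1_fun f" and A: "bounded_linear A"
  shows "bochner_integral (\<lambda>x. A (f x)) = A (bochner_integral f)"
proof -
  interpret A: bounded_linear A by fact
  obtain s where s: "approx_seq s f"
    using assms unfolding L1_fun_def by blast
  obtain K where K: "0 \<le> K" "\<And>x. norm (A x) \<le> norm x * K" using A.nonneg_bounded by blast
  have f: "strongly_measurable f"
    using assms unfolding L1_fun_def by auto
  have "sbi (\<lambda>x. A (s n x))" for n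
    using s unfolding approx_seq_def
    by (intro simple_bochner_integrable_compose2[where p = "\<lambda>x y. A x"]) (auto simp: A.zero)
  then have "approx_seq (\<lambda>n x. A (s n x)) (\<lambda>x. A (f x))"
    using K by (intro approx_seq_dominated1[OF _ f s, where K = K])
      (auto simp: mult.commute simp flip: A.diff)
  moreover have "(\<lambda>n. sint (\<lambda>x. A (s n x))) \<longlonglongrightarrow> A (bochner_integral f)"
    using approx_seq_sbi[OF s] bochner_integral_limit[OF f s] A.linear_axioms
    by (simp add: simple_bochner_integral_linear A.tendsto)
  ultimately show ?thesis
    using L1_fun_strongly_measurable[OF L1_fun_bounded_linear[OF assms]] by (intro bochner_integral_eqI)
qed

text \<open>The reverse triangle inequality under the integral. It carries the bound of an integral
  by the integral of the norm from simple functions to their limits.\<close>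

lemma approx_seq_integral_norm_tendsto:
  assumes f: "strongly_measurable f" and s: "approx_seq s f" and fin: "integrable lborel (\<lambda>x. norm (f x))"
  shows "(\<lambda>n. \<integral>x. norm (s n x) \<partial>lborel) \<longlonglongrightarrow> (\<integral>x. norm (f x) \<partial>lborel)"
proof -
  have int: "integrable lborel (\<lambda>x. norm (s n x))" for n
    using L1_fun_integrable_norm[OF L1_fun_sbi[OF approx_seq_sbi[OF s]]] .
  have intd: "integrable lborel (\<lambda>x. norm (f x - s n x))" for n
  proof (rule Bochner_Integration.integrable_bound[OF Bochner_Integration.integrable_add[OF fin int]])
    show "(\<lambda>x. norm (f x - s n x)) \<in> borel_measurable lborel"
      using f approx_seq_sbi[OF s] by (rule borel_measurable_norm_diff_sbi)
  qed (auto intro: norm_triangle_ineq4)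
  have e: "(\<integral>\<^sup>+x. ennreal (norm (f x - s n x)) \<partial>lborel) = ennreal (\<integral>x. norm (f x - s n x) \<partial>lborel)" for n
    using intd by (intro nn_integral_eq_integral) auto
  have "(\<lambda>n. \<integral>x. norm (f x - s n x) \<partial>lborel) \<longlonglongrightarrow> 0"
    using s unfolding approx_seq_def e by (simp add: ennreal_tendsto_0_iff)
  then have "(\<lambda>n. (\<integral>x. norm (s n x) \<partial>lborel) - (\<integral>x. norm (f x) \<partial>lborel)) \<longlonglongrightarrow> 0"
  proof (rule Lim_null_comparison[rotated])
    show "\<forall>\<^sub>F n in sequentially. norm ((\<integral>x. norm (s n x) \<partial>lborel) - (\<integral>x. norm (f x) \<partial>lborel))
        \<le> (\<integral>x. norm (f x - s n x) \<partial>lborel)"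
    proof (intro always_eventually allI)
      fix n
      have "norm ((\<integral>x. norm (s n x) \<partial>lborel) - (\<integral>x. norm (f x) \<partial>lborel))
          = norm (\<integral>x. norm (s n x) - norm (f x) \<partial>lborel)"
        by (subst Bochner_Integration.integral_diff[OF int fin]) simp
      also have "\<dots> \<le> (\<integral>x. norm (norm (s n x) - norm (f x)) \<partial>lborel)"
        by (rule integral_norm_bound)
      also have "\<dots> \<le> (\<integral>x. norm (f x - s n x) \<partial>lborel)"
      proof (rule integral_mono)
        show "integrable lborel (\<lambda>x. norm (norm (s n x) - norm (f x)))"
          using Bochner_Integration.integrable_norm[OF Bochner_Integration.integrable_diff[OF int fin]] .
        show "norm (norm (s n x) - norm (f x)) \<le> norm (f x - s n x)" for x
          using norm_triangle_ineq3[of "s n x" "f x"] by (simp add: norm_minus_commute)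
      qed (rule intd)
      finally show "norm ((\<integral>x. norm (s n x) \<partial>lborel) - (\<integral>x. norm (f x) \<partial>lborel))
        \<le> (\<integral>x. norm (f x - s n x) \<partial>lborel)" .
    qed
  qed
  then show ?thesis by (rule LIM_zero_cancel)
qed

lemma norm_bochner_integral_le:
  fixes f :: "real \<Rightarrow> 'a::banach"
  assumes f: "L1_fun f"
  shows "norm (bochner_integral f) \<le> (\<integral>x. norm (f x) \<partial>lborel)"
proof -
  obtain s where s: "approx_seq s f"
    using assms unfolding L1_fun_def by blast
  have "norm (sint (s n)) \<le> (\<integral>x. norm (s n x) \<partial>lborel)" for n
  proof -
    have "ennreal (norm (sint (s n))) \<le> (\<integral>\<^sup>+x. ennreal (norm (s n x)) \<partial>lborel)"
      by (intro norm_sint_le_nn_integral approx_seq_sbi[OF s])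
    also have "\<dots> = ennreal (\<integral>x. norm (s n x) \<partial>lborel)"
      using L1_fun_integrable_norm[OF L1_fun_sbi[OF approx_seq_sbi[OF s]]]
      by (intro nn_integral_eq_integral) auto
    finally show ?thesis by (simp add: ennreal_le_iff)
  qed
  then show ?thesis
    using LIMSEQ_le[OF tendsto_norm[OF bochner_integral_limit[OF L1_fun_strongly_measurable[OF f] s]]
        approx_seq_integral_norm_tendsto[OF L1_fun_strongly_measurable[OF f] s L1_fun_integrable_norm[OF f]]]
    by blast
qed

text \<open>Cutting the n-th simple approximant off where its norm exceeds 2 |f| preserves pointwise
  convergence and puts all approximants below 2 g, so dominated convergence turns pointwise
  approximation into approximation in the integral norm.\<close>

lemma L1_fun_dominated:
  assumes f: "strongly_measurable f" and g: "integrable lborel g" and le: "\<And>x. norm (f x) \<le> g x"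
  shows "L1_fun f"
proof -
  obtain s where s: "\<And>n. simple_function lborel (s n)" "\<And>x. (\<lambda>n. s n x) \<longlonglongrightarrow> f x"
    using f unfolding strongly_measurable_def by blast
  have fm [measurable]: "f \<in> borel_measurable lborel" using strongly_measurable_borel[OF f] .
  have sm [measurable]: "s n \<in> borel_measurable lborel" for n
    using s(1) by (rule borel_measurable_simple_function)
  have [measurable]: "g \<in> borel_measurable lborel" using g by (rule borel_measurable_integrable)
  define B where "B n = {x. norm (s n x) \<le> 2 * norm (f x)}" for n
  have B: "B n \<in> sets lborel" for n
    unfolding B_def by measurable
  define t where "t n x = indicator (B n) x *\<^sub>R s n x" for n x
  have ts: "simple_function lborel (t n)" for n
    unfolding t_def
    by (rule simple_function_compose2[OF simple_function_indicator[OF B] s(1)])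
  have tle: "norm (t n x) \<le> 2 * norm (f x)" for n x
    by (auto simp: t_def B_def indicator_def)
  \<comment> \<open>Where f vanishes the cut-off forces the value 0; elsewhere the factor 2 leaves
    room for \<open>s n x\<close> to satisfy the bound eventually.\<close>
  have tlim: "(\<lambda>n. t n x) \<longlonglongrightarrow> f x" for x
  proof (cases "f x = 0")
    case True
    then have "t n x = 0" for n using tle[of n x] by simp
    then show ?thesis using True by simp
  next
    case False
    have "(\<lambda>n. norm (s n x)) \<longlonglongrightarrow> norm (f x)" using s(2) by (rule tendsto_norm)
    then have "\<forall>\<^sub>F n in sequentially. norm (s n x) < 2 * norm (f x)"
      using False by (intro order_tendstoD) auto
    then have "\<forall>\<^sub>F n in sequentially. s n x = t n x"
      by eventually_elim (auto simp: t_def B_def)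
    then show ?thesis using s(2) by (rule Lim_transform_eventually[rotated])
  qed
  have nf: "(\<integral>\<^sup>+x. ennreal (norm (t n x)) \<partial>lborel) < \<infinity>" for n
  proof -
    have "(\<integral>\<^sup>+x. ennreal (norm (t n x)) \<partial>lborel) \<le> (\<integral>\<^sup>+x. ennreal (norm (2 * g x)) \<partial>lborel)"
      using tle le by (intro nn_integral_mono ennreal_leI) (smt (verit) real_norm_def)
    also have "\<dots> < \<infinity>"
      using integrable_mult_right[OF g, of 2] unfolding integrable_iff_bounded by blast
    finally show ?thesis .
  qed
  have tsbi: "sbi (t n)" for n
    using ts nf by (rule simple_bochner_integrableI_bounded)
  have [measurable]: "(\<lambda>x. norm (f x - t n x)) \<in> borel_measurable lborel" for n
    using f tsbi by (rule borel_measurable_norm_diff_sbi)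
  have "(\<lambda>n. \<integral>\<^sup>+x. ennreal (norm (f x - t n x)) \<partial>lborel) \<longlonglongrightarrow> (\<integral>\<^sup>+x. 0 \<partial>(lborel :: real measure))"
  proof (rule nn_integral_dominated_convergence[where w = "\<lambda>x. ennreal (3 * g x)"])
    show "AE x in lborel. ennreal (norm (f x - t n x)) \<le> ennreal (3 * g x)" for n
    proof (rule AE_I2, rule ennreal_leI)
      fix x
      show "norm (f x - t n x) \<le> 3 * g x"
        using norm_triangle_ineq4[of "f x" "t n x"] tle[of n x] le[of x] by linarith
    qed
    have "(\<integral>\<^sup>+x. ennreal (3 * g x) \<partial>lborel) \<le> (\<integral>\<^sup>+x. ennreal (norm (3 * g x)) \<partial>lborel)"
      by (intro nn_integral_mono ennreal_leI) auto
    also have "\<dots> < \<infinity>"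
      using integrable_mult_right[OF g, of 3] unfolding integrable_iff_bounded by blast
    finally show "(\<integral>\<^sup>+x. ennreal (3 * g x) \<partial>lborel) < \<infinity>" .
    show "AE x in lborel. (\<lambda>n. ennreal (norm (f x - t n x))) \<longlonglongrightarrow> 0"
    proof (rule AE_I2)
      fix x
      have "(\<lambda>n. norm (f x - t n x)) \<longlonglongrightarrow> norm (f x - f x)"
        using tlim[of x] by (intro tendsto_intros)
      then show "(\<lambda>n. ennreal (norm (f x - t n x))) \<longlonglongrightarrow> 0"
        by (simp add: ennreal_tendsto_0_iff)
    qed
  qed (use fm tsbi in auto)
  then have "approx_seq t f"
    unfolding approx_seq_def using tsbi by simp
  then show ?thesis using f unfolding L1_fun_def by blast
qed

text \<open>Precomposition with finitely valued maps \<open>p n\<close> converging to the identity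
  produces simple functions, so nothing is asked of the target space.\<close>

lemma strongly_measurable_continuous:
  fixes f :: "real \<Rightarrow> 'a::real_normed_vector"
  assumes "continuous_on UNIV f"
  shows "strongly_measurable f"
  unfolding strongly_measurable_def
proof (intro exI conjI allI)
  \<comment> \<open>Rounds down to the grid of mesh 1/(n+1) inside [-n,n] and is 0 outside; the
    window makes the range finite.\<close>
  define p where "p n x = (if \<bar>x\<bar> \<le> real n then \<lfloor>real (Suc n) * x\<rfloor> / real (Suc n) else 0)" for n and x :: real
  show "simple_function lborel (\<lambda>x. f (p n x))" for n
  proof -
    have [measurable]: "p n \<in> borel_measurable borel"
      unfolding p_def by measurable
    have "p n ` UNIV \<subseteq> (\<lambda>k::int. k / real (Suc n)) ` {-(int n * int (Suc n)) - 1..int n * int (Suc n)} \<union> {0}"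
    proof (rule image_subsetI)
      fix x :: real
      show "p n x \<in> (\<lambda>k::int. k / real (Suc n)) ` {-(int n * int (Suc n)) - 1..int n * int (Suc n)} \<union> {0}"
      proof (cases "\<bar>x\<bar> \<le> real n")
        case True
        then have "real (Suc n) * x \<le> real (Suc n) * real n" "real (Suc n) * (- real n) \<le> real (Suc n) * x"
          by (intro mult_left_mono; simp)+
        then have "\<lfloor>real (Suc n) * x\<rfloor> \<le> int n * int (Suc n)" "-(int n * int (Suc n)) - 1 \<le> \<lfloor>real (Suc n) * x\<rfloor>"
          by (simp_all add: floor_le_iff le_floor_iff algebra_simps)
        then show ?thesis using True by (auto simp: p_def)
      qed (simp add: p_def)
    qed
    then have "finite (p n ` UNIV)" by (rule finite_subset) simp
    then have "simple_function lborel (p n)"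
      by (simp add: simple_function_borel_measurable)
    then show ?thesis by (rule simple_function_compose1)
  qed
  fix x
  have "(\<lambda>n. p n x) \<longlonglongrightarrow> x"
  proof (rule LIMSEQ_I)
    fix r :: real assume "0 < r"
    obtain N where N: "\<bar>x\<bar> + 1/r < real N" using reals_Archimedean2 by blast
    have "norm (p n x - x) < r" if "n \<ge> N" for n
    proof -
      have 1: "\<bar>x\<bar> \<le> real n" "1/r < real (Suc n)" using N that \<open>0<r\<close>
        by (smt (verit) divide_pos_pos of_nat_mono of_nat_Suc)+
      have "\<bar>\<lfloor>real (Suc n) * x\<rfloor> - real (Suc n) * x\<bar> \<le> 1" by linarith
      then have "\<bar>\<lfloor>real (Suc n) * x\<rfloor> - real (Suc n) * x\<bar> / real (Suc n) \<le> 1 / real (Suc n)"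
        by (rule divide_right_mono) simp
      moreover have "\<bar>\<lfloor>real (Suc n) * x\<rfloor> - real (Suc n) * x\<bar> / real (Suc n) = \<bar>p n x - x\<bar>"
        using 1 by (simp add: p_def field_simps del: of_nat_Suc)
      moreover have "1 / real (Suc n) < r" using 1 \<open>0<r\<close> by (simp add: field_simps)
      ultimately show ?thesis by simp
    qed
    then show "\<exists>no. \<forall>n\<ge>no. norm (p n x - x) < r" by blast
  qed
  moreover have "isCont f x" using assms by (simp add: continuous_on_eq_continuous_at)
  ultimately show "(\<lambda>n. f (p n x)) \<longlonglongrightarrow> f x"
    using isCont_tendsto_compose by blast
qed

subsection \<open>Completeness of the space of integrable functions\<close>

lemma L1_fun_rep: "L1_fun (rep_L1 F)"
  using Quotient_rep_reflp[OF Quotient_L1, of F] by (simp add: L1_rel_def)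

lemma abs_rep_L1: "abs_L1 (rep_L1 F) = F"
  by (rule Quotient_abs_rep[OF Quotient_L1])

lemma L1_rel_refl: "L1_fun f \<Longrightarrow> L1_rel f f"
  by (simp add: L1_rel_def)

lemma abs_L1_eqI: "L1_fun f \<Longrightarrow> L1_fun g \<Longrightarrow> AE x in lborel. f x = g x \<Longrightarrow> abs_L1 f = abs_L1 g"
  using Quotient_rel_abs[OF Quotient_L1, of f g] by (simp add: L1_rel_def)

lemma rep_abs_L1: "L1_fun f \<Longrightarrow> AE x in lborel. rep_L1 (abs_L1 f) x = f x"
  using Quotient_rep_abs[OF Quotient_L1, OF L1_rel_refl[of f]] by (simp add: L1_rel_def)

lemma norm_abs_L1: "L1_fun f \<Longrightarrow> norm (abs_L1 f) = (\<integral>x. norm (f x) \<partial>lborel)"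
  by (rule norm_L1.abs_eq[OF L1_rel_refl])

lemma norm_L1_rep: "norm F = (\<integral>x. norm (rep_L1 F x) \<partial>lborel)"
  using norm_abs_L1[OF L1_fun_rep] by (simp add: abs_rep_L1)

lemma plus_abs_L1: "L1_fun f \<Longrightarrow> L1_fun g \<Longrightarrow> abs_L1 f + abs_L1 g = abs_L1 (\<lambda>x. f x + g x)"
  by (rule plus_L1.abs_eq[OF L1_rel_refl L1_rel_refl])

lemma scaleR_abs_L1: "L1_fun f \<Longrightarrow> r *\<^sub>R abs_L1 f = abs_L1 (\<lambda>x. r *\<^sub>R f x)"
  by (rule scaleR_L1.abs_eq[OF L1_rel_refl])

lemma scaleC_abs_L1: "L1_fun f \<Longrightarrow> c *\<^sub>C abs_L1 f = abs_L1 (\<lambda>x. c *\<^sub>C f x)"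
  by (rule scaleC_L1.abs_eq[OF L1_rel_refl])

lemma translate_abs_L1: "L1_fun f \<Longrightarrow> L1_translate d (abs_L1 f) = abs_L1 (\<lambda>x. f (x - d))"
  by (rule L1_translate.abs_eq[OF L1_rel_refl])

lemma L1_fun_uminus: "L1_fun f \<Longrightarrow> L1_fun (\<lambda>x. - f x)"
  using L1_fun_bounded_linear[OF _ bounded_linear_minus[OF bounded_linear_ident]] .

lemma L1_fun_diff: "L1_fun f \<Longrightarrow> L1_fun g \<Longrightarrow> L1_fun (\<lambda>x. f x - g x)"
  using L1_fun_add[OF _ L1_fun_uminus] by fastforce

lemma minus_abs_L1:
  assumes "L1_fun f" "L1_fun g"
  shows "abs_L1 f - abs_L1 g = abs_L1 (\<lambda>x. f x - g x)"
proof -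
  have "abs_L1 f - abs_L1 g = abs_L1 f + abs_L1 (\<lambda>x. - g x)"
    using uminus_L1.abs_eq[OF L1_rel_refl[OF assms(2)]] by (simp add: minus_L1_def)
  then show ?thesis using assms by (simp add: plus_abs_L1 L1_fun_uminus)
qed

lemma nn_integral_norm_L1:
  "L1_fun f \<Longrightarrow> (\<integral>\<^sup>+x. ennreal (norm (f x)) \<partial>lborel) = ennreal (norm (abs_L1 f))"
  by (simp add: norm_abs_L1 nn_integral_eq_integral L1_fun_integrable_norm)

lemma approx_seq_abs_L1:
  assumes f: "L1_fun f" and s: "approx_seq s f"
  shows "(\<lambda>n. abs_L1 (s n)) \<longlonglongrightarrow> abs_L1 f"
proof -
  have sn: "L1_fun (s n)" for n using approx_seq_sbi[OF s] by (rule L1_fun_sbi)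
  have "(\<lambda>n. ennreal (norm (abs_L1 f - abs_L1 (s n)))) \<longlonglongrightarrow> 0"
    using s unfolding approx_seq_def
    by (simp add: minus_abs_L1 f sn flip: nn_integral_norm_L1[OF L1_fun_diff[OF f sn]])
  then have "(\<lambda>n. norm (abs_L1 f - abs_L1 (s n))) \<longlonglongrightarrow> 0"
    by (simp add: ennreal_tendsto_0_iff)
  then have "(\<lambda>n. norm (abs_L1 (s n) - abs_L1 f)) \<longlonglongrightarrow> 0"
    by (simp add: norm_minus_commute)
  then show ?thesis by (simp add: LIM_zero_iff tendsto_norm_zero_iff)
qed

lemma sbi_dense_L1:
  assumes "0 < e"
  shows "\<exists>s. sbi s \<and> norm (F - abs_L1 s) < e"
proof -
  obtain s where s: "approx_seq s (rep_L1 F)"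
    using L1_fun_rep[of F] unfolding L1_fun_def by blast
  have "(\<lambda>n. abs_L1 (s n)) \<longlonglongrightarrow> F"
    using approx_seq_abs_L1[OF L1_fun_rep s] by (simp add: abs_rep_L1)
  from LIMSEQ_D[OF this assms] obtain n where "norm (abs_L1 (s n) - F) < e" by blast
  then show ?thesis using approx_seq_sbi[OF s] by (auto simp: norm_minus_commute)
qed

text \<open>Riesz-Fischer for simple functions: the sum of the norms of successive differences has
  integral at most 2 K, so it is finite outside a null set, and the tails of the same sum control
  the distance to the limit.\<close>

lemma sbi_rapid_convergent:
  fixes s :: "nat \<Rightarrow> real \<Rightarrow> 'a::banach"
  assumes s: "\<And>k. sbi (s k)"
    and d: "\<And>k. norm (abs_L1 (s (Suc k)) - abs_L1 (s k)) \<le> K * (1/2)^k"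
  shows "\<exists>F. \<forall>k. norm (F - abs_L1 (s k)) \<le> K * 2 * (1/2)^k"
proof -
  have Lk: "L1_fun (s k)" for k using s by (rule L1_fun_sbi)
  have K: "0 \<le> K" using norm_ge_zero[of "abs_L1 (s (Suc 0)) - abs_L1 (s 0)"] d[of 0]
    by (metis mult.right_neutral order_trans power_0)
  have ms [measurable]: "s k \<in> borel_measurable lborel" for k
    using sbi_simple[OF s] by (rule borel_measurable_simple_function)
  define \<delta> where "\<delta> k x = norm (s (Suc k) x - s k x)" for k x
  have m\<delta> [measurable]: "\<delta> k \<in> borel_measurable lborel" for k
    unfolding \<delta>_def[abs_def]
    by (rule borel_measurable_norm_diff_sbi[OF L1_fun_strongly_measurable[OF Lk] s])
  have int\<delta>: "(\<integral>\<^sup>+x. ennreal (\<delta> k x) \<partial>lborel) \<le> ennreal (K * (1/2)^k)" for k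
    unfolding \<delta>_def nn_integral_norm_L1[OF L1_fun_diff[OF Lk Lk]]
    using d[of k] by (simp add: minus_abs_L1 Lk ennreal_leI)
  have tail: "(\<integral>\<^sup>+x. (\<Sum>j. ennreal (\<delta> (j + k) x)) \<partial>lborel) \<le> ennreal (K * 2 * (1/2)^k)" for k
  proof -
    have "(\<integral>\<^sup>+x. (\<Sum>j. ennreal (\<delta> (j + k) x)) \<partial>lborel) = (\<Sum>j. \<integral>\<^sup>+x. ennreal (\<delta> (j + k) x) \<partial>lborel)"
      by (rule nn_integral_suminf) measurable
    also have "\<dots> \<le> (\<Sum>j. ennreal (K * (1/2)^(j + k)))"
      by (intro suminf_le int\<delta>) auto
    also have "\<dots> = ennreal (\<Sum>j. K * (1/2)^(j + k))"
    proof (rule suminf_ennreal2)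
      show "summable (\<lambda>j. K * (1/2)^(j + k))"
        by (intro summable_mult summable_ignore_initial_segment summable_geometric) auto
    qed (use K in auto)
    also have "(\<Sum>j. K * (1/2)^(j + k)) = K * (1/2)^k * (\<Sum>j. (1/2)^j)"
    proof -
      have "(\<Sum>j. K * (1/2)^(j + k)) = (\<Sum>j. K * (1/2)^k * (1/2)^j)"
        by (simp add: power_add mult_ac)
      also have "\<dots> = K * (1/2)^k * (\<Sum>j. (1/2)^j)"
        by (rule suminf_mult) (auto intro: summable_geometric)
      finally show ?thesis .
    qed
    also have "(\<Sum>j. (1/2::real)^j) = 2"
      by (simp add: suminf_geometric)
    finally show ?thesis by (simp add: mult_ac)
  qed
  define N where "N = {x. (\<Sum>j. ennreal (\<delta> j x)) = \<infinity>}"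
  have N: "N \<in> sets lborel" unfolding N_def by measurable
  have AEN: "AE x in lborel. x \<notin> N"
  proof -
    have "(\<integral>\<^sup>+x. (\<Sum>j. ennreal (\<delta> j x)) \<partial>lborel) \<noteq> \<infinity>"
      using tail[of 0] by (auto simp: top_unique)
    then have "AE x in lborel. (\<Sum>j. ennreal (\<delta> j x)) \<noteq> \<infinity>"
      by (intro nn_integral_noteq_infinite) auto
    then show ?thesis by (simp add: N_def)
  qed
  \<comment> \<open>Strong measurability asks for convergence at every point, so the approximants
    are set to 0 on the null set N; they stay simple because N is Borel, and their classes do not
    change.\<close>
  define u where "u k x = indicator (- N) x *\<^sub>R s k x" for k x
  have usimple: "simple_function lborel (u k)" for k
  proof -
    have "simple_function lborel (indicator (- N) :: real \<Rightarrow> real)"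
      by (rule simple_function_indicator) (use N in auto)
    then show ?thesis unfolding u_def
      by (rule simple_function_compose2) (rule sbi_simple[OF s])
  qed
  have usbi: "sbi (u k)" for k
  proof (rule simple_bochner_integrableI_bounded[OF usimple])
    have "(\<integral>\<^sup>+x. ennreal (norm (u k x)) \<partial>lborel) \<le> (\<integral>\<^sup>+x. ennreal (norm (s k x)) \<partial>lborel)"
      by (intro nn_integral_mono) (auto simp: u_def indicator_def)
    also have "\<dots> < \<infinity>" by (simp add: nn_integral_norm_L1[OF Lk])
    finally show "(\<integral>\<^sup>+x. ennreal (norm (u k x)) \<partial>lborel) < \<infinity>" .
  qed
  have ule: "norm (u (Suc k) x - u k x) \<le> \<delta> k x" for k x
    by (auto simp: u_def indicator_def \<delta>_def)
  have sumu: "summable (\<lambda>k. norm (u (Suc k) x - u k x))" for x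
  proof (cases "x \<in> N")
    case True then show ?thesis by (simp add: u_def)
  next
    case False
    then have "summable (\<lambda>j. \<delta> j x)"
      by (intro summable_suminf_not_top) (auto simp: N_def \<delta>_def)
    then show ?thesis by (rule summable_comparison_test') (use ule in auto)
  qed
  have uconv: "convergent (\<lambda>k. u k x)" for x
  proof -
    have "summable (\<lambda>k. u (Suc k) x - u k x)" using sumu by (rule summable_norm_cancel)
    then have "convergent (\<lambda>n. \<Sum>k<n. u (Suc k) x - u k x)" by (simp add: summable_iff_convergent)
    then have "convergent (\<lambda>n. u n x - u 0 x)"
      using sum_lessThan_telescope[of "\<lambda>k. u k x"] by simp
    then have "convergent (\<lambda>n. (u n x - u 0 x) + u 0 x)"
      by (intro convergent_add convergent_const)
    then show ?thesis by simp
  qed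
  define f where "f x = lim (\<lambda>k. u k x)" for x
  have ulim: "(\<lambda>k. u k x) \<longlonglongrightarrow> f x" for x
    using uconv unfolding f_def convergent_LIMSEQ_iff .
  have smf: "strongly_measurable f"
    unfolding strongly_measurable_def using usimple ulim by blast
  have fu: "ennreal (norm (f x - u k x)) \<le> (\<Sum>j. ennreal (\<delta> (j + k) x))" for x k
  proof -
    have lim1: "(\<lambda>n. ennreal (norm (u (n + k) x - u k x))) \<longlonglongrightarrow> ennreal (norm (f x - u k x))"
      by (intro tendsto_ennrealI tendsto_intros LIMSEQ_ignore_initial_segment ulim)
    have "ennreal (norm (u (n + k) x - u k x)) \<le> (\<Sum>j. ennreal (\<delta> (j + k) x))" for n
    proof -
      have "u (n + k) x - u k x = (\<Sum>j<n. u (Suc (j + k)) x - u (j + k) x)"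
        using sum_lessThan_telescope[of "\<lambda>j. u (j + k) x" n] by simp
      then have "norm (u (n + k) x - u k x) \<le> (\<Sum>j<n. \<delta> (j + k) x)"
        using ule by (auto intro!: sum_norm_le)
      then have "ennreal (norm (u (n + k) x - u k x)) \<le> (\<Sum>j<n. ennreal (\<delta> (j + k) x))"
        by (simp add: sum_ennreal \<delta>_def ennreal_leI)
      also have "\<dots> \<le> (\<Sum>j. ennreal (\<delta> (j + k) x))" by (rule sum_le_suminf) auto
      finally show ?thesis .
    qed
    then show ?thesis by (intro LIMSEQ_le_const2[OF lim1]) auto
  qed
  have intfu: "(\<integral>\<^sup>+x. ennreal (norm (f x - u k x)) \<partial>lborel) \<le> ennreal (K * 2 * (1/2)^k)" for k
    using nn_integral_mono[of lborel, OF fu] tail[of k] by (rule order_trans)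
  have "(\<lambda>k. ennreal (K * 2 * (1/2)^k)) \<longlonglongrightarrow> ennreal (K * 2 * 0)"
    by (intro tendsto_ennrealI tendsto_intros LIMSEQ_power_zero) auto
  then have 0: "(\<lambda>k. ennreal (K * 2 * (1/2)^k)) \<longlonglongrightarrow> 0" by simp
  have "(\<lambda>k. \<integral>\<^sup>+x. ennreal (norm (f x - u k x)) \<partial>lborel) \<longlonglongrightarrow> 0"
    by (rule tendsto_sandwich[OF _ _ tendsto_const 0]) (use intfu in auto)
  then have "approx_seq u f" unfolding approx_seq_def using usbi by blast
  then have Lf: "L1_fun f" using smf unfolding L1_fun_def by blast
  have Lu: "L1_fun (u k)" for k using usbi by (rule L1_fun_sbi)
  have eq: "abs_L1 (u k) = abs_L1 (s k)" for k
    using AEN by (intro abs_L1_eqI Lu Lk) (auto simp: u_def indicator_def elim: eventually_mono)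
  have "norm (abs_L1 f - abs_L1 (s k)) \<le> K * 2 * (1/2)^k" for k
  proof -
    have "ennreal (norm (abs_L1 f - abs_L1 (u k))) \<le> ennreal (K * 2 * (1/2)^k)"
      using intfu[of k] by (simp add: minus_abs_L1 Lf Lu nn_integral_norm_L1[OF L1_fun_diff[OF Lf Lu]])
    then show ?thesis using K by (simp add: eq ennreal_le_iff)
  qed
  then show ?thesis by blast
qed

text \<open>A Cauchy sequence is shadowed by rapidly converging simple functions, so that pointwise
  limits are only ever taken of simple functions.\<close>

instance L1 :: (banach) banach
proof
  fix X :: "nat \<Rightarrow> 'a L1" assume X: "Cauchy X"
  have "\<exists>N. \<forall>m\<ge>N. \<forall>n\<ge>N. norm (X m - X n) < (1/2)^k" for k :: nat
    using X CauchyD[of X "(1/2)^k"] by auto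
  then obtain N where N: "\<And>k m n. m \<ge> N k \<Longrightarrow> n \<ge> N k \<Longrightarrow> norm (X m - X n) < (1/2)^k" by metis
  obtain s where s: "\<And>k. sbi (s k)" "\<And>k. norm (X (N k) - abs_L1 (s k)) < (1/2)^k"
  proof -
    have "\<forall>k. \<exists>s. sbi s \<and> norm (X (N k) - abs_L1 s) < (1/2)^k"
      by (intro allI sbi_dense_L1) simp
    from choice[OF this] show ?thesis using that by blast
  qed
  \<comment> \<open>The chain through \<open>X (N (Suc k))\<close>, a common later term and
    \<open>X (N k)\<close> costs 2 (1/2)^(k+1) + 2 (1/2)^k = 3 (1/2)^k.\<close>
  have "norm (abs_L1 (s (Suc k)) - abs_L1 (s k)) \<le> 3 * (1/2)^k" for k
  proof -
    let ?m = "max (N k) (N (Suc k))"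
    have 1: "norm (abs_L1 (s (Suc k)) - X (N (Suc k))) \<le> (1/2)^Suc k"
      using s(2)[of "Suc k"] by (metis less_imp_le norm_minus_commute)
    have 2: "norm (X (N (Suc k)) - X ?m) \<le> (1/2)^Suc k"
      using N[of "Suc k" "N (Suc k)" ?m] by simp
    have 3: "norm (X ?m - X (N k)) \<le> (1/2)^k"
      using N[of k ?m "N k"] by simp
    have "norm (abs_L1 (s (Suc k)) - abs_L1 (s k)) \<le> (1/2)^Suc k + (1/2)^Suc k + (1/2)^k + (1/2)^k"
      by (rule norm_diff_triangle_le[OF norm_diff_triangle_le[OF norm_diff_triangle_le[OF 1 2] 3]])
        (use s(2)[of k] in simp)
    then show ?thesis by simp
  qed
  from sbi_rapid_convergent[OF s(1) this]
  obtain F where F: "\<And>k. norm (F - abs_L1 (s k)) \<le> 6 * (1/2)^k" by auto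
  have "X \<longlonglongrightarrow> F"
  proof (rule LIMSEQ_I)
    fix r :: real assume "0 < r"
    then obtain k where k: "(1/2::real)^k < r / 8" using real_arch_pow_inv[of "r/8" "1/2"] by auto
    have "norm (X n - F) < r" if "n \<ge> N k" for n
    proof -
      have 1: "norm (X n - X (N k)) \<le> (1/2)^k" using N[OF that order_refl] by simp
      have 2: "norm (X (N k) - abs_L1 (s k)) \<le> (1/2)^k" using s(2)[of k] by simp
      have "norm (X n - F) \<le> (1/2)^k + (1/2)^k + 6 * (1/2)^k"
        by (rule norm_diff_triangle_le[OF norm_diff_triangle_le[OF 1 2]])
          (use F[of k] in \<open>simp add: norm_minus_commute\<close>)
      then show ?thesis using k by simp
    qed
    then show "\<exists>no. \<forall>n\<ge>no. norm (X n - F) < r" by blast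
  qed
  then show "convergent X" by (rule convergentI)
qed

instance L1 :: (cbanach) cbanach ..

subsection \<open>Translations and indicator functions\<close>

lemma L1_induct: "(\<And>f. L1_fun f \<Longrightarrow> P (abs_L1 f)) \<Longrightarrow> P F"
  using L1_fun_rep abs_rep_L1 by metis

lemma integral_translate:
  fixes f :: "real \<Rightarrow> real"
  assumes [measurable]: "f \<in> borel_measurable lborel"
  shows "(\<integral>x. f (x - d) \<partial>lborel) = (\<integral>x. f x \<partial>lborel)"
proof -
  have "(\<integral>x. f x \<partial>lborel) = (\<integral>x. f x \<partial>distr lborel borel (\<lambda>x. x - d))"
    by (simp add: lborel_translate)
  also have "\<dots> = (\<integral>x. f (x - d) \<partial>lborel)"
    using assms by (subst integral_distr) auto
  finally show ?thesis by simp
qed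

lemma norm_L1_translate [simp]: "norm (L1_translate d F) = norm F"
proof (induction F rule: L1_induct)
  case (1 f)
  then show ?case
    using integral_translate[OF borel_measurable_integrable[OF L1_fun_integrable_norm[OF 1]], of d]
    by (simp add: translate_abs_L1 norm_abs_L1 L1_fun_translate)
qed

lemma L1_translate_add [simp]: "L1_translate d (F + G) = L1_translate d F + L1_translate d G"
proof (induction F rule: L1_induct)
  case (1 f)
  show ?case
  proof (induction G rule: L1_induct)
    case (1 g)
    then show ?case using \<open>L1_fun f\<close>
      by (simp add: translate_abs_L1 plus_abs_L1 L1_fun_translate L1_fun_add)
  qed
qed

lemma L1_translate_scaleR [simp]: "L1_translate d (r *\<^sub>R F) = r *\<^sub>R L1_translate d F"
proof (induction F rule: L1_induct)
  case (1 f)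
  then show ?case
    using L1_fun_bounded_linear[OF 1 bounded_linear_scaleR_right]
    by (simp add: translate_abs_L1 scaleR_abs_L1 L1_fun_translate)
qed

lemma L1_translate_scaleC [simp]: "L1_translate d (c *\<^sub>C F) = c *\<^sub>C L1_translate d F"
proof (induction F rule: L1_induct)
  case (1 f)
  then show ?case
    using L1_fun_bounded_linear[OF 1 bounded_linear_scaleC]
    by (simp add: translate_abs_L1 scaleC_abs_L1 L1_fun_translate)
qed

lemma L1_translate_translate [simp]: "L1_translate d (L1_translate e F) = L1_translate (d + e) F"
proof (induction F rule: L1_induct)
  case (1 f)
  then show ?case
    by (simp add: translate_abs_L1 L1_fun_translate[of "\<lambda>x. f (x - e)"] L1_fun_translate diff_diff_eq)
qed

lemma L1_translate_0 [simp]: "L1_translate 0 F = F"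
  by (induction F rule: L1_induct) (simp add: translate_abs_L1)

lemma bounded_linear_translate: "bounded_linear (L1_translate d)"
  by (rule bounded_linear_intro[where K = 1]) auto

lemma L1_translate_diff: "L1_translate d (F - G) = L1_translate d F - L1_translate d G"
  by (rule linear_diff[OF bounded_linear.linear[OF bounded_linear_translate]])

section \<open>Indicator functions as building blocks of L^1\<close>

lemma sbi_indicator:
  assumes "E \<in> fmeasurable lborel"
  shows "sbi (\<lambda>x. indicator E x *\<^sub>R v)"
proof (rule simple_bochner_integrableI_bounded)
  have E [measurable]: "E \<in> sets lborel" and fin: "emeasure lborel E < \<infinity>"
    using assms by (auto simp: fmeasurable_def)
  have "simple_function lborel (indicator E :: real \<Rightarrow> real)"
    by (rule simple_function_indicator[OF E])
  then show "simple_function lborel (\<lambda>x. indicator E x *\<^sub>R v)"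
    by (rule simple_function_compose1)
  have "(\<integral>\<^sup>+x. ennreal (norm (indicator E x *\<^sub>R v)) \<partial>lborel) = (\<integral>\<^sup>+x. ennreal (norm v) * indicator E x \<partial>lborel)"
    by (intro nn_integral_cong) (simp add: indicator_def)
  also have "\<dots> = ennreal (norm v) * emeasure lborel E" by (rule nn_integral_cmult_indicator[OF E])
  also have "\<dots> < \<infinity>" using fin by (simp add: ennreal_mult_less_top)
  finally show "(\<integral>\<^sup>+x. ennreal (norm (indicator E x *\<^sub>R v)) \<partial>lborel) < \<infinity>" .
qed

lemmas L1_fun_indicator_const = L1_fun_sbi[OF sbi_indicator]

lemma norm_L1_indicator:
  assumes "E \<in> fmeasurable lborel"
  shows "norm (L1_indicator E v) = measure lborel E * norm v"
proof -
  have [measurable]: "E \<in> sets borel" using assms by (auto simp: fmeasurable_def)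
  have "norm (L1_indicator E v) = (\<integral>x. norm v * indicator E x \<partial>lborel)"
    unfolding L1_indicator_def norm_abs_L1[OF L1_fun_indicator_const[OF assms]]
    by (intro Bochner_Integration.integral_cong) (auto simp: indicator_def)
  then show ?thesis by simp
qed

lemma bounded_linear_L1_indicator:
  assumes "E \<in> fmeasurable lborel"
  shows "bounded_linear (L1_indicator E)"
proof (rule bounded_linear_intro)
  note L = L1_fun_indicator_const[OF assms]
  show "L1_indicator E (v + w) = L1_indicator E v + L1_indicator E w" for v w :: 'a
    unfolding L1_indicator_def by (simp add: plus_abs_L1 L scaleR_add_right)
  show "L1_indicator E (r *\<^sub>R v) = r *\<^sub>R L1_indicator E v" for r and v :: 'a
    unfolding L1_indicator_def by (simp add: scaleR_abs_L1 L mult.commute)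
  show "norm (L1_indicator E v) \<le> norm v * measure lborel E" for v :: 'a
    by (simp add: norm_L1_indicator assms mult.commute)
qed

lemma L1_indicator_scaleC:
  assumes "E \<in> fmeasurable lborel"
  shows "L1_indicator E (c *\<^sub>C v) = c *\<^sub>C L1_indicator E v"
proof -
  have "indicator E x *\<^sub>R c *\<^sub>C v = c *\<^sub>C indicator E x *\<^sub>R v" for x
    by (simp add: scaleC_scaleC mult.commute flip: scaleC_of_real)
  then show ?thesis
    unfolding L1_indicator_def by (simp add: scaleC_abs_L1 L1_fun_indicator_const[OF assms])
qed

lemma fmeasurable_translate:
  fixes d :: real
  assumes "E \<in> fmeasurable lborel"
  shows "{x. x - d \<in> E} \<in> fmeasurable lborel" "measure lborel {x. x - d \<in> E} = measure lborel E"
proof -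
  have E: "E \<in> sets borel" using assms by (auto simp: fmeasurable_def)
  have 1: "emeasure lborel {x. x - d \<in> E} = emeasure lborel E"
    using E emeasure_distr[of "\<lambda>x. x - d" lborel borel E]
    unfolding lborel_translate by (simp add: vimage_def)
  have 2: "{x. x - d \<in> E} \<in> sets borel"
    using measurable_sets[of "\<lambda>x. x - d" borel borel E] E by (simp add: vimage_def)
  show "{x. x - d \<in> E} \<in> fmeasurable lborel"
    using 1 2 assms by (auto simp: fmeasurable_def)
  show "measure lborel {x. x - d \<in> E} = measure lborel E"
    using 1 by (simp add: measure_def)
qed

lemma L1_translate_indicator:
  assumes "E \<in> fmeasurable lborel"
  shows "L1_translate d (L1_indicator E v) = L1_indicator {x. x - d \<in> E} v"
  unfolding L1_indicator_def translate_abs_L1[OF L1_fun_indicator_const[OF assms]]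
  by (simp add: indicator_def)

text \<open>The sets are the level sets of the nonzero values. They are disjoint, so the norm of the
  sum equals the sum of the norms, and an estimate made term by term loses no constant.\<close>

lemma sbi_decompose:
  fixes s :: "real \<Rightarrow> 'a::real_normed_vector"
  assumes s: "sbi s"
  obtains R :: "'a set" and E where "finite R" "\<And>y. y \<in> R \<Longrightarrow> E y \<in> fmeasurable lborel"
    "abs_L1 s = (\<Sum>y\<in>R. L1_indicator (E y) y)"
    "norm (abs_L1 s) = (\<Sum>y\<in>R. measure lborel (E y) * norm y)"
proof
  define E where "E y = s -` {y}" for y
  have ss: "simple_function lborel s" using s by (rule sbi_simple)
  let ?R = "s ` space lborel - {0}"
  show fin: "finite ?R" using simple_functionD(1)[OF ss] by simp
  show E: "E y \<in> fmeasurable lborel" if "y \<in> ?R" for y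
  proof -
    have 1: "E y \<in> sets lborel" using simple_functionD(2)[OF ss, of "{y}"] by (simp add: E_def)
    have 2: "{x \<in> space lborel. s x \<noteq> 0} \<in> sets lborel"
      using simple_functionD(2)[OF ss, of "- {0}"] by (simp add: vimage_def)
    have "emeasure lborel (E y) \<le> emeasure lborel {x \<in> space lborel. s x \<noteq> 0}"
      using 2 that by (intro emeasure_mono) (auto simp: E_def)
    also have "\<dots> < \<infinity>" using s by (auto simp: simple_bochner_integrable.simps less_top)
    finally show ?thesis using 1 by (simp add: fmeasurable_def)
  qed
  have sum_abs: "abs_L1 (\<lambda>x. \<Sum>y\<in>R. indicator (E y) x *\<^sub>R y) = (\<Sum>y\<in>R. L1_indicator (E y) y)
      \<and> L1_fun (\<lambda>x. \<Sum>y\<in>R. indicator (E y) x *\<^sub>R y)"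
    if "R \<subseteq> ?R" for R
    using finite_subset[OF that fin] that
  proof (induction R rule: finite_induct)
    case empty
    then show ?case by (simp add: L1_fun_zero zero_L1.abs_eq)
  next
    case (insert y R)
    have 1: "L1_fun (\<lambda>x. indicator (E y) x *\<^sub>R y)"
      using insert L1_fun_indicator_const[OF E] by auto
    have 2: "abs_L1 (\<lambda>x. \<Sum>y\<in>R. indicator (E y) x *\<^sub>R y) = (\<Sum>y\<in>R. L1_indicator (E y) y)"
      and 3: "L1_fun (\<lambda>x. \<Sum>y\<in>R. indicator (E y) x *\<^sub>R y)"
      using insert by blast+
    show ?case
      unfolding sum.insert[OF insert(1,2)] 2[symmetric] L1_indicator_def[of "E y"]
      using plus_abs_L1[OF 1 3] L1_fun_add[OF 1 3] by simp
  qed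
  \<comment> \<open>At each x only the term with y = s x survives; with h the identity this recovers
    s, with h = \<open>norm\<close> it computes the norm. The value 0 is left out of the range,
    hence the condition h 0 = 0.\<close>
  have delta: "(\<Sum>y\<in>?R. indicator (E y) x *\<^sub>R h y) = h (s x)" if "h 0 = 0"
    for h :: "'a \<Rightarrow> 'c::real_vector" and x
  proof -
    have "(\<Sum>y\<in>?R. indicator (E y) x *\<^sub>R h y) = (\<Sum>y\<in>?R. if y = s x then h y else 0)"
      by (intro sum.cong) (auto simp: E_def indicator_def)
    also have "\<dots> = h (s x)" using fin that by (auto simp: sum.delta)
    finally show ?thesis .
  qed
  have s_eq: "s = (\<lambda>x. \<Sum>y\<in>?R. indicator (E y) x *\<^sub>R y)"
    using delta[of "\<lambda>y. y"] by (intro ext) (rule sym, simp only:)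
  show "abs_L1 s = (\<Sum>y\<in>?R. L1_indicator (E y) y)"
    by (rule trans[OF arg_cong[OF s_eq, of abs_L1] conjunct1[OF sum_abs[OF order_refl]]])
  have "norm (abs_L1 s) = (\<integral>x. norm (s x) \<partial>lborel)"
    using L1_fun_sbi[OF s] by (rule norm_abs_L1)
  also have "\<dots> = (\<integral>x. (\<Sum>y\<in>?R. indicator (E y) x *\<^sub>R norm y) \<partial>lborel)"
    using delta[of norm] by (intro Bochner_Integration.integral_cong[OF refl]) (simp only: norm_zero)
  also have "\<dots> = (\<Sum>y\<in>?R. \<integral>x. indicator (E y) x *\<^sub>R norm y \<partial>lborel)"
    using E by (intro Bochner_Integration.integral_sum integrable_scaleR_left)
      (auto simp: fmeasurable_def)
  also have "\<dots> = (\<Sum>y\<in>?R. measure lborel (E y) * norm y)"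
    by simp
  finally show "norm (abs_L1 s) = (\<Sum>y\<in>?R. measure lborel (E y) * norm y)" .
qed

text \<open>By the exact decomposition of simple functions, an estimate on the functions
  \<open>L1_indicator E v\<close> extends with the same constant, and density does the rest.
  Operator estimates on L^1(R;X) thus reduce to estimates in X; K = 0 gives equality of
  operators.\<close>

lemma bounded_linear_L1_bound:
  fixes Q :: "'a::real_normed_vector L1 \<Rightarrow> 'b::real_normed_vector"
  assumes Q: "bounded_linear Q"
    and b: "\<And>E v. E \<in> fmeasurable lborel \<Longrightarrow> norm (Q (L1_indicator E v)) \<le> K * measure lborel E * norm v"
  shows "norm (Q F) \<le> K * norm F"
proof -
  interpret Q: bounded_linear Q by fact
  have simple: "norm (Q (abs_L1 s)) \<le> K * norm (abs_L1 s)" if s: "sbi s" for s :: "real \<Rightarrow> 'a"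
  proof -
    from s obtain R :: "'a set" and E where R: "finite R" "\<And>y. y \<in> R \<Longrightarrow> E y \<in> fmeasurable lborel"
      "abs_L1 s = (\<Sum>y\<in>R. L1_indicator (E y) y)"
      "norm (abs_L1 s) = (\<Sum>y\<in>R. measure lborel (E y) * norm y)"
      by (rule sbi_decompose) blast
    have "norm (Q (abs_L1 s)) \<le> (\<Sum>y\<in>R. K * measure lborel (E y) * norm y)"
      unfolding R(3) Q.sum using b R(2) by (intro sum_norm_le) auto
    also have "\<dots> = K * norm (abs_L1 s)" by (simp add: R(4) sum_distrib_left mult.assoc)
    finally show ?thesis .
  qed
  obtain s where s: "approx_seq s (rep_L1 F)"
    using L1_fun_rep[of F] unfolding L1_fun_def by blast
  have lim: "(\<lambda>n. abs_L1 (s n)) \<longlonglongrightarrow> F"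
    using approx_seq_abs_L1[OF L1_fun_rep s] by (simp add: abs_rep_L1)
  show ?thesis
    by (rule LIMSEQ_le[OF tendsto_norm[OF Q.tendsto[OF lim]] tendsto_mult[OF tendsto_const tendsto_norm[OF lim]]])
      (use simple approx_seq_sbi[OF s] in blast)
qed

lemma bounded_linear_L1_eqI:
  assumes Q: "bounded_linear Q" "bounded_linear R"
    and eq: "\<And>E v. E \<in> fmeasurable lborel \<Longrightarrow> Q (L1_indicator E v) = R (L1_indicator E v)"
  shows "Q F = R F"
  using bounded_linear_L1_bound[OF bounded_linear_sub[OF Q], of 0] eq by simp

lemma L1_dense_induct [case_names indicator add limit]:
  fixes P :: "'a::real_normed_vector L1 \<Rightarrow> bool"
  assumes ind: "\<And>E v. E \<in> fmeasurable lborel \<Longrightarrow> P (L1_indicator E v)"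
    and add: "\<And>F G. P F \<Longrightarrow> P G \<Longrightarrow> P (F + G)"
    and lim: "\<And>F. (\<And>e. 0 < e \<Longrightarrow> \<exists>G. norm (F - G) < e \<and> P G) \<Longrightarrow> P F"
  shows "P F"
proof (rule lim)
  have zero: "P 0"
    using ind[of "{}" 0] linear_0[OF bounded_linear.linear[OF bounded_linear_L1_indicator[of "{}"]]]
    by (metis fmeasurable.empty_sets)
  have sum: "P (\<Sum>y\<in>R. h y)" if "finite R" "\<And>y. y \<in> R \<Longrightarrow> P (h y)" for h and R :: "'a set"
    using that by (induction R rule: finite_induct) (auto intro: zero add)
  have simple: "P (abs_L1 s)" if "sbi s" for s
    using that by (rule sbi_decompose) (simp add: sum ind)
  fix e :: real assume "0 < e"
  then show "\<exists>G. norm (F - G) < e \<and> P G" using sbi_dense_L1[of e F] simple by blast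
qed

text \<open>Outer regularity of E yields V; outer regularity of the complement yields a closed
  subset of E, and a large interval makes it compact. Each of the three errors is below e/3.\<close>

lemma fmeasurable_between_compact_open:
  assumes E: "E \<in> fmeasurable lborel" and e: "0 < (e::real)"
  obtains K V :: "real set" where "compact K" "open V" "K \<subseteq> E" "E \<subseteq> V"
    "V - K \<in> fmeasurable lborel" "measure lborel (V - K) < e"
proof -
  have Eb: "E \<in> sets borel" and fin: "emeasure lborel E < \<infinity>"
    using E by (auto simp: fmeasurable_def)
  obtain V where V: "open V" "E \<subseteq> V" "emeasure lborel (V - E) < ennreal (e/3)"
    using outer_regular_lborel[OF Eb, of "e/3"] e by auto
  obtain W where W: "open W" "- E \<subseteq> W" "emeasure lborel (W - (- E)) < ennreal (e/3)"
    using outer_regular_lborel[of "- E" "e/3"] e Eb by auto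
  let ?D = "\<lambda>n::nat. E - {- real n..real n}"
  have "(\<lambda>n. emeasure lborel (?D n)) \<longlonglongrightarrow> emeasure lborel (\<Inter>n. ?D n)"
  proof (rule Lim_emeasure_decseq)
    show "range ?D \<subseteq> sets lborel" using Eb by auto
    show "decseq ?D" by (auto simp: decseq_def)
    show "emeasure lborel (?D n) \<noteq> \<infinity>" for n
      using fin emeasure_mono[of "?D n" E lborel] Eb by (auto simp: top_unique)
  qed
  moreover have "(\<Inter>n. ?D n) = {}"
  proof -
    have "\<exists>n. x \<notin> ?D n" for x
    proof -
      obtain n where "\<bar>x\<bar> < real n" using reals_Archimedean2 by blast
      then have "x \<notin> ?D n" by auto
      then show ?thesis by blast
    qed
    then show ?thesis by blast
  qed
  ultimately have "(\<lambda>n. emeasure lborel (?D n)) \<longlonglongrightarrow> 0"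
    by (simp only: emeasure_empty)
  from order_tendstoD(2)[OF this]
  have "\<forall>\<^sub>F n in sequentially. emeasure lborel (?D n) < ennreal (e/3)"
    using e by simp
  then obtain n where n: "emeasure lborel (?D n) < ennreal (e/3)"
    by (auto simp: eventually_sequentially)
  let ?K = "{- real n..real n} - W"
  have K: "compact ?K" using W(1) by (intro compact_diff) auto
  have Ks: "?K \<subseteq> E" using W(2) by auto
  have [measurable]: "V \<in> sets borel" "W \<in> sets borel" using V(1) W(1) by auto
  have "emeasure lborel (V - ?K) \<le> emeasure lborel ((V - E) \<union> ((W - (- E)) \<union> ?D n))"
    using Eb by (intro emeasure_mono) auto
  also have "\<dots> \<le> emeasure lborel (V - E) + (emeasure lborel (W - (- E)) + emeasure lborel (?D n))"
    using Eb by (intro order_trans[OF emeasure_subadditive] add_left_mono emeasure_subadditive) auto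
  also have "\<dots> < ennreal (e/3) + (ennreal (e/3) + ennreal (e/3))"
    using V(3) W(3) n by (intro add_strict_mono) auto
  also have "\<dots> = ennreal e" using e by (simp flip: ennreal_plus)
  finally have less: "emeasure lborel (V - ?K) < ennreal e" .
  then have fm: "V - ?K \<in> fmeasurable lborel"
    by (auto simp: fmeasurable_def intro: less_trans)
  then have "measure lborel (V - ?K) < e"
    using less e by (simp add: emeasure_eq_measure2 ennreal_less_iff)
  then show ?thesis using that[OF K V(1) Ks V(2) fm] by blast
qed

text \<open>For an indicator function and t smaller than the distance from K to the complement of V,
  a shift keeps K inside V, so E and its translate differ only inside V - K and its translate. The
  passage to limits works because translations are isometries.\<close>

lemma L1_translate_tendsto_0: "((\<lambda>t. L1_translate t F) \<longlongrightarrow> F) (at 0)"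
proof (induction F rule: L1_dense_induct)
  case (indicator E v)
  show ?case
  proof (rule LIM_I)
    fix r :: real assume r: "0 < r"
    \<comment> \<open>Leaves 2 |v| e < r; the summand 1 covers v = 0.\<close>
    define e where "e = r / (2 * (norm v + 1))"
    have e: "0 < e" using r by (simp add: e_def add_nonneg_pos)
    obtain K V where KV: "compact K" "open V" "K \<subseteq> E" "E \<subseteq> V"
      "V - K \<in> fmeasurable lborel" "measure lborel (V - K) < e"
      using fmeasurable_between_compact_open[OF indicator e] by blast
    obtain d where d: "d > 0" "(\<Union>x\<in>K. ball x d) \<subseteq> V"
      using compact_subset_open_imp_ball_epsilon_subset[OF KV(1,2)] KV(3,4) by blast
    have "norm (L1_translate t (L1_indicator E v) - L1_indicator E v) < r" if t: "norm (t - 0) < d" for t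
    proof -
      have Kt: "x + t \<in> V" "x - t \<in> V" if "x \<in> K" for x
        using d(2) that t by (auto simp: dist_real_def intro!: subsetD[OF d(2)] bexI[of _ x])
      note Et = fmeasurable_translate(1)[OF indicator, of t]
      note D = fmeasurable_translate[OF KV(5), of t]
      note i1 = L1_fun_indicator_const[OF Et] L1_fun_indicator_const[OF indicator]
      have "norm (L1_translate t (L1_indicator E v) - L1_indicator E v)
          = (\<integral>x. norm (indicator {x. x - t \<in> E} x *\<^sub>R v - indicator E x *\<^sub>R v) \<partial>lborel)"
        unfolding L1_translate_indicator[OF indicator] unfolding L1_indicator_def
          minus_abs_L1[OF i1] norm_abs_L1[OF L1_fun_diff[OF i1]] ..
      also have "\<dots> \<le> (\<integral>x. norm v * indicator (V - K) x + norm v * indicator {x. x - t \<in> V - K} x \<partial>lborel)"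
      proof (rule integral_mono)
        show "integrable lborel (\<lambda>x. norm (indicator {x. x - t \<in> E} x *\<^sub>R v - indicator E x *\<^sub>R v))"
          by (rule L1_fun_integrable_norm[OF L1_fun_diff[OF i1]])
        show "integrable lborel (\<lambda>x. norm v * indicator (V - K) x + norm v * indicator {x. x - t \<in> V - K} x)"
          using KV(5) D(1)
          by (intro Bochner_Integration.integrable_add integrable_mult_right) (auto simp: fmeasurable_def)
        fix x
        show "norm (indicator {x. x - t \<in> E} x *\<^sub>R v - indicator E x *\<^sub>R v)
            \<le> norm v * indicator (V - K) x + norm v * indicator {x. x - t \<in> V - K} x"
          using Kt(1)[of "x - t"] Kt(2)[of x] KV(3,4) by (auto simp: indicator_def split: if_splits)
      qed
      also have "\<dots> = 2 * norm v * measure lborel (V - K)"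
        using KV(5) D by (subst Bochner_Integration.integral_add) (auto simp: fmeasurable_def)
      also have "\<dots> \<le> 2 * norm v * e"
        using KV(6) by (intro mult_left_mono) auto
      also have "\<dots> < 2 * (norm v + 1) * e" using e by (intro mult_strict_right_mono) auto
      also have "\<dots> = r" by (simp add: e_def add_nonneg_eq_0_iff)
      finally show ?thesis .
    qed
    then show "\<exists>s>0. \<forall>x. x \<noteq> 0 \<and> norm (x - 0) < s \<longrightarrow>
        norm (L1_translate x (L1_indicator E v) - L1_indicator E v) < r"
      using d(1) by blast
  qed
next
  case (add F G)
  then show ?case by (auto intro: tendsto_add)
next
  case (limit F)
  show ?case
  proof (rule LIM_I)
    fix r :: real assume r: "0 < r"
    then obtain G where G: "norm (F - G) < r/3" "((\<lambda>t. L1_translate t G) \<longlongrightarrow> G) (at 0)"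
      using limit[of "r/3"] by auto
    obtain s where s: "s > 0" "\<And>t. t \<noteq> 0 \<Longrightarrow> norm (t - 0) < s \<Longrightarrow> norm (L1_translate t G - G) < r/3"
      using LIM_D[OF G(2), of "r/3"] r by auto
    have "norm (L1_translate t F - F) < r" if "t \<noteq> 0" "norm (t - 0) < s" for t
    proof -
      have 1: "norm (L1_translate t F - L1_translate t G) \<le> r/3"
        using G(1) by (simp flip: L1_translate_diff)
      have 2: "norm (L1_translate t G - G) < r/3" using s that by blast
      have "norm (L1_translate t F - G) < r/3 + r/3"
        using norm_triangle_ineq[of "L1_translate t F - L1_translate t G" "L1_translate t G - G"] 1 2 by simp
      then show ?thesis
        using norm_triangle_ineq[of "L1_translate t F - G" "G - F"] G(1) by (simp add: norm_minus_commute)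
    qed
    then show "\<exists>s>0. \<forall>t. t \<noteq> 0 \<and> norm (t - 0) < s \<longrightarrow> norm (L1_translate t F - F) < r"
      using s(1) by blast
  qed
qed

text \<open>Joint continuity, from strong continuity in the shift and isometry in the function. It
  makes y \<mapsto> \<open>L1_translate y (S (g y))\<close> strongly measurable, hence admissible as
  an integrand.\<close>

lemma tendsto_L1_translate:
  assumes x: "x \<longlonglongrightarrow> a" and y: "y \<longlonglongrightarrow> b"
  shows "(\<lambda>n::nat. L1_translate (x n) (y n)) \<longlonglongrightarrow> L1_translate a b"
proof (rule LIM_zero_cancel, rule Lim_null_comparison)
  have t0: "isCont (\<lambda>t. L1_translate t b) 0"
    using L1_translate_tendsto_0[of b] by (simp add: isCont_def)
  have xa: "(\<lambda>n. x n - a) \<longlonglongrightarrow> 0" using x by (simp add: LIM_zero)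
  have "(\<lambda>n. L1_translate (x n - a) b) \<longlonglongrightarrow> b"
    using isCont_tendsto_compose[OF t0 xa] by simp
  then have "(\<lambda>n. norm (y n - b) + norm (L1_translate (x n - a) b - b)) \<longlonglongrightarrow> 0 + 0"
    using y by (intro tendsto_add) (auto simp: tendsto_norm_zero_iff LIM_zero_iff)
  then show "(\<lambda>n. norm (y n - b) + norm (L1_translate (x n - a) b - b)) \<longlonglongrightarrow> 0" by simp
  show "\<forall>\<^sub>F n in sequentially. norm (L1_translate (x n) (y n) - L1_translate a b)
      \<le> norm (y n - b) + norm (L1_translate (x n - a) b - b)"
  proof (intro always_eventually allI)
    fix n
    have "norm (L1_translate (x n) b - L1_translate a b) = norm (L1_translate a (L1_translate (x n - a) b - b))"
      by (simp add: L1_translate_diff)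
    then have "norm (L1_translate (x n) b - L1_translate a b) = norm (L1_translate (x n - a) b - b)"
      by (simp only: norm_L1_translate)
    moreover have "norm (L1_translate (x n) (y n) - L1_translate (x n) b) = norm (y n - b)"
      by (simp flip: L1_translate_diff)
    ultimately show "norm (L1_translate (x n) (y n) - L1_translate a b)
      \<le> norm (y n - b) + norm (L1_translate (x n - a) b - b)"
      using norm_triangle_ineq[of "L1_translate (x n) (y n) - L1_translate (x n) b"
          "L1_translate (x n) b - L1_translate a b"] by simp
  qed
qed

lemma continuous_on_L1_translate: "continuous_on S (\<lambda>t. L1_translate t F)"
  by (auto simp: continuous_on_sequentially o_def intro: tendsto_L1_translate)

subsection \<open>Measure preserving substitutions\<close>

lemma lborel_reflect: "distr lborel borel (\<lambda>y::real. c - y) = lborel"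
proof -
  have "lborel = density (distr lborel borel (\<lambda>x::real. c + (- 1) * x)) (\<lambda>_. ennreal \<bar>- 1\<bar>)"
    by (rule lborel_real_affine) simp
  then show ?thesis by (simp add: density_1)
qed

lemma simple_function_measurable_comp:
  assumes s: "simple_function N s" and h: "h \<in> measurable M N"
  shows "simple_function M (\<lambda>x. s (h x))"
  unfolding simple_function_def
proof (intro conjI ballI)
  have "(\<lambda>x. s (h x)) ` space M \<subseteq> s ` space N" using h by (auto simp: measurable_def)
  then show "finite ((\<lambda>x. s (h x)) ` space M)"
    using simple_functionD(1)[OF s] by (rule finite_subset)
  fix y
  have "h -` (s -` {y} \<inter> space N) \<inter> space M \<in> sets M"
    by (rule measurable_sets[OF h simple_functionD(2)[OF s]])
  moreover have "h -` (s -` {y} \<inter> space N) \<inter> space M = (\<lambda>x. s (h x)) -` {y} \<inter> space M"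
    using h by (auto simp: measurable_def)
  ultimately show "(\<lambda>x. s (h x)) -` {y} \<inter> space M \<in> sets M" by simp
qed

text \<open>Preimages of level sets keep their measure, so the substitution can be made in the
  approximating simple functions with unchanged errors and unchanged integrals.\<close>

lemma approx_seq_comp:
  fixes \<phi> :: "real \<Rightarrow> real"
  assumes \<phi> [measurable]: "\<phi> \<in> borel_measurable borel" and d: "distr lborel borel \<phi> = lborel"
    and f: "strongly_measurable f" and s: "approx_seq s f"
  shows "approx_seq (\<lambda>n x. s n (\<phi> x)) (\<lambda>x. f (\<phi> x))"
    and "sint (\<lambda>x. s n (\<phi> x)) = sint (s n)"
    and "strongly_measurable (\<lambda>x. f (\<phi> x))"
proof -
  have \<phi>': "\<phi> \<in> measurable lborel lborel" by simp
  have simple: "simple_function lborel (\<lambda>x. s n (\<phi> x))" for n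
    using sbi_simple[OF approx_seq_sbi[OF s]] \<phi>' by (rule simple_function_measurable_comp)
  have em: "emeasure lborel (\<phi> -` A) = emeasure lborel A" if "A \<in> sets borel" for A
    using emeasure_distr[of \<phi> lborel borel A] that unfolding d by simp
  have sets: "s n -` A \<in> sets borel" for n A
    using simple_functionD(2)[OF sbi_simple[OF approx_seq_sbi[OF s, of n]], of A] by simp
  have sbi\<phi>: "sbi (\<lambda>x. s n (\<phi> x))" for n
  proof
    show "simple_function lborel (\<lambda>x. s n (\<phi> x))" by (rule simple)
    have "{x \<in> space lborel. s n (\<phi> x) \<noteq> 0} = \<phi> -` (s n -` (- {0}))" by auto
    then have "emeasure lborel {x \<in> space lborel. s n (\<phi> x) \<noteq> 0} = emeasure lborel (s n -` (- {0}))"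
      using em[OF sets] by simp
    also have "\<dots> \<noteq> \<infinity>" using approx_seq_sbi[OF s, of n]
      by (auto simp: simple_bochner_integrable.simps vimage_def)
    finally show "emeasure lborel {x \<in> space lborel. s n (\<phi> x) \<noteq> 0} \<noteq> \<infinity>" .
  qed
  have m: "(\<lambda>x. norm (f x - s n x)) \<in> borel_measurable lborel" for n
    using f approx_seq_sbi[OF s] by (rule borel_measurable_norm_diff_sbi)
  have "(\<integral>\<^sup>+x. ennreal (norm (f (\<phi> x) - s n (\<phi> x))) \<partial>lborel)
      = (\<integral>\<^sup>+x. ennreal (norm (f x - s n x)) \<partial>distr lborel borel \<phi>)" for n
    using m[of n] by (subst nn_integral_distr) auto
  then show "approx_seq (\<lambda>n x. s n (\<phi> x)) (\<lambda>x. f (\<phi> x))"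
    using s sbi\<phi> unfolding approx_seq_def d by simp
  \<comment> \<open>Values of \<open>s n\<close> that the composite misses enter with level sets of
    measure 0, since \<phi> preserves measure but need not be onto.\<close>
  have "sint (\<lambda>x. s n (\<phi> x)) = (\<Sum>y\<in>range (s n). measure lborel (s n -` {y}) *\<^sub>R y)"
  proof -
    have m1: "measure lborel {x. s n (\<phi> x) = y} = measure lborel (s n -` {y})" for y
      using em[OF sets[of n "{y}"]] by (simp add: measure_def vimage_def)
    have sub: "range (\<lambda>x. s n (\<phi> x)) \<subseteq> range (s n)" by auto
    have fin: "finite (range (s n))"
      using simple_functionD(1)[OF sbi_simple[OF approx_seq_sbi[OF s]]] by simp
    show ?thesis
      unfolding simple_bochner_integral_def space_lborel space_borel Collect_conj_eq
    proof (rule sum.mono_neutral_cong_left)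
      show "finite (range (s n))" by (rule fin)
      show "(\<lambda>x. s n (\<phi> x)) ` UNIV \<subseteq> range (s n)" by (rule sub)
      show "\<forall>y\<in>range (s n) - range (\<lambda>x. s n (\<phi> x)). measure lborel (s n -` {y}) *\<^sub>R y = 0"
      proof
        fix y assume "y \<in> range (s n) - range (\<lambda>x. s n (\<phi> x))"
        then have "y \<notin> range (\<lambda>x. s n (\<phi> x))" by blast
        then have "{x. s n (\<phi> x) = y} = {}"
          by (metis (mono_tags, lifting) Collect_empty_eq rangeI)
        then show "measure lborel (s n -` {y}) *\<^sub>R y = 0" using m1[of y] by simp
      qed
      show "measure lborel ({x. x \<in> UNIV} \<inter> {x. s n (\<phi> x) = y}) *\<^sub>R y = measure lborel (s n -` {y}) *\<^sub>R y" for y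
        using m1[of y] by simp
    qed
  qed
  also have "\<dots> = sint (s n)"
    by (simp add: simple_bochner_integral_def vimage_def)
  finally show "sint (\<lambda>x. s n (\<phi> x)) = sint (s n)" .
  obtain u where u: "\<And>n. simple_function lborel (u n)" "\<And>x. (\<lambda>n. u n x) \<longlonglongrightarrow> f x"
    using f unfolding strongly_measurable_def by blast
  show "strongly_measurable (\<lambda>x. f (\<phi> x))" unfolding strongly_measurable_def
    using simple_function_measurable_comp[OF u(1) \<phi>'] u(2) by (intro exI[where x = "\<lambda>n x. u n (\<phi> x)"]) blast
qed

lemma L1_fun_comp:
  fixes \<phi> :: "real \<Rightarrow> real"
  assumes "\<phi> \<in> borel_measurable borel" "distr lborel borel \<phi> = lborel" "L1_fun f"
  shows "L1_fun (\<lambda>x. f (\<phi> x))"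
  using assms approx_seq_comp(1,3)[OF assms(1,2)] unfolding L1_fun_def by blast

lemma bochner_integral_comp:
  fixes \<phi> :: "real \<Rightarrow> real" and f :: "real \<Rightarrow> 'a::banach"
  assumes \<phi>: "\<phi> \<in> borel_measurable borel" "distr lborel borel \<phi> = lborel" and f: "L1_fun f"
  shows "bochner_integral (\<lambda>x. f (\<phi> x)) = bochner_integral f"
proof -
  obtain s where s: "approx_seq s f" using f unfolding L1_fun_def by blast
  note c = approx_seq_comp[OF \<phi> L1_fun_strongly_measurable[OF f] s]
  show ?thesis
    using bochner_integral_limit[OF L1_fun_strongly_measurable[OF f] s]
    by (intro bochner_integral_eqI[OF c(3) c(1)]) (simp add: c(2))
qed

subsection \<open>Pairing with bounded scalar functions\<close>

lemma strongly_measurable_borel_measurable: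
  fixes \<phi> :: "real \<Rightarrow> 'b::{real_normed_vector, second_countable_topology}"
  assumes "\<phi> \<in> borel_measurable borel"
  shows "strongly_measurable \<phi>"
proof -
  have "\<phi> \<in> borel_measurable lborel" using assms by simp
  from borel_measurable_implies_sequence_metric[OF this, of 0]
  show ?thesis unfolding strongly_measurable_def by auto
qed

lemma scaleC_one: "1 *\<^sub>C x = (x :: 'a::complex_normed_vector)"
  using scaleC_of_real[of 1 x] by simp

lemma scaleC_tendsto:
  fixes y :: "nat \<Rightarrow> 'a::complex_normed_vector"
  assumes x: "x \<longlonglongrightarrow> a" and y: "y \<longlonglongrightarrow> b"
  shows "(\<lambda>n. x n *\<^sub>C y n) \<longlonglongrightarrow> a *\<^sub>C b"
proof -
  have "bounded_bilinear (\<lambda>(c::complex) (v::'a). c *\<^sub>C v)"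
  proof
    fix r :: real and a :: complex and v :: 'a
    have r: "r *\<^sub>R a = complex_of_real r * a" by (rule scaleR_conv_of_real)
    show "(r *\<^sub>R a) *\<^sub>C v = r *\<^sub>R a *\<^sub>C v"
      unfolding r scaleC_scaleC[symmetric] scaleC_of_real ..
    show "a *\<^sub>C (r *\<^sub>R v) = r *\<^sub>R a *\<^sub>C v"
      by (simp add: scaleC_of_real[symmetric] scaleC_scaleC mult.commute)
    show "\<exists>K. \<forall>(a::complex) (b::'a). norm (a *\<^sub>C b) \<le> norm a * norm b * K"
      by (intro exI[of _ 1]) (simp add: norm_scaleC)
  qed (rule scaleC_add_left scaleC_add_right)+
  from bounded_bilinear.tendsto[OF this x y] show ?thesis .
qed

text \<open>With a character as weight this is the Fourier transform, with an indicator function the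
  mass of h on a set; values of the transform and coefficients of Riemann sums are both
  instances.\<close>

definition L1_pair :: "(real \<Rightarrow> complex) \<Rightarrow> 'a::complex_normed_vector L1 \<Rightarrow> 'a" where
  "L1_pair \<phi> h = bochner_integral (\<lambda>x. \<phi> x *\<^sub>C rep_L1 h x)"

lemma L1_fun_mult:
  fixes f :: "real \<Rightarrow> 'a::complex_normed_vector"
  assumes \<phi>: "\<phi> \<in> borel_measurable borel" "\<And>x. cmod (\<phi> x) \<le> C" and f: "L1_fun f"
  shows "L1_fun (\<lambda>x. \<phi> x *\<^sub>C f x)"
proof (rule L1_fun_dominated)
  show "strongly_measurable (\<lambda>x. \<phi> x *\<^sub>C f x)"
    by (rule strongly_measurable_compose2[OF strongly_measurable_borel_measurable[OF \<phi>(1)] L1_fun_strongly_measurable[OF f]])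
      (rule scaleC_tendsto)
  show "integrable lborel (\<lambda>x. C * norm (f x))"
    by (intro integrable_mult_right L1_fun_integrable_norm f)
  show "norm (\<phi> x *\<^sub>C f x) \<le> C * norm (f x)" for x
    using \<phi>(2)[of x] by (simp add: norm_scaleC mult_right_mono)
qed

lemma L1_pair_abs:
  assumes "L1_fun f"
  shows "L1_pair \<phi> (abs_L1 f) = bochner_integral (\<lambda>x. \<phi> x *\<^sub>C f x)"
  unfolding L1_pair_def using rep_abs_L1[OF assms]
  by (intro bochner_integral_cong_AE) (auto elim: eventually_mono)

lemma norm_L1_pair_le:
  fixes h :: "'a::cbanach L1"
  assumes \<phi>: "\<phi> \<in> borel_measurable borel" "\<And>x. cmod (\<phi> x) \<le> C"
  shows "norm (L1_pair \<phi> h) \<le> C * norm h"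
proof -
  have "norm (L1_pair \<phi> h) \<le> (\<integral>x. norm (\<phi> x *\<^sub>C rep_L1 h x) \<partial>lborel)"
    unfolding L1_pair_def by (intro norm_bochner_integral_le L1_fun_mult[OF \<phi>] L1_fun_rep)
  also have "\<dots> \<le> (\<integral>x. C * norm (rep_L1 h x) \<partial>lborel)"
  proof (rule integral_mono)
    show "integrable lborel (\<lambda>x. norm (\<phi> x *\<^sub>C rep_L1 h x))"
      by (intro L1_fun_integrable_norm L1_fun_mult[OF \<phi>] L1_fun_rep)
    show "integrable lborel (\<lambda>x. C * norm (rep_L1 h x))"
      by (intro integrable_mult_right L1_fun_integrable_norm L1_fun_rep)
    show "norm (\<phi> x *\<^sub>C rep_L1 h x) \<le> C * norm (rep_L1 h x)" for x
      using \<phi>(2)[of x] by (simp add: norm_scaleC mult_right_mono)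
  qed
  also have "\<dots> = C * norm h" by (simp add: norm_L1_rep)
  finally show ?thesis .
qed

lemma bounded_linear_L1_pair:
  assumes \<phi>: "\<phi> \<in> borel_measurable borel" "\<And>x. cmod (\<phi> x) \<le> C"
  shows "bounded_linear (L1_pair \<phi> :: 'a::cbanach L1 \<Rightarrow> 'a)"
proof (rule bounded_linear_intro)
  show "norm (L1_pair \<phi> h) \<le> norm h * C" for h :: "'a L1"
    using norm_L1_pair_le[OF \<phi>, of h] by (simp add: mult.commute)
  note L = L1_fun_mult[OF \<phi> L1_fun_rep]
  fix g h :: "'a L1" and r :: real
  have "L1_pair \<phi> (g + h) = L1_pair \<phi> (abs_L1 (\<lambda>x. rep_L1 g x + rep_L1 h x))"
    by (simp add: plus_abs_L1[symmetric] L1_fun_rep abs_rep_L1)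
  also have "\<dots> = L1_pair \<phi> g + L1_pair \<phi> h"
    unfolding L1_pair_abs[OF L1_fun_add[OF L1_fun_rep L1_fun_rep]]
    by (simp add: L1_pair_def scaleC_add_right bochner_integral_add L)
  finally show "L1_pair \<phi> (g + h) = L1_pair \<phi> g + L1_pair \<phi> h" .
  have "L1_pair \<phi> (r *\<^sub>R h) = L1_pair \<phi> (abs_L1 (\<lambda>x. r *\<^sub>R rep_L1 h x))"
    by (simp add: scaleR_abs_L1[symmetric] L1_fun_rep abs_rep_L1)
  also have "\<dots> = bochner_integral (\<lambda>x. r *\<^sub>R (\<phi> x *\<^sub>C rep_L1 h x))"
    unfolding L1_pair_abs[OF L1_fun_bounded_linear[OF L1_fun_rep bounded_linear_scaleR_right]]
    by (simp add: scaleC_scaleC mult.commute flip: scaleC_of_real)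
  also have "\<dots> = r *\<^sub>R L1_pair \<phi> h"
    unfolding L1_pair_def by (rule bochner_integral_bounded_linear[OF L bounded_linear_scaleR_right])
  finally show "L1_pair \<phi> (r *\<^sub>R h) = r *\<^sub>R L1_pair \<phi> h" .
qed

lemma L1_pair_scaleC:
  fixes h :: "'a::cbanach L1"
  assumes \<phi>: "\<phi> \<in> borel_measurable borel" "\<And>x. cmod (\<phi> x) \<le> C"
  shows "L1_pair \<phi> (c *\<^sub>C h) = c *\<^sub>C L1_pair \<phi> h"
proof -
  note L = L1_fun_mult[OF \<phi> L1_fun_rep]
  have "L1_pair \<phi> (c *\<^sub>C h) = L1_pair \<phi> (abs_L1 (\<lambda>x. c *\<^sub>C rep_L1 h x))"
    by (simp add: scaleC_abs_L1[symmetric] L1_fun_rep abs_rep_L1)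
  also have "\<dots> = bochner_integral (\<lambda>x. c *\<^sub>C (\<phi> x *\<^sub>C rep_L1 h x))"
    unfolding L1_pair_abs[OF L1_fun_bounded_linear[OF L1_fun_rep bounded_linear_scaleC]]
    by (simp add: scaleC_scaleC mult.commute)
  also have "\<dots> = c *\<^sub>C L1_pair \<phi> h"
    unfolding L1_pair_def by (rule bochner_integral_bounded_linear[OF L bounded_linear_scaleC])
  finally show ?thesis .
qed

subsection \<open>Pointwise application of an operator\<close>

text \<open>Embeds the bounded operators of X into the commutant of the translations. The operators
  That(l), the inverses of I + That(l) and the masses of T over short intervals enter the algebra in
  this way.\<close>

definition L1_map :: "('a::real_normed_vector \<Rightarrow> 'b::real_normed_vector) \<Rightarrow> 'a L1 \<Rightarrow> 'b L1" where
  "L1_map B F = abs_L1 (\<lambda>x. B (rep_L1 F x))"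

lemma L1_map_abs:
  assumes B: "bounded_linear B" and f: "L1_fun f"
  shows "L1_map B (abs_L1 f) = abs_L1 (\<lambda>x. B (f x))"
  unfolding L1_map_def using rep_abs_L1[OF f]
  by (intro abs_L1_eqI L1_fun_bounded_linear[OF _ B] L1_fun_rep f) (auto elim: eventually_mono)

lemma L1_map_indicator:
  assumes B: "bounded_linear B" and E: "E \<in> fmeasurable lborel"
  shows "L1_map B (L1_indicator E v) = L1_indicator E (B v)"
  unfolding L1_indicator_def L1_map_abs[OF B L1_fun_indicator_const[OF E]]
  by (simp add: linear_scale[OF bounded_linear.linear[OF B]])

lemma norm_L1_map_le:
  assumes B: "bounded_linear B" and K: "\<And>v. norm (B v) \<le> K * norm v"
  shows "norm (L1_map B F) \<le> K * norm F"
proof -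
  have L: "L1_fun (\<lambda>x. B (rep_L1 F x))" by (rule L1_fun_bounded_linear[OF L1_fun_rep B])
  have "norm (L1_map B F) = (\<integral>x. norm (B (rep_L1 F x)) \<partial>lborel)"
    unfolding L1_map_def by (rule norm_abs_L1[OF L])
  also have "\<dots> \<le> (\<integral>x. K * norm (rep_L1 F x) \<partial>lborel)"
    by (intro integral_mono integrable_mult_right L1_fun_integrable_norm L L1_fun_rep K)
  also have "\<dots> = K * norm F" by (simp add: norm_L1_rep)
  finally show ?thesis .
qed

lemma bounded_linear_L1_map:
  assumes B: "bounded_linear B"
  shows "bounded_linear (L1_map B)"
proof -
  obtain K where K: "\<And>v. norm (B v) \<le> norm v * K" using bounded_linear.bounded[OF B] by blast
  interpret B: bounded_linear B by fact
  show ?thesis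
  proof (rule bounded_linear_intro)
    show "norm (L1_map B F) \<le> norm F * K" for F
      using norm_L1_map_le[OF B, of K F] K by (simp add: mult.commute)
    fix F G r
    have "L1_map B (F + G) = L1_map B (abs_L1 (\<lambda>x. rep_L1 F x + rep_L1 G x))"
      by (simp add: plus_abs_L1[symmetric] L1_fun_rep abs_rep_L1)
    also have "\<dots> = L1_map B F + L1_map B G"
      unfolding L1_map_abs[OF B L1_fun_add[OF L1_fun_rep L1_fun_rep]]
      by (simp add: L1_map_def B.add plus_abs_L1 L1_fun_bounded_linear[OF L1_fun_rep B])
    finally show "L1_map B (F + G) = L1_map B F + L1_map B G" .
    have "L1_map B (r *\<^sub>R F) = L1_map B (abs_L1 (\<lambda>x. r *\<^sub>R rep_L1 F x))"
      by (simp add: scaleR_abs_L1[symmetric] L1_fun_rep abs_rep_L1)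
    also have "\<dots> = r *\<^sub>R L1_map B F"
      unfolding L1_map_abs[OF B L1_fun_bounded_linear[OF L1_fun_rep bounded_linear_scaleR_right]]
      by (simp add: L1_map_def B.scaleR scaleR_abs_L1 L1_fun_bounded_linear[OF L1_fun_rep B])
    finally show "L1_map B (r *\<^sub>R F) = r *\<^sub>R L1_map B F" .
  qed
qed

lemma L1_map_translate:
  assumes B: "bounded_linear B"
  shows "L1_map B (L1_translate d F) = L1_translate d (L1_map B F)"
  by (rule bounded_linear_L1_eqI[OF bounded_linear_compose[OF bounded_linear_L1_map[OF B] bounded_linear_translate]
        bounded_linear_compose[OF bounded_linear_translate bounded_linear_L1_map[OF B]]])
    (simp add: L1_translate_indicator L1_map_indicator B fmeasurable_translate)

lemma L1_map_scaleC:
  assumes "bounded_clinear B"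
  shows "L1_map B (c *\<^sub>C F) = c *\<^sub>C L1_map B F"
proof -
  have B: "bounded_linear B" and c: "B (c *\<^sub>C v) = c *\<^sub>C B v" for v
    using assms by (auto simp: bounded_clinear_def)
  show ?thesis
    by (rule bounded_linear_L1_eqI[OF bounded_linear_compose[OF bounded_linear_L1_map[OF B] bounded_linear_scaleC]
        bounded_linear_compose[OF bounded_linear_scaleC bounded_linear_L1_map[OF B]]])
      (simp add: L1_map_indicator B c flip: L1_indicator_scaleC)
qed

subsection \<open>Vector-valued integrals of integrable functions\<close>

text \<open>Joint measurability for Tonelli. As in one variable it is phrased by simple
  approximants, because differences of Borel functions into a nonseparable space need not be
  Borel.\<close>

definition strongly_measurable2 :: "(real \<times> real \<Rightarrow> 'a::real_normed_vector) \<Rightarrow> bool" where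
  "strongly_measurable2 f \<longleftrightarrow>
     (\<exists>s. (\<forall>n. simple_function (lborel \<Otimes>\<^sub>M lborel) (s n)) \<and> (\<forall>x. (\<lambda>n. s n x) \<longlonglongrightarrow> f x))"

lemma strongly_measurable2_compose2:
  assumes "strongly_measurable2 f" "strongly_measurable2 g"
    and p: "\<And>x y a b. x \<longlonglongrightarrow> a \<Longrightarrow> y \<longlonglongrightarrow> b \<Longrightarrow> (\<lambda>n::nat. p (x n) (y n)) \<longlonglongrightarrow> p a b"
  shows "strongly_measurable2 (\<lambda>x. p (f x) (g x))"
proof -
  obtain s t where "\<And>n. simple_function (lborel \<Otimes>\<^sub>M lborel) (s n)" "\<And>x. (\<lambda>n. s n x) \<longlonglongrightarrow> f x"
    "\<And>n. simple_function (lborel \<Otimes>\<^sub>M lborel) (t n)" "\<And>x. (\<lambda>n. t n x) \<longlonglongrightarrow> g x"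
    using assms unfolding strongly_measurable2_def by metis
  then show ?thesis unfolding strongly_measurable2_def
    by (intro exI[where x = "\<lambda>n x. p (s n x) (t n x)"]) (auto intro: p simple_function_compose2)
qed

lemma strongly_measurable2_comp:
  assumes f: "strongly_measurable f" and h: "h \<in> measurable (lborel \<Otimes>\<^sub>M lborel) lborel"
  shows "strongly_measurable2 (\<lambda>z. f (h z))"
proof -
  obtain s where s: "\<And>n. simple_function lborel (s n)" "\<And>x. (\<lambda>n. s n x) \<longlonglongrightarrow> f x"
    using f unfolding strongly_measurable_def by blast
  show ?thesis unfolding strongly_measurable2_def
    using simple_function_measurable_comp[OF s(1) h] s(2)
    by (intro exI[where x = "\<lambda>n z. s n (h z)"]) blast
qed

lemma strongly_measurable2_sum:
  assumes "finite R" "\<And>c. c \<in> R \<Longrightarrow> strongly_measurable2 (f c)"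
  shows "strongly_measurable2 (\<lambda>z. \<Sum>c\<in>R. f c z)"
  using assms
proof (induction R rule: finite_induct)
  case empty
  have "simple_function (lborel \<Otimes>\<^sub>M lborel) (\<lambda>z::real \<times> real. 0::'b)" by simp
  then show ?case unfolding strongly_measurable2_def by (intro exI[of _ "\<lambda>n z. 0"]) auto
next
  case (insert c R)
  then show ?case
    by (simp, intro strongly_measurable2_compose2[of _ _ "(+)"]) (auto intro: tendsto_add)
qed

lemma strongly_measurable2_norm_diff:
  assumes "strongly_measurable2 f" "strongly_measurable2 g"
  shows "(\<lambda>z. norm (f z - g z)) \<in> borel_measurable (lborel \<Otimes>\<^sub>M lborel)"
proof -
  have "strongly_measurable2 (\<lambda>z. norm (f z - g z))"
    using assms by (rule strongly_measurable2_compose2) (intro tendsto_intros)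
  then obtain s where s: "\<And>n. simple_function (lborel \<Otimes>\<^sub>M lborel) (s n)"
    "\<And>z. (\<lambda>n. s n z) \<longlonglongrightarrow> norm (f z - g z)"
    unfolding strongly_measurable2_def by blast
  show ?thesis
    by (rule borel_measurable_LIMSEQ_metric[OF borel_measurable_simple_function[OF s(1)] s(2)])
qed

text \<open>Both sides are compared with a sequence of simple \<open>L\<^sup>1\<close>-valued functions approximating
  \<open>K\<close>; by Tonelli, the error of the pointwise integrals is at most the error in \<open>L\<^sup>1\<close>.\<close>

lemma bochner_integral_L1_pointwise:
  fixes k :: "real \<Rightarrow> real \<Rightarrow> 'a::banach"
  assumes K: "L1_fun K"
    and k1: "\<And>y. L1_fun (k y)" "\<And>y. K y = abs_L1 (k y)"
    and k2: "\<And>x. L1_fun (\<lambda>y. k y x)"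
    and k: "strongly_measurable2 (\<lambda>(y, x). k y x)"
    and G: "strongly_measurable (\<lambda>x. bochner_integral (\<lambda>y. k y x))"
  shows "L1_fun (\<lambda>x. bochner_integral (\<lambda>y. k y x))"
    and "abs_L1 (\<lambda>x. bochner_integral (\<lambda>y. k y x)) = bochner_integral K"
proof -
  define g where "g x = bochner_integral (\<lambda>y. k y x)" for x
  \<comment> \<open>Representatives normalized to vanish identically for the class 0, so that y
    \<mapsto> \<open>r (s n y) x\<close> vanishes off a set of finite measure for every x, not just
    for almost every x.\<close>
  define r where "r c = (if c = 0 then (\<lambda>_. 0) else rep_L1 c)" for c :: "'a L1"
  have r0 [simp]: "r 0 = (\<lambda>_. 0)" by (simp add: r_def)
  have rL: "L1_fun (r c)" for c by (simp add: r_def L1_fun_zero L1_fun_rep)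
  have abs_r: "abs_L1 (r c) = c" for c by (simp add: r_def abs_rep_L1 zero_L1.abs_eq)
  obtain s where s: "approx_seq s K" using K unfolding L1_fun_def by blast
  have ss: "simple_function lborel (s n)" for n using sbi_simple[OF approx_seq_sbi[OF s]] .
  have fin: "finite (range (s n))" for n using simple_functionD(1)[OF ss] by simp
  define S where "S n x = sint (\<lambda>y. r (s n y) x)" for n x
  have sbi_r: "sbi (\<lambda>y. r (s n y) x)" for n x
    using approx_seq_sbi[OF s, of n]
    by (intro simple_bochner_integrable_compose2[where p = "\<lambda>c d. r c x" and f = "s n" and g = "s n"]) auto
  define \<mu> where "\<mu> n c = measure lborel {y \<in> space lborel. s n y = c}" for n c
  have S_eq: "S n x = (\<Sum>c\<in>range (s n). \<mu> n c *\<^sub>R r c x)" for n x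
    unfolding S_def \<mu>_def
    using simple_bochner_integral_partition[OF sbi_r ss[of n], where v = "\<lambda>c. r c x"] by simp
  have sum_abs: "abs_L1 (\<lambda>x. \<Sum>c\<in>R. \<mu> n c *\<^sub>R r c x) = (\<Sum>c\<in>R. \<mu> n c *\<^sub>R c)
      \<and> L1_fun (\<lambda>x. \<Sum>c\<in>R. \<mu> n c *\<^sub>R r c x)" if "finite R" for R n
    using that
  proof (induction R rule: finite_induct)
    case empty
    then show ?case by (simp add: L1_fun_zero zero_L1.abs_eq)
  next
    case (insert c R)
    have 1: "L1_fun (\<lambda>x. \<mu> n c *\<^sub>R r c x)"
      by (rule L1_fun_bounded_linear[OF rL bounded_linear_scaleR_right])
    have 2: "abs_L1 (\<lambda>x. \<mu> n c *\<^sub>R r c x) = \<mu> n c *\<^sub>R c"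
      by (simp add: scaleR_abs_L1[symmetric] rL abs_r)
    have 3: "abs_L1 (\<lambda>x. \<Sum>c\<in>R. \<mu> n c *\<^sub>R r c x) = (\<Sum>c\<in>R. \<mu> n c *\<^sub>R c)"
      and 4: "L1_fun (\<lambda>x. \<Sum>c\<in>R. \<mu> n c *\<^sub>R r c x)"
      using insert by blast+
    show ?case
      unfolding sum.insert[OF insert(1,2)] plus_abs_L1[OF 1 4, symmetric] 2 3
      using L1_fun_add[OF 1 4] by simp
  qed
  have S: "abs_L1 (S n) = sint (s n)" "L1_fun (S n)" for n
    using sum_abs[OF fin, of n n] S_eq[of n, abs_def]
    unfolding simple_bochner_integral_def \<mu>_def by auto
  \<comment> \<open>A simple function of y selects among finitely many functions of x, so this is a
    finite sum of products of one-variable functions.\<close>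
  have sm_r: "strongly_measurable2 (\<lambda>(y, x). r (s n y) x)" for n
  proof -
    have eq: "(\<lambda>(y, x). r (s n y) x) = (\<lambda>z. \<Sum>c\<in>range (s n). indicator {y. s n y = c} (fst z) *\<^sub>R r c (snd z))"
    proof
      fix z :: "real \<times> real"
      have "(\<Sum>c\<in>range (s n). indicator {y. s n y = c} (fst z) *\<^sub>R r c (snd z))
        = (\<Sum>c\<in>range (s n). if c = s n (fst z) then r c (snd z) else 0)"
        by (intro sum.cong) (auto simp: indicator_def)
      also have "\<dots> = r (s n (fst z)) (snd z)" using fin by (simp add: sum.delta)
      finally show "(case z of (y, x) \<Rightarrow> r (s n y) x)
          = (\<Sum>c\<in>range (s n). indicator {y. s n y = c} (fst z) *\<^sub>R r c (snd z))"
        by (simp add: case_prod_beta)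
    qed
    have "strongly_measurable (indicator {y. s n y = c} :: real \<Rightarrow> real)" for c
      using simple_functionD(2)[OF ss[of n], of "{c}"]
      by (intro strongly_measurable_simple simple_function_indicator) (simp add: vimage_def)
    then show ?thesis unfolding eq
      by (intro strongly_measurable2_sum[OF fin] strongly_measurable2_compose2[where p = "(*\<^sub>R)"]
          strongly_measurable2_comp[OF _ measurable_fst] strongly_measurable2_comp[OF L1_fun_strongly_measurable[OF rL] measurable_snd])
        (auto intro: tendsto_scaleR)
  qed
  have bound: "(\<integral>\<^sup>+x. ennreal (norm (g x - S n x)) \<partial>lborel) \<le> (\<integral>\<^sup>+y. ennreal (norm (K y - s n y)) \<partial>lborel)" for n
  proof -
    have m: "(\<lambda>(y, x). ennreal (norm (k y x - r (s n y) x))) \<in> borel_measurable (lborel \<Otimes>\<^sub>M lborel)"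
      using strongly_measurable2_norm_diff[OF k sm_r[of n]] by (simp add: case_prod_beta)
    have "(\<integral>\<^sup>+x. ennreal (norm (g x - S n x)) \<partial>lborel)
        \<le> (\<integral>\<^sup>+x. (\<integral>\<^sup>+y. ennreal (norm (k y x - r (s n y) x)) \<partial>lborel) \<partial>lborel)"
    proof (rule nn_integral_mono)
      fix x
      have Ld: "L1_fun (\<lambda>y. k y x - r (s n y) x)"
        by (intro L1_fun_diff k2 L1_fun_sbi sbi_r)
      have "bochner_integral (\<lambda>y. k y x) = bochner_integral (\<lambda>y. (k y x - r (s n y) x) + r (s n y) x)"
        by simp
      also have "\<dots> = bochner_integral (\<lambda>y. k y x - r (s n y) x) + bochner_integral (\<lambda>y. r (s n y) x)"
        by (intro bochner_integral_add Ld L1_fun_sbi sbi_r)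
      finally have "g x - S n x = bochner_integral (\<lambda>y. k y x - r (s n y) x)"
        unfolding g_def S_def by (simp add: bochner_integral_sbi sbi_r)
      then have "norm (g x - S n x) \<le> (\<integral>y. norm (k y x - r (s n y) x) \<partial>lborel)"
        using norm_bochner_integral_le[OF Ld] by simp
      also have "ennreal (\<integral>y. norm (k y x - r (s n y) x) \<partial>lborel)
          = (\<integral>\<^sup>+y. ennreal (norm (k y x - r (s n y) x)) \<partial>lborel)"
        by (rule nn_integral_eq_integral[symmetric]) (auto intro: L1_fun_integrable_norm Ld)
      finally show "ennreal (norm (g x - S n x)) \<le> (\<integral>\<^sup>+y. ennreal (norm (k y x - r (s n y) x)) \<partial>lborel)"
        by (simp add: ennreal_leI)
    qed
    also have "\<dots> = (\<integral>\<^sup>+y. (\<integral>\<^sup>+x. ennreal (norm (k y x - r (s n y) x)) \<partial>lborel) \<partial>lborel)"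
      by (rule lborel_pair.Fubini'[OF m])
    also have "\<dots> = (\<integral>\<^sup>+y. ennreal (norm (K y - s n y)) \<partial>lborel)"
    proof (rule nn_integral_cong)
      fix y
      have "K y - s n y = abs_L1 (\<lambda>x. k y x - r (s n y) x)"
        by (simp add: minus_abs_L1[symmetric] k1 rL abs_r)
      then show "(\<integral>\<^sup>+x. ennreal (norm (k y x - r (s n y) x)) \<partial>lborel) = ennreal (norm (K y - s n y))"
        using nn_integral_norm_L1[OF L1_fun_diff[OF k1(1) rL]] by simp
    qed
    finally show ?thesis .
  qed
  have lim0: "(\<lambda>n. \<integral>\<^sup>+x. ennreal (norm (g x - S n x)) \<partial>lborel) \<longlonglongrightarrow> 0"
  proof (rule tendsto_sandwich[OF _ _ tendsto_const])
    show "(\<lambda>n. \<integral>\<^sup>+y. ennreal (norm (K y - s n y)) \<partial>lborel) \<longlonglongrightarrow> 0"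
      using s by (simp add: approx_seq_def)
  qed (use bound in auto)
  have gsm: "strongly_measurable g" using G unfolding g_def[abs_def] .
  have m: "(\<lambda>x. norm (g x - S n x)) \<in> borel_measurable lborel" for n
    by (rule borel_measurable_norm_diff[OF gsm L1_fun_strongly_measurable[OF S(2)]])
  have Lg: "L1_fun g"
  proof (rule L1_fun_dominated[OF gsm])
    show "integrable lborel (\<lambda>x. norm (g x))"
    proof (rule integrableI_bounded)
      show "(\<lambda>x. norm (g x)) \<in> borel_measurable lborel"
        using strongly_measurable_borel[OF gsm] by measurable
      from order_tendstoD(2)[OF lim0, of 1]
      obtain n where n: "(\<integral>\<^sup>+x. ennreal (norm (g x - S n x)) \<partial>lborel) < 1"
        by (auto simp: eventually_sequentially)
      have mS: "(\<lambda>x. norm (S n x)) \<in> borel_measurable lborel"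
        using L1_fun_integrable_norm[OF S(2)] by (rule borel_measurable_integrable)
      have "(\<integral>\<^sup>+x. ennreal (norm (norm (g x))) \<partial>lborel)
          \<le> (\<integral>\<^sup>+x. ennreal (norm (g x - S n x)) + ennreal (norm (S n x)) \<partial>lborel)"
        by (intro nn_integral_mono) (simp add: norm_triangle_sub add.commute flip: ennreal_plus)
      also have "\<dots> = (\<integral>\<^sup>+x. ennreal (norm (g x - S n x)) \<partial>lborel) + (\<integral>\<^sup>+x. ennreal (norm (S n x)) \<partial>lborel)"
        using m[of n] mS by (intro nn_integral_add) auto
      also have "\<dots> < \<infinity>"
        using n by (auto simp: ennreal_add_less_top nn_integral_norm_L1[OF S(2)] intro: less_trans)
      finally show "(\<integral>\<^sup>+x. ennreal (norm (norm (g x))) \<partial>lborel) < \<infinity>" .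
    qed
  qed simp
  have "(\<lambda>n. ennreal (norm (abs_L1 g - sint (s n)))) \<longlonglongrightarrow> 0"
    using lim0 nn_integral_norm_L1[OF L1_fun_diff[OF Lg S(2)]]
    by (simp add: minus_abs_L1 Lg S(2) flip: S(1))
  then have "(\<lambda>n. norm (abs_L1 g - sint (s n))) \<longlonglongrightarrow> 0"
    by (simp add: ennreal_tendsto_0_iff)
  then have "(\<lambda>n. norm (sint (s n) - abs_L1 g)) \<longlonglongrightarrow> 0"
    by (simp add: norm_minus_commute)
  then have "(\<lambda>n. sint (s n)) \<longlonglongrightarrow> abs_L1 g"
    by (simp add: LIM_zero_iff tendsto_norm_zero_iff)
  then have "bochner_integral K = abs_L1 g"
    using bochner_integral_eqI[OF L1_fun_strongly_measurable[OF K] s] by blast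
  then show "abs_L1 (\<lambda>x. bochner_integral (\<lambda>y. k y x)) = bochner_integral K"
    unfolding g_def[abs_def] by simp
  show "L1_fun (\<lambda>x. bochner_integral (\<lambda>y. k y x))"
    using Lg unfolding g_def[abs_def] .
qed

subsection \<open>Convolution operators\<close>

text \<open>Convolution as the L^1-valued integral of U_y S(g(y)) dy. No pointwise values S(\<rho>)
  occur, which need not be bounded operators; \<open>wiener_act_eq\<close> identifies it with the
  action that defines the product.\<close>

definition conv_op :: "('a::real_normed_vector \<Rightarrow> 'b::real_normed_vector L1) \<Rightarrow> 'a L1 \<Rightarrow> 'b L1" where
  "conv_op S g = bochner_integral (\<lambda>y. L1_translate y (S (rep_L1 g y)))"

lemma L1_fun_translate_op:
  assumes S: "bounded_linear S" and g: "L1_fun g"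
  shows "L1_fun (\<lambda>y. L1_translate y (S (g y)))"
proof -
  obtain K where K: "\<And>v. norm (S v) \<le> norm v * K" using bounded_linear.bounded[OF S] by blast
  show ?thesis
  proof (rule L1_fun_dominated)
    show "strongly_measurable (\<lambda>y. L1_translate y (S (g y)))"
      by (rule strongly_measurable_compose2[OF strongly_measurable_continuous[OF continuous_on_id]
            L1_fun_strongly_measurable[OF g], where p = "\<lambda>a b. L1_translate a (S b)"])
        (intro tendsto_L1_translate bounded_linear.tendsto[OF S])
    show "integrable lborel (\<lambda>y. norm (g y) * K)"
      by (intro integrable_mult_left L1_fun_integrable_norm g)
  qed (simp add: K)
qed

lemma conv_op_abs:
  assumes "L1_fun f"
  shows "conv_op S (abs_L1 f) = bochner_integral (\<lambda>y. L1_translate y (S (f y)))"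
  unfolding conv_op_def using rep_abs_L1[OF assms]
  by (intro bochner_integral_cong_AE) (auto elim: eventually_mono)

lemma norm_conv_op_le:
  fixes S :: "'a::real_normed_vector \<Rightarrow> 'b::banach L1"
  assumes S: "bounded_linear S" and K: "\<And>v. norm (S v) \<le> K * norm v"
  shows "norm (conv_op S g) \<le> K * norm g"
proof -
  note L = L1_fun_translate_op[OF S L1_fun_rep]
  have "norm (conv_op S g) \<le> (\<integral>y. norm (L1_translate y (S (rep_L1 g y))) \<partial>lborel)"
    unfolding conv_op_def by (rule norm_bochner_integral_le[OF L])
  also have "\<dots> \<le> (\<integral>y. K * norm (rep_L1 g y) \<partial>lborel)"
    by (intro integral_mono integrable_mult_right L1_fun_integrable_norm[OF L]
        L1_fun_integrable_norm[OF L1_fun_rep]) (simp add: K)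
  also have "\<dots> = K * norm g" by (simp add: norm_L1_rep)
  finally show ?thesis .
qed

lemma bounded_linear_conv_op:
  fixes S :: "'a::real_normed_vector \<Rightarrow> 'b::banach L1"
  assumes S: "bounded_linear S"
  shows "bounded_linear (conv_op S)"
proof -
  interpret S: bounded_linear S by fact
  obtain K where K: "\<And>v. norm (S v) \<le> norm v * K" using S.bounded by blast
  note L = L1_fun_translate_op[OF S L1_fun_rep]
  show ?thesis
  proof (rule bounded_linear_intro)
    show "norm (conv_op S g) \<le> norm g * K" for g
      using norm_conv_op_le[OF S, of K g] K by (simp add: mult.commute)
    fix F G r
    have "conv_op S (F + G) = conv_op S (abs_L1 (\<lambda>x. rep_L1 F x + rep_L1 G x))"
      by (simp add: plus_abs_L1[symmetric] L1_fun_rep abs_rep_L1)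
    also have "\<dots> = conv_op S F + conv_op S G"
      unfolding conv_op_abs[OF L1_fun_add[OF L1_fun_rep L1_fun_rep]]
      by (simp add: S.add conv_op_def bochner_integral_add L)
    finally show "conv_op S (F + G) = conv_op S F + conv_op S G" .
    have "conv_op S (r *\<^sub>R F) = conv_op S (abs_L1 (\<lambda>x. r *\<^sub>R rep_L1 F x))"
      by (simp add: scaleR_abs_L1[symmetric] L1_fun_rep abs_rep_L1)
    also have "\<dots> = r *\<^sub>R conv_op S F"
      unfolding conv_op_abs[OF L1_fun_bounded_linear[OF L1_fun_rep bounded_linear_scaleR_right]]
      using bochner_integral_bounded_linear[OF L bounded_linear_scaleR_right]
      by (simp add: S.scaleR conv_op_def)
    finally show "conv_op S (r *\<^sub>R F) = r *\<^sub>R conv_op S F" .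
  qed
qed

text \<open>A bounded operator passes under the Bochner integral, and commutation moves it past the
  translation onto the values of S.\<close>

lemma conv_op_commute:
  fixes S :: "'a::real_normed_vector \<Rightarrow> 'b::banach L1"
  assumes S: "bounded_linear S" and P: "bounded_linear P"
    and c: "\<And>d F. P (L1_translate d F) = L1_translate d (P F)"
  shows "P (conv_op S g) = conv_op (\<lambda>v. P (S v)) g"
  unfolding conv_op_def
  using bochner_integral_bounded_linear[OF L1_fun_translate_op[OF S L1_fun_rep] P] by (simp add: c)

lemma conv_op_translate:
  fixes S :: "'a::real_normed_vector \<Rightarrow> 'b::banach L1"
  assumes S: "bounded_linear S"
  shows "conv_op S (L1_translate d g) = L1_translate d (conv_op S g)"
proof (induction g rule: L1_induct)
  case (1 f)
  define F where "F y = L1_translate d (L1_translate y (S (f y)))" for y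
  have F: "L1_fun F" unfolding F_def
    by (intro L1_fun_bounded_linear[OF _ bounded_linear_translate] L1_fun_translate_op S 1)
  have "conv_op S (L1_translate d (abs_L1 f)) = bochner_integral (\<lambda>y. F (y - d))"
    by (simp add: translate_abs_L1 1 conv_op_abs L1_fun_translate F_def)
  also have "\<dots> = bochner_integral F"
    by (rule bochner_integral_comp[OF _ lborel_translate F]) simp
  also have "\<dots> = L1_translate d (conv_op S (abs_L1 f))"
    unfolding F_def conv_op_abs[OF 1]
    by (rule bochner_integral_bounded_linear[OF L1_fun_translate_op[OF S 1] bounded_linear_translate])
  finally show ?case .
qed

lemma conv_op_scaleC:
  fixes S :: "'a::complex_normed_vector \<Rightarrow> 'b::cbanach L1"
  assumes S: "bounded_clinear S"
  shows "conv_op S (c *\<^sub>C g) = c *\<^sub>C conv_op S g"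
proof (induction g rule: L1_induct)
  case (1 f)
  have bl: "bounded_linear S" and c: "S (c *\<^sub>C v) = c *\<^sub>C S v" for v
    using S by (auto simp: bounded_clinear_def)
  have "conv_op S (c *\<^sub>C abs_L1 f) = bochner_integral (\<lambda>y. c *\<^sub>C L1_translate y (S (f y)))"
    by (simp add: scaleC_abs_L1 1 conv_op_abs L1_fun_bounded_linear[OF 1 bounded_linear_scaleC] c)
  also have "\<dots> = c *\<^sub>C conv_op S (abs_L1 f)"
    unfolding conv_op_abs[OF 1]
    by (rule bochner_integral_bounded_linear[OF L1_fun_translate_op[OF bl 1] bounded_linear_scaleC])
  finally show ?case .
qed

section \<open>Convolution with an indicator function\<close>

lemma L1_fun_indicator_translate:
  assumes E: "E \<in> fmeasurable lborel"
  shows "L1_fun (\<lambda>y. indicator E y *\<^sub>R L1_translate y h)"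
  using L1_fun_translate_op[OF bounded_linear_scaleR_left, of "indicator E" h]
    L1_fun_indicator_const[OF E, of "1::real"] by simp

lemma scaleC_indicator: "(indicator E x :: complex) *\<^sub>C v = (indicator E x :: real) *\<^sub>R v"
proof -
  have "(indicator E x :: complex) = complex_of_real (indicator E x)" by (simp add: indicator_def)
  then show ?thesis by (simp only: scaleC_of_real)
qed

lemma fmeasurable_imp_borel: "E \<in> fmeasurable lborel \<Longrightarrow> E \<in> sets borel"
  by (simp add: fmeasurable_def)

context
  fixes E :: "real set" and f :: "real \<Rightarrow> 'a::cbanach"
  assumes E: "E \<in> fmeasurable lborel" and f: "L1_fun f"
begin

lemma indicator_conv_swap:
  "bochner_integral (\<lambda>y. indicator E (x - y) *\<^sub>R f y) = bochner_integral (\<lambda>y. indicator E y *\<^sub>R f (x - y))"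
proof -
  have "L1_fun (\<lambda>y. indicator E y *\<^sub>R f (x - y))"
    by (rule L1_fun_indicator[OF L1_fun_comp[OF _ lborel_reflect f]]) (simp_all add: fmeasurable_imp_borel[OF E])
  from bochner_integral_comp[OF _ lborel_reflect this, of x] show ?thesis by simp
qed

text \<open>After reflection the value at x is the pairing of the indicator function with the
  x-translate of a fixed class, which is continuous in x.\<close>

lemma strongly_measurable_indicator_conv:
  "strongly_measurable (\<lambda>x. bochner_integral (\<lambda>y. indicator E (x - y) *\<^sub>R f y))"
proof -
  define F where "F = abs_L1 (\<lambda>y. f (0 - y))"
  have L: "L1_fun (\<lambda>y. f (0 - y))" by (rule L1_fun_comp[OF _ lborel_reflect f]) simp
  have "bochner_integral (\<lambda>y. indicator E (x - y) *\<^sub>R f y) = L1_pair (indicator E) (L1_translate x F)" for x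
    unfolding F_def translate_abs_L1[OF L] L1_pair_abs[OF L1_fun_translate[OF L]] indicator_conv_swap scaleC_indicator
    by simp
  moreover have "bounded_linear (L1_pair (indicator E) :: 'a L1 \<Rightarrow> 'a)"
    by (rule bounded_linear_L1_pair[where C = 1]) (auto simp: fmeasurable_imp_borel[OF E] borel_measurable_indicator indicator_def)
  then have "continuous_on UNIV (\<lambda>x. L1_pair (indicator E) (L1_translate x F))"
    by (rule bounded_linear.continuous_on[OF _ continuous_on_L1_translate])
  ultimately show ?thesis by (simp add: strongly_measurable_continuous)
qed

text \<open>Integration over the variable of the indicator function: a superposition of translates
  of f. In this form the convolution commutes with every bounded operator that commutes with
  translations.\<close>

lemma indicator_conv_eq1:
  "abs_L1 (\<lambda>x. bochner_integral (\<lambda>y. indicator E (x - y) *\<^sub>R f y))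
    = bochner_integral (\<lambda>y. indicator E y *\<^sub>R L1_translate y (abs_L1 f))"
proof -
  have indE: "strongly_measurable (indicator E :: real \<Rightarrow> real)"
    by (intro strongly_measurable_simple simple_function_indicator) (simp add: fmeasurable_imp_borel[OF E])
  show ?thesis
    unfolding indicator_conv_swap
  proof (rule bochner_integral_L1_pointwise(2))
    show "L1_fun (\<lambda>y. indicator E y *\<^sub>R L1_translate y (abs_L1 f))"
      by (rule L1_fun_indicator_translate[OF E])
    show "L1_fun (\<lambda>x. indicator E y *\<^sub>R f (x - y))" for y
      by (rule L1_fun_bounded_linear[OF L1_fun_translate[OF f] bounded_linear_scaleR_right])
    show "indicator E y *\<^sub>R L1_translate y (abs_L1 f) = abs_L1 (\<lambda>x. indicator E y *\<^sub>R f (x - y))" for y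
      by (simp add: translate_abs_L1 f scaleR_abs_L1 L1_fun_translate)
    show "L1_fun (\<lambda>y. indicator E y *\<^sub>R f (x - y))" for x
      by (rule L1_fun_indicator[OF L1_fun_comp[OF _ lborel_reflect f]]) (simp_all add: fmeasurable_imp_borel[OF E])
    have "strongly_measurable2 (\<lambda>z. indicator E (fst z) *\<^sub>R f (snd z - fst z))"
      by (rule strongly_measurable2_compose2[where p = "(*\<^sub>R)"])
        (auto intro: tendsto_scaleR strongly_measurable2_comp[OF indE] strongly_measurable2_comp[OF L1_fun_strongly_measurable[OF f]])
    then show "strongly_measurable2 (\<lambda>(y, x). indicator E y *\<^sub>R f (x - y))"
      by (simp add: case_prod_beta')
    show "strongly_measurable (\<lambda>x. bochner_integral (\<lambda>y. indicator E y *\<^sub>R f (x - y)))"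
      using strongly_measurable_indicator_conv unfolding indicator_conv_swap .
  qed
qed

text \<open>Integration over the variable of f: the same class as a convolution operator applied to
  f. This form gives boundedness, with the measure of E as constant.\<close>

lemma indicator_conv_eq2:
  "abs_L1 (\<lambda>x. bochner_integral (\<lambda>y. indicator E (x - y) *\<^sub>R f y))
    = bochner_integral (\<lambda>y. L1_translate y (L1_indicator E (f y)))"
proof -
  have indE: "strongly_measurable (indicator E :: real \<Rightarrow> real)"
    by (intro strongly_measurable_simple simple_function_indicator) (simp add: fmeasurable_imp_borel[OF E])
  show ?thesis
  proof (rule bochner_integral_L1_pointwise(2))
    show "L1_fun (\<lambda>y. L1_translate y (L1_indicator E (f y)))"
      by (rule L1_fun_translate_op[OF bounded_linear_L1_indicator[OF E] f])
    show "L1_fun (\<lambda>x. indicator E (x - y) *\<^sub>R f y)" for y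
      by (rule L1_fun_translate[OF L1_fun_indicator_const[OF E]])
    show "L1_translate y (L1_indicator E (f y)) = abs_L1 (\<lambda>x. indicator E (x - y) *\<^sub>R f y)" for y
      unfolding L1_indicator_def translate_abs_L1[OF L1_fun_indicator_const[OF E]] ..
    show "L1_fun (\<lambda>y. indicator E (x - y) *\<^sub>R f y)" for x
    proof -
      have "{y. x - y \<in> E} \<in> sets borel"
        using measurable_sets[of "\<lambda>y. x - y" borel borel E] fmeasurable_imp_borel[OF E] by (simp add: vimage_def)
      from L1_fun_indicator[OF f this] show ?thesis by (simp add: indicator_def)
    qed
    have "strongly_measurable2 (\<lambda>z. indicator E (snd z - fst z) *\<^sub>R f (fst z))"
      by (rule strongly_measurable2_compose2[where p = "(*\<^sub>R)"])
        (auto intro: tendsto_scaleR strongly_measurable2_comp[OF indE] strongly_measurable2_comp[OF L1_fun_strongly_measurable[OF f]])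
    then show "strongly_measurable2 (\<lambda>(y, x). indicator E (x - y) *\<^sub>R f y)"
      by (simp add: case_prod_beta')
  qed (rule strongly_measurable_indicator_conv)
qed

end

lemma indicator_conv_integral:
  fixes h :: "'a::cbanach L1"
  assumes E: "E \<in> fmeasurable lborel"
  shows "indicator_conv E h = bochner_integral (\<lambda>y. indicator E y *\<^sub>R L1_translate y h)"
  unfolding indicator_conv_def using indicator_conv_eq1[OF E L1_fun_rep[of h]] by (simp add: abs_rep_L1)

lemma indicator_conv_conv_op:
  fixes h :: "'a::cbanach L1"
  assumes E: "E \<in> fmeasurable lborel"
  shows "indicator_conv E h = conv_op (L1_indicator E) h"
  unfolding indicator_conv_def conv_op_def using indicator_conv_eq2[OF E L1_fun_rep[of h]] .

lemma bounded_linear_indicator_conv: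
  assumes E: "E \<in> fmeasurable lborel"
  shows "bounded_linear (indicator_conv E :: 'a::cbanach L1 \<Rightarrow> 'a L1)"
  unfolding indicator_conv_conv_op[OF E, abs_def]
  by (rule bounded_linear_conv_op[OF bounded_linear_L1_indicator[OF E]])

lemma norm_indicator_conv_le:
  fixes h :: "'a::cbanach L1"
  assumes E: "E \<in> fmeasurable lborel"
  shows "norm (indicator_conv E h) \<le> measure lborel E * norm h"
  unfolding indicator_conv_conv_op[OF E]
  by (rule norm_conv_op_le[OF bounded_linear_L1_indicator[OF E]]) (simp add: norm_L1_indicator E)

lemma indicator_conv_commute:
  fixes P :: "'a::cbanach L1 \<Rightarrow> 'a L1"
  assumes E: "E \<in> fmeasurable lborel" and P: "bounded_linear P"
    and c: "\<And>d F. P (L1_translate d F) = L1_translate d (P F)"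
  shows "P (indicator_conv E h) = indicator_conv E (P h)"
  unfolding indicator_conv_integral[OF E]
    bochner_integral_bounded_linear[OF L1_fun_indicator_translate[OF E] P, symmetric]
  by (simp add: c linear_scale[OF bounded_linear.linear[OF P]])

lemma indicator_conv_translate:
  fixes h :: "'a::cbanach L1"
  assumes E: "E \<in> fmeasurable lborel"
  shows "indicator_conv E (L1_translate d h) = L1_translate d (indicator_conv E h)"
  by (rule indicator_conv_commute[OF E bounded_linear_translate, symmetric]) (simp add: add.commute)

lemma indicator_conv_scaleC:
  fixes h :: "'a::cbanach L1"
  assumes E: "E \<in> fmeasurable lborel"
  shows "indicator_conv E (c *\<^sub>C h) = c *\<^sub>C indicator_conv E h"
  by (rule indicator_conv_commute[OF E bounded_linear_scaleC, symmetric]) simp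

lemma conv_op_indicator:
  fixes S :: "'a::cbanach \<Rightarrow> 'a L1"
  assumes S: "bounded_linear S" and E: "E \<in> fmeasurable lborel"
  shows "conv_op S (L1_indicator E v) = indicator_conv E (S v)"
  unfolding L1_indicator_def conv_op_abs[OF L1_fun_indicator_const[OF E]] indicator_conv_integral[OF E]
  by (simp add: linear_scale[OF bounded_linear.linear[OF S]])

text \<open>Evaluates the definite description: a bounded operator is determined by its values on
  the functions \<open>L1_indicator E v\<close>.\<close>

lemma wiener_act_eqI:
  fixes S :: "'a::cbanach \<Rightarrow> 'a L1"
  assumes A: "bounded_clinear A"
    and eq: "\<And>E v. E \<in> fmeasurable lborel \<Longrightarrow> A (L1_indicator E v) = indicator_conv E (S v)"
  shows "wiener_act S = A"
  unfolding wiener_act_def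
proof (rule the_equality)
  fix B :: "'a L1 \<Rightarrow> 'a L1"
  assume B: "bounded_clinear B \<and> (\<forall>E\<in>fmeasurable lborel. \<forall>v. B (L1_indicator E v) = indicator_conv E (S v))"
  show "B = A"
  proof
    fix F
    show "B F = A F"
    proof (rule bounded_linear_L1_eqI[of B A])
      show "bounded_linear B" "bounded_linear A" using A B by (simp_all add: bounded_clinear_def)
      show "B (L1_indicator E v) = A (L1_indicator E v)" if "E \<in> fmeasurable lborel" for E v
        using B eq[OF that] that by simp
    qed
  qed
qed (use assms in auto)

lemma wiener_act_eq:
  fixes S :: "'a::cbanach \<Rightarrow> 'a L1"
  assumes "S \<in> wiener"
  shows "wiener_act S = conv_op S"
proof -
  have S: "bounded_clinear S" "bounded_linear S" using assms by (auto simp: wiener_def bounded_clinear_def)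
  show ?thesis
    by (rule wiener_act_eqI)
      (auto simp: bounded_clinear_def bounded_linear_conv_op conv_op_scaleC[OF S(1)] conv_op_indicator S)
qed

subsection \<open>Continuous characters of the real line\<close>

text \<open>Since \<open>c(t) \<integral>\<^sub>0\<^sup>a c = \<integral>\<^sub>t\<^sup>t\<^sup>+\<^sup>a c\<close>, continuity implies differentiability.\<close>

lemma character_differentiable_0:
  fixes c :: "real \<Rightarrow> complex"
  assumes hom: "\<And>s t. c (s + t) = c s * c t" and c0: "c 0 = 1" and cont: "continuous_on UNIV c"
  shows "\<exists>\<kappa>. (c has_vector_derivative \<kappa>) (at 0)"
proof -
  have "isCont c 0" using cont by (simp add: continuous_on_eq_continuous_at)
  then have "c \<midarrow>0\<rightarrow> 1" by (simp add: isCont_def c0)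
  from LIM_D[OF this, of "1/2"] obtain d
    where d0: "d > 0" "\<And>s. s \<noteq> 0 \<Longrightarrow> norm (s - 0) < d \<Longrightarrow> norm (c s - 1) < 1/2" by auto
  have d1: "norm (c s - 1) < 1/2" if "\<bar>s\<bar> < d" for s
    using d0 that c0 by (cases "s = 0") auto
  \<comment> \<open>Up to a the values of c stay within 1/2 of 1, so that |K - a| \<le> a/2 and K
    \<noteq> 0; the cap 1 keeps t + s inside [-2,2] when |t| < 1.\<close>
  define a where "a = min (d/2) 1"
  have a: "0 < a" "a \<le> 1" "a < d" using d0(1) by (auto simp: a_def)
  obtain g where g: "\<And>x. x \<in> {-2..2} \<Longrightarrow> (g has_vector_derivative c x) (at x within {-2..2})"
    using antiderivative_continuous[OF continuous_on_subset[OF cont, of "{-2..2}"]] by auto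
  have ci: "c integrable_on {0..a}"
    by (rule integrable_continuous_real[OF continuous_on_subset[OF cont]]) simp
  define K where "K = integral {0..a} c"
  have "K \<noteq> 0"
  proof
    assume "K = 0"
    have "((\<lambda>s. c s - 1) has_integral (K - a *\<^sub>R 1)) {0..a}"
      using has_integral_diff[OF integrable_integral[OF ci] has_integral_const_real[of "1::complex" 0 a]] a
      by (simp add: K_def)
    from has_integral_bound_real[OF _ _ this, of "1/2" "{}"]
    have "norm (K - a *\<^sub>R 1) \<le> 1/2 * a" using d1 a by (force simp: less_imp_le)
    then show False using \<open>K = 0\<close> a by simp
  qed
  have eq: "c t * K = g (t + a) - g t" if t: "\<bar>t\<bar> < 1" for t
  proof -
    have 1: "((\<lambda>s. c (t + s)) has_integral (g (t + a) - g (t + 0))) {0..a}"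
    proof (rule fundamental_theorem_of_calculus)
      fix s assume s: "s \<in> {0..a}"
      have "((\<lambda>s. g (t + s)) has_vector_derivative c (t + s)) (at s within {0..a})"
      proof -
        have "(g has_vector_derivative c (t + s)) (at (t + s) within (+) t ` {0..a})"
          by (rule has_vector_derivative_within_subset[OF g]) (use s t a in auto)
        moreover have "((+) t has_vector_derivative 1) (at s within {0..a})"
          by (auto intro!: derivative_eq_intros)
        ultimately show ?thesis
          using vector_diff_chain_within[of "(+) t" 1 s "{0..a}" g "c (t + s)"] by (simp add: o_def)
      qed
      then show "((\<lambda>s. g (t + s)) has_vector_derivative c (t + s)) (at s within {0..a})" .
    qed (use a in simp)
    have 2: "((\<lambda>s. c (t + s)) has_integral (c t * K)) {0..a}"
      using has_integral_mult_right[OF integrable_integral[OF ci], of "c t"] by (simp add: hom K_def)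
    from has_integral_unique[OF 2 1] show ?thesis by simp
  qed
  have gd: "(g has_vector_derivative c x) (at x)" if "\<bar>x\<bar> < 2" for x
  proof -
    have "- 2 < x" "x < 2" using that by auto
    then show ?thesis using g[of x] at_within_Icc_at[of "-2" x 2] by simp
  qed
  have "((\<lambda>t. (g (t + a) - g t) / K) has_vector_derivative ((c a - c 0) / K)) (at 0)"
  proof -
    have "(g has_vector_derivative c a) (at (0 + a))" using gd[of a] a by simp
    moreover have "((\<lambda>t::real. t + a) has_vector_derivative 1) (at 0)"
      by (auto intro!: derivative_eq_intros)
    ultimately have "((\<lambda>t. g (t + a)) has_vector_derivative c a) (at 0)"
      using vector_diff_chain_at[of "\<lambda>t. t + a" 1 0 g "c a"] by (simp add: o_def)
    then show ?thesis
      using has_vector_derivative_mult_left[OF has_vector_derivative_diff[OF _ gd[of 0]], of _ "c a" "1/K"]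
      by simp
  qed
  then have "(c has_vector_derivative ((c a - c 0) / K)) (at 0)"
    by (rule has_vector_derivative_transform_within_open[of _ _ _ "{-1<..<1}"])
      (use eq \<open>K \<noteq> 0\<close> in \<open>auto simp: field_simps\<close>)
  then show ?thesis by blast
qed

text \<open>The homomorphism law spreads the derivative at 0 to c' = \<kappa> c, so c(t)
  exp(-\<kappa> t) is constant; modulus 1 forces Re \<kappa> = 0.\<close>

lemma continuous_character:
  fixes c :: "real \<Rightarrow> complex"
  assumes hom: "\<And>s t. c (s + t) = c s * c t" and n: "\<And>t. cmod (c t) = 1"
    and cont: "(c \<longlongrightarrow> 1) (at 0)"
  shows "\<exists>l. \<forall>t. c t = exp (- \<i> * of_real l * of_real t)"
proof -
  have c0: "c 0 = 1" using hom[of 0 0] n[of 0] by auto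
  have "continuous_on UNIV c"
  proof (rule continuous_at_imp_continuous_on, rule ballI)
    fix t
    have "((\<lambda>h. c t * c h) \<longlongrightarrow> c t * 1) (at 0)" by (intro tendsto_intros cont)
    then show "isCont c t" by (simp add: isCont_iff hom)
  qed
  from character_differentiable_0[OF hom c0 this] obtain \<kappa> where k0: "(c has_vector_derivative \<kappa>) (at 0)" by blast
  have k: "(c has_vector_derivative (c t * \<kappa>)) (at t)" for t
  proof -
    have "((\<lambda>s. s - t) has_vector_derivative 1) (at t)" by (auto intro!: derivative_eq_intros)
    moreover have "(c has_vector_derivative \<kappa>) (at (t - t))" using k0 by simp
    ultimately have "((\<lambda>s. c (s - t)) has_vector_derivative \<kappa>) (at t)"
      using vector_diff_chain_at[of "\<lambda>s. s - t" 1 t c \<kappa>] by (simp add: o_def)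
    then have "((\<lambda>s. c t * c (s - t)) has_vector_derivative (c t * \<kappa>)) (at t)"
      by (rule has_vector_derivative_mult_right)
    then show ?thesis by (simp flip: hom)
  qed
  have e: "((\<lambda>t. exp (- \<kappa> * of_real t)) has_vector_derivative (- \<kappa> * exp (- \<kappa> * of_real t))) (at t)" for t
  proof -
    have "((\<lambda>z. exp (- \<kappa> * z)) has_field_derivative (- \<kappa> * exp (- \<kappa> * of_real t))) (at (of_real t))"
      by (auto intro!: derivative_eq_intros)
    from has_vector_derivative_real_field[OF this] show ?thesis .
  qed
  have "((\<lambda>t. c t * exp (- \<kappa> * of_real t)) has_vector_derivative 0) (at t)" for t
    using has_vector_derivative_mult[OF k e, of t] by (simp add: algebra_simps)
  then obtain w where w: "\<And>t. c t * exp (- \<kappa> * of_real t) = w"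
    using has_vector_derivative_zero_constant[of UNIV "\<lambda>t. c t * exp (- \<kappa> * of_real t)"] by auto
  have "w = 1" using w[of 0] c0 by simp
  then have ce: "c t = exp (\<kappa> * of_real t)" for t
    using w[of t] by (simp add: exp_minus field_simps)
  have "Re \<kappa> = 0" using n[of 1] ce[of 1] by (simp add: norm_exp_eq_Re)
  then have "\<kappa> = - \<i> * of_real (- Im \<kappa>)" by (simp add: complex_eq_iff)
  then show ?thesis using ce by metis
qed

text \<open>Read as powers of z = exp(2 pi i k/n), this is a geometric sum with z^n = 1 and z
  \<noteq> 1.\<close>

lemma sum_root_of_unity_powers:
  fixes n k :: nat
  assumes "0 < k" "k < n"
  shows "(\<Sum>j<n. (exp (2 * of_real pi * \<i> * of_nat j / of_nat n) :: complex) ^ k) = 0"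
proof -
  define z :: complex where "z = exp (2 * of_real pi * \<i> * of_nat k / of_nat n)"
  have "exp (2 * of_real pi * \<i> * of_nat j / of_nat n) ^ k = z ^ j" for j
    unfolding z_def exp_of_nat_mult[symmetric] by (simp add: mult_ac)
  moreover have "z \<noteq> 1"
    unfolding z_def using complex_root_unity_eq_1[of n k] assms by (auto dest: dvd_imp_le)
  moreover have "z ^ n = 1" unfolding z_def using assms by (intro complex_root_unity) auto
  ultimately show ?thesis by (simp add: sum_gp_strict)
qed

subsection \<open>Banach algebras containing a central group of isometries\<close>

text \<open>The properties of the commutant that enter the argument, symmetric under reversal of the
  product so that right inverses come from left ones. \<open>car\<close> is a closed subspace of a
  larger Banach space because the commutant sits inside a type of real-linear operators; complex
  scalars are therefore supplied by a central homomorphism \<open>\<iota>\<close>.\<close>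

locale translation_algebra =
  fixes mul :: "'b::banach \<Rightarrow> 'b \<Rightarrow> 'b" (infixl \<open>\<odot>\<close> 70)
    and one :: 'b and car :: "'b set" and \<iota> :: "complex \<Rightarrow> 'b" and U :: "real \<Rightarrow> 'b"
  assumes bilinear: "bounded_bilinear (\<odot>)"
    and norm_mul: "norm (a \<odot> b) \<le> norm a * norm b"
    and assoc: "(a \<odot> b) \<odot> c = a \<odot> (b \<odot> c)"
    and one_mul [simp]: "one \<odot> a = a" and mul_one [simp]: "a \<odot> one = a"
    and norm_one: "norm one \<le> 1"
    and subspace_car: "subspace car" and closed_car: "closed car"
    and one_car: "one \<in> car" and mul_car: "a \<in> car \<Longrightarrow> b \<in> car \<Longrightarrow> a \<odot> b \<in> car"
    and \<iota>_car: "\<iota> z \<in> car" and \<iota>_add: "\<iota> (z + w) = \<iota> z + \<iota> w" and \<iota>_mult: "\<iota> (z * w) = \<iota> z \<odot> \<iota> w"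
    and \<iota>_of_real: "\<iota> (of_real r) = r *\<^sub>R one" and norm_\<iota>: "norm (\<iota> z) \<le> cmod z"
    and \<iota>_central: "a \<in> car \<Longrightarrow> \<iota> z \<odot> a = a \<odot> \<iota> z"
    and U_car: "U t \<in> car" and U_0: "U 0 = one" and U_add: "U (s + t) = U s \<odot> U t"
    and U_central: "a \<in> car \<Longrightarrow> U t \<odot> a = a \<odot> U t" and norm_U: "norm (U t) \<le> 1"
begin

sublocale mul: bounded_bilinear "(\<odot>)" by (rule bilinear)

lemmas car_intros = subspace_add[OF subspace_car] subspace_diff[OF subspace_car]
  subspace_scale[OF subspace_car] subspace_0[OF subspace_car] subspace_sum[OF subspace_car]
  one_car mul_car \<iota>_car U_car

lemma \<iota>_1: "\<iota> 1 = one" using \<iota>_of_real[of 1] by simp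
lemma \<iota>_0: "\<iota> 0 = 0" using \<iota>_of_real[of 0] by simp
lemma \<iota>_minus: "\<iota> (- z) = - \<iota> z" using \<iota>_add[of z "- z"] by (simp add: \<iota>_0 eq_neg_iff_add_eq_0 add.commute)
lemma \<iota>_diff: "\<iota> (z - w) = \<iota> z - \<iota> w" using \<iota>_add[of z "- w"] by (simp add: \<iota>_minus)
lemma \<iota>_sum: "\<iota> (\<Sum>i\<in>I. f i) = (\<Sum>i\<in>I. \<iota> (f i))"
  by (induction I rule: infinite_finite_induct) (simp_all add: \<iota>_0 \<iota>_add)

definition pw :: "'b \<Rightarrow> nat \<Rightarrow> 'b" where
  "pw a n = ((\<odot>) a ^^ n) one"

lemma pw_0 [simp]: "pw a 0 = one" by (simp add: pw_def)
lemma pw_Suc: "pw a (Suc n) = a \<odot> pw a n" by (simp add: pw_def)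
lemma pw_Suc2: "pw a (Suc n) = pw a n \<odot> a"
proof (induction n)
  case (Suc n)
  have "pw a (Suc (Suc n)) = a \<odot> pw a (Suc n)" by (rule pw_Suc)
  also have "\<dots> = (a \<odot> pw a n) \<odot> a" by (simp only: Suc assoc)
  finally show ?case by (simp only: pw_Suc)
qed (simp add: pw_Suc)

lemma pw_car: "a \<in> car \<Longrightarrow> pw a n \<in> car"
  by (induction n) (auto simp: pw_Suc intro: car_intros)

lemma norm_pw: "norm (pw a n) \<le> norm a ^ n"
proof (induction n)
  case 0 then show ?case by (simp add: norm_one)
next
  case (Suc n)
  have "norm (pw a (Suc n)) \<le> norm a * norm (pw a n)" unfolding pw_Suc by (rule norm_mul)
  also have "\<dots> \<le> norm a * norm a ^ n" by (intro mult_left_mono Suc) auto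
  finally show ?case by simp
qed

text \<open>The Neumann series; its sum stays in \<open>car\<close>, which is closed.\<close>

lemma neumann_left_inverse:
  assumes a: "a \<in> car" and less: "norm (one - a) < 1"
  shows "\<exists>b\<in>car. b \<odot> a = one"
proof -
  define x where "x = one - a"
  have xc: "x \<in> car" unfolding x_def by (intro car_intros a)
  have sm: "summable (\<lambda>n. pw x n)"
  proof (rule summable_comparison_test')
    show "summable (\<lambda>n. norm x ^ n)" using less by (intro summable_geometric) (simp add: x_def)
    show "norm (pw x n) \<le> norm x ^ n" for n by (rule norm_pw)
  qed
  define b where "b = suminf (pw x)"
  have lim: "(\<lambda>n. \<Sum>k<n. pw x k) \<longlonglongrightarrow> b" unfolding b_def by (rule summable_LIMSEQ[OF sm])
  have "b \<in> car"
    by (rule closed_sequentially[OF closed_car _ lim]) (intro car_intros pw_car xc)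
  moreover have "b \<odot> a = one"
  proof -
    have "(\<Sum>k<n. pw x k) \<odot> a = one - pw x n" for n
      by (induction n) (simp_all add: mul.add_left mul.zero_left x_def mul.diff_right pw_Suc2 algebra_simps)
    moreover have "(\<lambda>n. (\<Sum>k<n. pw x k) \<odot> a) \<longlonglongrightarrow> b \<odot> a"
      by (intro mul.tendsto lim tendsto_const)
    moreover have "(\<lambda>n. one - pw x n) \<longlonglongrightarrow> one - 0"
      by (intro tendsto_diff tendsto_const summable_LIMSEQ_zero[OF sm])
    ultimately show ?thesis using LIMSEQ_unique by fastforce
  qed
  ultimately show ?thesis by blast
qed

text \<open>Properness is built in as \<open>one \<notin> L\<close>. A real subspace is enough,
  since left multiplication by \<open>\<iota> z\<close> provides complex multiples.\<close>

definition left_ideal :: "'b set \<Rightarrow> bool" where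
  "left_ideal L \<longleftrightarrow> subspace L \<and> L \<subseteq> car \<and> (\<forall>a\<in>car. \<forall>l\<in>L. a \<odot> l \<in> L) \<and> one \<notin> L"

text \<open>A closer element would have a left inverse, which would bring \<open>one\<close> into L.
  Hence maximal left ideals are closed, and \<open>one\<close> keeps norm at least 1 in the
  quotient.\<close>

lemma left_ideal_dist:
  assumes "left_ideal L" "l \<in> L"
  shows "1 \<le> norm (one - l)"
  using neumann_left_inverse[of l] assms unfolding left_ideal_def by (metis not_le subsetD)

text \<open>Absence of a left inverse means that the left ideal of all multiples
  \<open>y \<odot> x\<close> is proper; unions of chains remain proper because they omit
  \<open>one\<close>, and Zorn's lemma applies.\<close>

lemma maximal_left_ideal_exists:
  assumes x: "x \<in> car" and no: "\<not> (\<exists>y\<in>car. y \<odot> x = one)"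
  shows "\<exists>L. left_ideal L \<and> x \<in> L \<and> (\<forall>L'. left_ideal L' \<longrightarrow> L \<subseteq> L' \<longrightarrow> L' = L)"
proof -
  let ?\<A> = "{L. left_ideal L \<and> x \<in> L}"
  let ?L0 = "(\<lambda>y. y \<odot> x) ` car"
  have "left_ideal ?L0" unfolding left_ideal_def
  proof (intro conjI ballI)
    have "linear (\<lambda>y. y \<odot> x)" by (rule bounded_linear.linear[OF mul.bounded_linear_left])
    then show "subspace ?L0" by (rule linear_subspace_image[OF _ subspace_car])
    show "?L0 \<subseteq> car" using x by (auto intro: mul_car)
    show "a \<odot> l \<in> ?L0" if "a \<in> car" "l \<in> ?L0" for a l
      using that by (auto simp: assoc[symmetric] intro: mul_car)
    show "one \<notin> ?L0" using no by force
  qed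
  moreover have "x \<in> ?L0" using one_car by force
  ultimately have ne: "?\<A> \<noteq> {}" by blast
  have "\<exists>M\<in>?\<A>. \<forall>X\<in>?\<A>. M \<subseteq> X \<longrightarrow> X = M"
  proof (rule subset_Zorn_nonempty[OF ne])
    fix \<C> assume \<C>: "\<C> \<noteq> {}" "subset.chain ?\<A> \<C>"
    have ch: "A \<subseteq> B \<or> B \<subseteq> A" if "A \<in> \<C>" "B \<in> \<C>" for A B
      using \<C>(2) that by (auto simp: subset_chain_def)
    have id: "left_ideal A" "x \<in> A" if "A \<in> \<C>" for A
      using \<C>(2) that by (auto simp: subset_chain_def)
    have "left_ideal (\<Union>\<C>)" unfolding left_ideal_def
    proof (intro conjI ballI)
      show "subspace (\<Union>\<C>)" unfolding subspace_def
      proof (intro conjI ballI allI)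
        show "0 \<in> \<Union>\<C>" using \<C>(1) id by (auto simp: left_ideal_def subspace_0)
        show "u + v \<in> \<Union>\<C>" if uv: "u \<in> \<Union>\<C>" "v \<in> \<Union>\<C>" for u v
        proof -
          obtain A B where AB: "A \<in> \<C>" "u \<in> A" "B \<in> \<C>" "v \<in> B" using uv by blast
          with ch[of A B] obtain D where "D \<in> \<C>" "u \<in> D" "v \<in> D" by blast
          then show ?thesis using id(1)[of D] by (auto simp: left_ideal_def intro: subspace_add)
        qed
        show "c *\<^sub>R u \<in> \<Union>\<C>" if u: "u \<in> \<Union>\<C>" for c u
          using u id(1) by (auto simp: left_ideal_def intro: subspace_scale)
      qed
      show "\<Union>\<C> \<subseteq> car" using id(1) by (auto simp: left_ideal_def)
      show "a \<odot> l \<in> \<Union>\<C>" if "a \<in> car" "l \<in> \<Union>\<C>" for a l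
        using that id(1) by (auto simp: left_ideal_def)
      show "one \<notin> \<Union>\<C>" using id(1) by (auto simp: left_ideal_def)
    qed
    then show "\<Union>\<C> \<in> ?\<A>" using \<C>(1) id(2) by blast
  qed
  then obtain M where M: "left_ideal M" "x \<in> M" "\<And>X. left_ideal X \<Longrightarrow> x \<in> X \<Longrightarrow> M \<subseteq> X \<Longrightarrow> X = M" by blast
  then show ?thesis by (intro exI[of _ M]) blast
qed

end

lemma subspace_closure:
  fixes S :: "'c::real_normed_vector set"
  assumes S: "subspace S"
  shows "subspace (closure S)"
proof (rule subspaceI)
  show "0 \<in> closure S" using subspace_0[OF S] closure_subset by blast
  show "u + v \<in> closure S" if uv: "u \<in> closure S" "v \<in> closure S" for u v
  proof -
    obtain x y where xy: "\<And>n. x n \<in> S" "x \<longlonglongrightarrow> u" "\<And>n. y n \<in> S" "y \<longlonglongrightarrow> v"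
      using uv unfolding closure_sequential by blast
    have "\<forall>n. x n + y n \<in> S" using subspace_add[OF S xy(1,3)] by blast
    then show ?thesis using tendsto_add[OF xy(2,4)] unfolding closure_sequential
      by (intro exI[of _ "\<lambda>n. x n + y n"] conjI)
  qed
  show "c *\<^sub>R u \<in> closure S" if u: "u \<in> closure S" for c u
  proof -
    obtain x where x: "\<And>n. x n \<in> S" "x \<longlonglongrightarrow> u" using u unfolding closure_sequential by blast
    have "\<forall>n. c *\<^sub>R x n \<in> S" using subspace_scale[OF S x(1)] by blast
    then show ?thesis using tendsto_scaleR[OF tendsto_const x(2), of c] unfolding closure_sequential
      by (intro exI[of _ "\<lambda>n. c *\<^sub>R x n"] conjI)
  qed
qed

locale maximal_left_ideal = translation_algebra +
  fixes L :: "'a set"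
  assumes L: "left_ideal L" and maximal: "\<And>L'. left_ideal L' \<Longrightarrow> L \<subseteq> L' \<Longrightarrow> L' = L"
begin

lemma L_subspace: "subspace L" and L_car: "l \<in> L \<Longrightarrow> l \<in> car"
  and L_mul: "a \<in> car \<Longrightarrow> l \<in> L \<Longrightarrow> a \<odot> l \<in> L" and one_L: "one \<notin> L"
  using L unfolding left_ideal_def by auto

lemmas L_add = subspace_add[OF L_subspace] and L_diff = subspace_diff[OF L_subspace]
  and L_0 = subspace_0[OF L_subspace] and L_sum = subspace_sum[OF L_subspace]
  and L_scale = subspace_scale[OF L_subspace]

text \<open>The closure is a left ideal, proper since the elements of L keep distance 1 from
  \<open>one\<close>; maximality gives equality.\<close>

lemma L_closed: "closed L"
proof -
  have "left_ideal (closure L)" unfolding left_ideal_def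
  proof (intro conjI ballI)
    show "subspace (closure L)" by (rule subspace_closure[OF L_subspace])
    show "closure L \<subseteq> car" using L_car by (intro closure_minimal closed_car) auto
    show "a \<odot> l \<in> closure L" if a: "a \<in> car" and l: "l \<in> closure L" for a l
    proof -
      obtain s where s: "\<And>n. s n \<in> L" "s \<longlonglongrightarrow> l" using l unfolding closure_sequential by blast
      have "(\<lambda>n. a \<odot> s n) \<longlonglongrightarrow> a \<odot> l" by (intro mul.tendsto tendsto_const s)
      then show ?thesis using L_mul[OF a s(1)] unfolding closure_sequential
        by (intro exI[of _ "\<lambda>n. a \<odot> s n"] conjI allI)
    qed
    show "one \<notin> closure L"
    proof
      assume "one \<in> closure L"
      then obtain l where "l \<in> L" "dist l one < 1" unfolding closure_approachable by (meson zero_less_one)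
      then show False using left_ideal_dist[OF L, of l] by (simp add: dist_norm norm_minus_commute)
    qed
  qed
  from maximal[OF this closure_subset] show ?thesis by (metis closed_closure)
qed

text \<open>Otherwise the sum of L and the multiples of z would be a strictly larger proper left
  ideal: the quotient by L is a simple module, generated by each nonzero class.\<close>

lemma maximal_inverse:
  assumes z: "z \<in> car" "z \<notin> L"
  shows "\<exists>w\<in>car. one - w \<odot> z \<in> L"
proof (rule ccontr)
  assume no: "\<not> ?thesis"
  let ?W = "(\<lambda>y. y \<odot> z) ` car"
  let ?L' = "{l + w | l w. l \<in> L \<and> w \<in> ?W}"
  have W: "subspace ?W"
    by (rule linear_subspace_image[OF bounded_linear.linear[OF mul.bounded_linear_left] subspace_car])
  have "left_ideal ?L'" unfolding left_ideal_def
  proof (intro conjI ballI)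
    show "subspace ?L'" by (rule subspace_sums[OF L_subspace W])
    show "?L' \<subseteq> car" using z L_car by (auto intro!: car_intros)
    show "a \<odot> m \<in> ?L'" if a: "a \<in> car" and m: "m \<in> ?L'" for a m
    proof -
      obtain l y where ly: "l \<in> L" "y \<in> car" "m = l + y \<odot> z" using m by blast
      have "a \<odot> m = a \<odot> l + (a \<odot> y) \<odot> z" by (simp add: ly mul.add_right assoc)
      then show ?thesis using L_mul[OF a ly(1)] mul_car[OF a ly(2)] by blast
    qed
    show "one \<notin> ?L'"
    proof
      assume "one \<in> ?L'"
      then obtain l y where ly: "l \<in> L" "y \<in> car" "one = l + y \<odot> z" by blast
      then have "one - y \<odot> z \<in> L" by simp
      then show False using no ly(2) by blast
    qed
  qed
  moreover have "L \<subseteq> ?L'"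
  proof
    fix l assume "l \<in> L"
    moreover have "0 \<in> ?W" using subspace_0[OF W] .
    ultimately show "l \<in> ?L'" by (metis (mono_tags, lifting) add.right_neutral mem_Collect_eq)
  qed
  ultimately have "?L' = L" by (rule maximal)
  moreover have "z \<in> ?L'"
  proof -
    have "z = 0 + one \<odot> z" by simp
    then show ?thesis using L_0 one_car by blast
  qed
  ultimately show False using z(2) by blast
qed

definition central :: "'a \<Rightarrow> bool" where
  "central z \<longleftrightarrow> z \<in> car \<and> (\<forall>a\<in>car. z \<odot> a = a \<odot> z)"

lemma central_U_diff: "central (U t - \<iota> z)"
  by (auto simp: central_def mul.diff_left mul.diff_right U_central \<iota>_central intro: car_intros)

text \<open>Injectivity in Schur's lemma: for central z the elements b of \<open>car\<close> with b
  z in L form a proper left ideal containing L, hence equal to L.\<close>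

lemma central_cancel:
  assumes z: "central z" "z \<notin> L" and b: "b \<in> car" "b \<odot> z \<in> L"
  shows "b \<in> L"
proof -
  let ?L' = "{b \<in> car. b \<odot> z \<in> L}"
  have "left_ideal ?L'" unfolding left_ideal_def
  proof (intro conjI ballI)
    show "subspace ?L'" unfolding subspace_def
      by (auto simp: mul.add_left mul.scaleR_left intro: car_intros L_add L_scale L_0 simp: mul.zero_left)
    show "a \<odot> l \<in> ?L'" if "a \<in> car" "l \<in> ?L'" for a l
      using that by (auto simp: assoc intro: mul_car L_mul)
    show "one \<notin> ?L'" using z(2) by simp
  qed auto
  moreover have "L \<subseteq> ?L'"
  proof
    fix l assume l: "l \<in> L"
    then have "l \<odot> z = z \<odot> l" using z(1) L_car by (simp add: central_def)
    moreover have "z \<odot> l \<in> L" using l z(1) L_mul by (simp add: central_def)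
    ultimately show "l \<in> ?L'" using L_car[OF l] by simp
  qed
  ultimately have "?L' = L" by (rule maximal)
  then show ?thesis using b by blast
qed

text \<open>The norm of the quotient by L; as L is closed, it vanishes exactly on L.\<close>

definition q :: "'a \<Rightarrow> real" where "q x = infdist x L"

lemma q_nonneg: "0 \<le> q x" by (simp add: q_def infdist_nonneg)

lemma q_le: "l \<in> L \<Longrightarrow> q x \<le> norm (x - l)"
  unfolding q_def using infdist_le by (metis dist_norm)

lemma q_le_norm: "q x \<le> norm x" using q_le[OF L_0] by simp

lemma q_approx:
  assumes "q x < e"
  shows "\<exists>l\<in>L. norm (x - l) < e"
proof -
  have ne: "L \<noteq> {}" using L_0 by blast
  have "Inf ((\<lambda>l. dist x l) ` L) < e" using assms ne by (simp add: q_def infdist_notempty)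
  then obtain l where "l \<in> L" "dist x l < e" using cInf_lessD[of "(\<lambda>l. dist x l) ` L" e] ne by auto
  then show ?thesis by (auto simp: dist_norm)
qed

lemma q_add: "q (x + y) \<le> q x + q y"
proof (rule field_le_epsilon)
  fix e :: real assume "0 < e"
  then obtain l m where lm: "l \<in> L" "norm (x - l) < q x + e/2" "m \<in> L" "norm (y - m) < q y + e/2"
    using q_approx[of x "q x + e/2"] q_approx[of y "q y + e/2"] by auto
  have "q (x + y) \<le> norm ((x + y) - (l + m))" by (rule q_le[OF L_add[OF lm(1,3)]])
  also have "\<dots> \<le> norm (x - l) + norm (y - m)" by (rule norm_diff_triangle_ineq)
  finally show "q (x + y) \<le> q x + q y + e" using lm by simp
qed

lemma q_mul:
  assumes "a \<in> car"
  shows "q (a \<odot> x) \<le> norm a * q x"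
proof (rule field_le_epsilon)
  fix e :: real assume e: "0 < e"
  define d where "d = e / (norm a + 1)"
  have d: "0 < d" using e by (simp add: d_def add_nonneg_pos)
  obtain l where l: "l \<in> L" "norm (x - l) < q x + d" using q_approx[of x "q x + d"] d by auto
  have "q (a \<odot> x) \<le> norm (a \<odot> x - a \<odot> l)" by (rule q_le[OF L_mul[OF assms l(1)]])
  also have "\<dots> \<le> norm a * norm (x - l)" using norm_mul[of a "x - l"] by (simp add: mul.diff_right)
  also have "\<dots> \<le> norm a * (q x + d)" using l by (intro mult_left_mono) auto
  also have "\<dots> \<le> norm a * q x + (norm a + 1) * d" using d by (simp add: algebra_simps)
  also have "(norm a + 1) * d = e" by (simp add: d_def add_nonneg_eq_0_iff)
  finally show "q (a \<odot> x) \<le> norm a * q x + e" .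
qed

lemma q_\<iota>_mul: "q (\<iota> z \<odot> x) \<le> cmod z * q x"
  by (rule order_trans[OF q_mul[OF \<iota>_car] mult_right_mono[OF norm_\<iota> q_nonneg]])

lemma q_minus: "q (- x) = q x"
proof -
  have "q (- x) \<le> q x" for x
  proof -
    have "- x = \<iota> (- 1) \<odot> x" by (simp add: \<iota>_minus \<iota>_1 mul.minus_left)
    then show ?thesis using q_\<iota>_mul[of "- 1" x] by simp
  qed
  from this[of x] this[of "- x"] show ?thesis by simp
qed

lemma q_diff: "q (x - y) \<le> q x + q y"
  using q_add[of x "- y"] by (simp add: q_minus)

lemma q_one: "1 \<le> q one"
proof (rule ccontr)
  assume "\<not> 1 \<le> q one"
  then obtain l where "l \<in> L" "norm (one - l) < 1" using q_approx[of one 1] by auto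
  then show False using left_ideal_dist[OF L] by force
qed

lemma q_sum: "finite I \<Longrightarrow> q (\<Sum>i\<in>I. f i) \<le> (\<Sum>i\<in>I. q (f i))"
proof (induction I rule: finite_induct)
  case empty then show ?case using q_le_norm[of 0] by simp
next
  case (insert i I) then show ?case using q_add[of "f i" "\<Sum>i\<in>I. f i"] by simp
qed

lemma q_zero_imp: "q x = 0 \<Longrightarrow> x \<in> L"
  using in_closed_iff_infdist_zero[OF L_closed] L_0 by (auto simp: q_def)

lemma L_q_zero: "x \<in> L \<Longrightarrow> q x = 0"
  using q_le[of x x] q_nonneg[of x] by simp

text \<open>A quantitative Schur lemma: right multiplication by w, an inverse of z modulo L, undoes
  multiplication by z and has norm at most |w| in the quotient.\<close>

lemma central_bounded_below:
  assumes z: "central z" "z \<notin> L"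
  shows "\<exists>M>0. \<forall>b\<in>car. q b \<le> M * q (b \<odot> z)"
proof -
  have zc: "z \<in> car" using z(1) by (simp add: central_def)
  obtain w where w: "w \<in> car" "one - w \<odot> z \<in> L" using maximal_inverse[OF zc z(2)] by blast
  \<comment> \<open>A left ideal is not stable under right multiplication in general. Here (l w) z
    differs from l by an element of L, and the central z can be cancelled.\<close>
  have Lw: "l \<odot> w \<in> L" if l: "l \<in> L" for l
  proof (rule central_cancel[OF z mul_car[OF L_car[OF l] w(1)]])
    have "(l \<odot> w) \<odot> z = l - l \<odot> (one - w \<odot> z)" by (simp add: mul.diff_right assoc)
    then show "(l \<odot> w) \<odot> z \<in> L" using L_diff[OF l L_mul[OF L_car[OF l] w(2)]] by simp
  qed
  have "q b \<le> (norm w + 1) * q (b \<odot> z)" if b: "b \<in> car" for b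
  proof -
    have bw: "q ((b \<odot> z) \<odot> w) \<le> q (b \<odot> z) * norm w"
    proof (rule field_le_epsilon)
      fix e :: real assume e: "0 < e"
      define d where "d = e / (norm w + 1)"
      have d: "0 < d" using e by (simp add: d_def add_nonneg_pos)
      obtain l where l: "l \<in> L" "norm (b \<odot> z - l) < q (b \<odot> z) + d"
        using q_approx[of "b \<odot> z" "q (b \<odot> z) + d"] d by auto
      have "q ((b \<odot> z) \<odot> w) \<le> norm ((b \<odot> z) \<odot> w - l \<odot> w)" by (rule q_le[OF Lw[OF l(1)]])
      also have "\<dots> \<le> norm (b \<odot> z - l) * norm w" using norm_mul[of "b \<odot> z - l" w] by (simp add: mul.diff_left)
      also have "\<dots> \<le> (q (b \<odot> z) + d) * norm w" using l by (intro mult_right_mono) auto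
      also have "\<dots> \<le> q (b \<odot> z) * norm w + (norm w + 1) * d" using d by (simp add: algebra_simps)
      also have "(norm w + 1) * d = e" by (simp add: d_def add_nonneg_eq_0_iff)
      finally show "q ((b \<odot> z) \<odot> w) \<le> q (b \<odot> z) * norm w + e" .
    qed
    have "(b \<odot> z) \<odot> w = b \<odot> (w \<odot> z)" using z(1) w(1) by (simp add: assoc central_def)
    then have "b = b \<odot> (one - w \<odot> z) + (b \<odot> z) \<odot> w" by (simp add: mul.diff_right)
    then have "q b \<le> q (b \<odot> (one - w \<odot> z)) + q ((b \<odot> z) \<odot> w)" using q_add by metis
    also have "q (b \<odot> (one - w \<odot> z)) = 0" by (rule L_q_zero[OF L_mul[OF b w(2)]])
    also have "0 + q ((b \<odot> z) \<odot> w) \<le> (norm w + 1) * q (b \<odot> z)"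
      using bw q_nonneg[of "b \<odot> z"] by (simp add: algebra_simps)
    finally show ?thesis .
  qed
  then show ?thesis by (intro exI[of _ "norm w + 1"]) (auto simp: add_nonneg_pos)
qed

end

subsection \<open>A central isometry acts on a simple module as a scalar\<close>

context maximal_left_ideal
begin

text \<open>Replacing c by d costs at most M |d - c| q(b) \<le> q(b)/2, which is absorbed on the
  left at the price of doubling the constant.\<close>

lemma bounded_below_perturb:
  assumes M: "0 < M" "\<And>b. b \<in> car \<Longrightarrow> q b \<le> M * q (b \<odot> (u - \<iota> c))" and d: "cmod (d - c) \<le> 1 / (2 * M)"
    and b: "b \<in> car"
  shows "q b \<le> 2 * M * q (b \<odot> (u - \<iota> d))"
proof -
  have "b \<odot> (u - \<iota> c) = b \<odot> (u - \<iota> d) + \<iota> (d - c) \<odot> b"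
    using \<iota>_central[OF b] by (simp add: \<iota>_diff mul.diff_right mul.diff_left)
  then have "q (b \<odot> (u - \<iota> c)) \<le> q (b \<odot> (u - \<iota> d)) + cmod (d - c) * q b"
    using q_add[of "b \<odot> (u - \<iota> d)" "\<iota> (d - c) \<odot> b"] q_\<iota>_mul[of "d - c" b] by simp
  also have "\<dots> \<le> q (b \<odot> (u - \<iota> d)) + 1 / (2 * M) * q b"
    using d by (intro add_left_mono mult_right_mono q_nonneg)
  finally have "q b \<le> M * (q (b \<odot> (u - \<iota> d)) + 1 / (2 * M) * q b)"
    using M(2)[OF b] mult_left_mono[of "q (b \<odot> (u - \<iota> c))" _ M] M(1) by (meson less_imp_le order_trans)
  also have "\<dots> = M * q (b \<odot> (u - \<iota> d)) + q b / 2" using M(1) by (simp add: field_simps)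
  finally show ?thesis by simp
qed

text \<open>Each lower bound persists, with doubled constant, in a disc of radius 1/(2M), and
  finitely many such discs cover the circle.\<close>

lemma bounded_below_uniform:
  assumes "\<And>c. cmod c = 1 \<Longrightarrow> central (u - \<iota> c) \<and> u - \<iota> c \<notin> L"
  shows "\<exists>M>0. \<forall>c. cmod c = 1 \<longrightarrow> (\<forall>b\<in>car. q b \<le> M * q (b \<odot> (u - \<iota> c)))"
proof -
  have "\<forall>c. \<exists>M. cmod c = 1 \<longrightarrow> M > 0 \<and> (\<forall>b\<in>car. q b \<le> M * q (b \<odot> (u - \<iota> c)))"
    using assms central_bounded_below by blast
  from choice[OF this] obtain M where M: "\<And>c. cmod c = 1 \<Longrightarrow> M c > 0"
    "\<And>c b. cmod c = 1 \<Longrightarrow> b \<in> car \<Longrightarrow> q b \<le> M c * q (b \<odot> (u - \<iota> c))" by blast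
  let ?B = "\<lambda>c. ball c (1 / (2 * M c))"
  have "sphere (0::complex) 1 \<subseteq> (\<Union>c\<in>sphere 0 1. ?B c)" using M(1) by force
  from compactE_image[OF compact_sphere _ this] obtain D where
    D: "D \<subseteq> sphere 0 1" "finite D" "sphere 0 1 \<subseteq> (\<Union>c\<in>D. ?B c)" by blast
  \<comment> \<open>The sum dominates the doubled constant of every disc; the 1 keeps N
    positive.\<close>
  define N where "N = (\<Sum>c\<in>D. 2 * M c) + 1"
  have Mpos: "0 \<le> 2 * M c" if "c \<in> D" for c using M(1)[of c] D(1) that by (auto simp: less_imp_le)
  have "q b \<le> N * q (b \<odot> (u - \<iota> c))" if c: "cmod c = 1" and b: "b \<in> car" for b c
  proof -
    obtain d where d: "d \<in> D" "dist d c < 1 / (2 * M d)" using D(3) c by force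
    have d1: "cmod d = 1" using D(1) d(1) by auto
    have "q b \<le> 2 * M d * q (b \<odot> (u - \<iota> c))"
      using bounded_below_perturb[of "M d" u d c b] M[OF d1] b d(2) by (auto simp: dist_norm norm_minus_commute)
    also have "2 * M d \<le> (\<Sum>c\<in>D. 2 * M c)" using D(2) d(1) Mpos by (intro member_le_sum) auto
    then have "2 * M d * q (b \<odot> (u - \<iota> c)) \<le> N * q (b \<odot> (u - \<iota> c))"
      by (intro mult_right_mono q_nonneg) (simp add: N_def)
    finally show ?thesis .
  qed
  moreover have "N > 0" using Mpos by (simp add: N_def add_nonneg_pos sum_nonneg)
  ultimately show ?thesis by blast
qed

section \<open>Expansions of the resolvent on the two sides of the unit circle\<close>

lemma q_\<iota>_U: "q (\<iota> z \<odot> U s) \<le> cmod z"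
proof -
  have "q (\<iota> z \<odot> U s) \<le> cmod z * q (U s)" by (rule q_\<iota>_mul)
  also have "\<dots> \<le> cmod z * 1"
    using q_le_norm[of "U s"] norm_U[of s] by (intro mult_left_mono) auto
  finally show ?thesis by simp
qed

lemma q_\<iota>: "q (\<iota> z) \<le> cmod z"
  using q_le_norm[of "\<iota> z"] norm_\<iota>[of z] by simp

text \<open>Partial sums of the expansion of c (c - \<open>U t\<close>)^-1 in powers of
  \<open>U t\<close>/c. The remainder has size |c|^(1-n), small for |c| > 1.\<close>

lemma resolvent_sum_outer:
  assumes "c \<noteq> 0"
  shows "(\<Sum>k<n. \<iota> (inverse c ^ k) \<odot> U (real k * t)) \<odot> (U t - \<iota> c)
    = \<iota> (inverse c ^ n * c) \<odot> U (real n * t) - \<iota> c"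
proof (induction n)
  case 0 then show ?case by (simp add: U_0 mul.zero_left)
next
  case (Suc n)
  have 1: "\<iota> (inverse c ^ n) \<odot> U (real n * t) \<odot> U t = \<iota> (inverse c ^ Suc n * c) \<odot> U (real (Suc n) * t)"
  proof -
    have "inverse c ^ Suc n * c = inverse c ^ n" using assms by simp
    moreover have "real (Suc n) * t = real n * t + t" by (simp add: algebra_simps)
    ultimately show ?thesis by (simp only: assoc U_add)
  qed
  have 2: "\<iota> (inverse c ^ n) \<odot> U (real n * t) \<odot> \<iota> c = \<iota> (inverse c ^ n * c) \<odot> U (real n * t)"
    by (simp add: assoc U_central[OF \<iota>_car] \<iota>_mult)
  show ?case
    unfolding sum.lessThan_Suc mul.add_left Suc
    unfolding mul.diff_right 1 2 by simp
qed

text \<open>Partial sums of the expansion of -c (c - \<open>U t\<close>)^-1 in inverse powers of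
  \<open>U t\<close>, with a remainder of size |c|^(n+1). The sign is opposite to that of the outer
  expansion, so adding the two compares the resolvent on both sides of the circle.\<close>

lemma resolvent_sum_inner:
  "(\<Sum>k<n. \<iota> (c ^ Suc k) \<odot> U (- (real (Suc k) * t))) \<odot> (U t - \<iota> c)
    = \<iota> c - \<iota> (c ^ Suc n) \<odot> U (- (real n * t))"
proof (induction n)
  case 0 then show ?case by (simp add: U_0 mul.zero_left)
next
  case (Suc n)
  have 1: "\<iota> (c ^ Suc n) \<odot> U (- (real (Suc n) * t)) \<odot> U t = \<iota> (c ^ Suc n) \<odot> U (- (real n * t))"
    by (simp add: assoc algebra_simps flip: U_add)
  have 2: "\<iota> (c ^ Suc n) \<odot> U (- (real (Suc n) * t)) \<odot> \<iota> c = \<iota> (c ^ Suc (Suc n)) \<odot> U (- (real (Suc n) * t))"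
  proof -
    have "\<iota> (c ^ Suc n) \<odot> U (- (real (Suc n) * t)) \<odot> \<iota> c = \<iota> (c ^ Suc n * c) \<odot> U (- (real (Suc n) * t))"
      by (simp only: assoc U_central[OF \<iota>_car] \<iota>_mult)
    then show ?thesis by (simp only: power_Suc2[of c "Suc n"])
  qed
  show ?case
    unfolding sum.lessThan_Suc mul.add_left Suc
    unfolding mul.diff_right 1 2 by simp
qed

text \<open>Otherwise the resolvent of \<open>U t\<close> would extend continuously across the unit circle as an
  operator modulo \<open>L\<close>. But averaging over roots of unity distinguishes the two sides: the average
  of \<open>c (c - U t)\<^sup>-\<^sup>1\<close> is close to the identity for \<open>\<bar>c\<bar> > 1\<close> and close to \<open>0\<close> for \<open>\<bar>c\<bar> < 1\<close>
  (Rickart's proof of the nonemptiness of the spectrum).\<close>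

lemma U_scalar: "\<exists>c. cmod c = 1 \<and> U t - \<iota> c \<in> L"
proof (rule ccontr)
  assume no: "\<not> ?thesis"
  then have "\<And>c. cmod c = 1 \<Longrightarrow> central (U t - \<iota> c) \<and> U t - \<iota> c \<notin> L"
    using central_U_diff by blast
  from bounded_below_uniform[OF this]
  obtain M where M: "M > 0" "\<And>c b. cmod c = 1 \<Longrightarrow> b \<in> car \<Longrightarrow> q b \<le> M * q (b \<odot> (U t - \<iota> c))" by blast
  \<comment> \<open>The lower bound with constant M on the circle becomes one with constant 2M
    within distance 1/(2M) of it.\<close>
  define M' where "M' = 2 * M"
  have M': "M' > 0" using M(1) by (simp add: M'_def)
  \<comment> \<open>\<eta> = 1/D is the distance of the test points from the circle. D secures
    \<eta> < 1 and \<eta> \<le> 1/M' = 1/(2M), and makes M'(2 + 4M')\<eta>, the part of the final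
    estimate that does not decay in n, at most 1/4.\<close>
  define D where "D = 4 * (M' + 1) * (2 + 4 * M')"
  have D: "D = 8 + 24 * M' + 4 * (M' * (4 * M'))" unfolding D_def by (simp add: algebra_simps)
  have MM: "0 < M' * (4 * M')" using M' by simp
  have den: "D > 1" "D \<ge> M'" "D \<ge> 4 * (M' * (2 + 4 * M'))"
    using M' MM unfolding D distrib_left by linarith+
  define \<eta> where "\<eta> = 1 / D"
  have \<eta>0: "0 < \<eta>" and \<eta>1: "\<eta> < 1" using den(1) by (auto simp: \<eta>_def)
  have \<eta>M: "\<eta> \<le> 1 / M'" using den(2) M' by (simp add: \<eta>_def frac_le)
  have \<eta>s: "M' * (2 + 4 * M') * \<eta> \<le> 1/4"
    using den(1,3) by (simp add: \<eta>_def divide_le_eq)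
  define \<rho> where "\<rho> = inverse (1 + \<eta>)"
  define \<sigma> where "\<sigma> = 1 - \<eta>"
  have \<rho>: "0 < \<rho>" "\<rho> < 1" and \<sigma>: "0 < \<sigma>" "\<sigma> < 1"
    using \<eta>0 \<eta>1 by (auto simp: \<rho>_def \<sigma>_def inverse_less_1_iff)
  \<comment> \<open>Solves (3M' + 1) e = 1/2, the share left to the terms that decay in n.\<close>
  define e where "e = 1 / (2 * (3 * M' + 1))"
  have e: "0 < e" using M' by (simp add: e_def)
  have "\<forall>\<^sub>F n in sequentially. \<rho> ^ n < e" "\<forall>\<^sub>F n in sequentially. \<sigma> ^ n < e"
    using \<rho> \<sigma> e by (auto intro!: order_tendstoD(2)[OF LIMSEQ_power_zero])
  then have "\<forall>\<^sub>F n in sequentially. \<rho> ^ n < e \<and> \<sigma> ^ n < e \<and> n \<ge> 1"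
    by (intro eventually_conj eventually_ge_at_top)
  then obtain n where n: "\<rho> ^ n < e" "\<sigma> ^ n < e" "n \<ge> 1" by (auto simp: eventually_sequentially)
  define \<omega> where "\<omega> j = (exp (2 * of_real pi * \<i> * of_nat j / of_nat n) :: complex)" for j :: nat
  have \<omega>n: "\<omega> j ^ n = 1" for j unfolding \<omega>_def using n(3) by (intro complex_root_unity) auto
  have \<omega>1: "cmod (\<omega> j) = 1" for j unfolding \<omega>_def by (simp add: norm_exp_eq_Re)
  have \<omega>s: "(\<Sum>j<n. \<omega> j ^ k) = 0" if "0 < k" "k < n" for k
    unfolding \<omega>_def by (rule sum_root_of_unity_powers[OF that])
  \<comment> \<open>\<open>c j\<close> lies just outside and \<open>d j\<close> just inside the
    circle, on the ray of the same root of unity.\<close>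
  define c where "c j = \<omega> j * of_real (1 + \<eta>)" for j
  define d where "d j = \<omega> j * of_real \<sigma>" for j
  define X where "X j = (\<Sum>k<n. \<iota> (inverse (c j) ^ k) \<odot> U (real k * t))" for j
  define Y where "Y j = (\<Sum>k<n. \<iota> (d j ^ Suc k) \<odot> U (- (real (Suc k) * t)))" for j
  have XY_car: "X j \<in> car" "Y j \<in> car" for j unfolding X_def Y_def by (intro car_intros)+
  have nc: "cmod (c j) = 1 + \<eta>" and nd: "cmod (d j) = \<sigma>" for j
    using \<eta>0 \<sigma> unfolding c_def d_def norm_mult \<omega>1 norm_of_real by auto
  \<comment> \<open>Summation over the roots of unity removes every power k with 0 < k < n; only the
    constant term survives.\<close>
  have sumX: "(\<Sum>j<n. X j) = \<iota> (of_nat n)"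
  proof -
    have "(\<Sum>j<n. X j) = (\<Sum>k<n. \<iota> (\<Sum>j<n. inverse (c j) ^ k) \<odot> U (real k * t))"
      unfolding X_def \<iota>_sum mul.sum_left by (rule sum.swap)
    also have "\<dots> = (\<Sum>k<n. if k = 0 then \<iota> (of_nat n) else 0)"
    proof (rule sum.cong[OF refl])
      fix k assume k: "k \<in> {..<n}"
      show "\<iota> (\<Sum>j<n. inverse (c j) ^ k) \<odot> U (real k * t) = (if k = 0 then \<iota> (of_nat n) else 0)"
      proof (cases "k = 0")
        case False
        have "inverse (\<omega> j) = cnj (\<omega> j)" for j
          using \<omega>1[of j] by (simp add: inverse_unique complex_norm_square[symmetric] flip: complex_mult_cnj)
        then have "(\<Sum>j<n. inverse (c j) ^ k) = (\<Sum>j<n. cnj (\<omega> j ^ k) * of_real \<rho> ^ k)"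
          by (intro sum.cong refl) (simp add: c_def \<rho>_def power_mult_distrib of_real_inverse)
        also have "\<dots> = cnj (\<Sum>j<n. \<omega> j ^ k) * of_real \<rho> ^ k"
          by (simp add: sum_distrib_right)
        also have "\<dots> = 0" using \<omega>s[of k] False k by simp
        finally show ?thesis using False by (simp add: \<iota>_0 mul.zero_left)
      qed (simp add: U_0)
    qed
    also have "\<dots> = \<iota> (of_nat n)" using n(3) by (simp add: sum.delta)
    finally show ?thesis .
  qed
  \<comment> \<open>Here the exponents run from 1 to n, so only the last one survives, with the
    factor \<sigma>^n.\<close>
  have sumY: "q (\<Sum>j<n. Y j) \<le> real n * \<sigma> ^ n"
  proof -
    have "(\<Sum>j<n. Y j) = (\<Sum>k<n. \<iota> (\<Sum>j<n. d j ^ Suc k) \<odot> U (- (real (Suc k) * t)))"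
      unfolding Y_def \<iota>_sum mul.sum_left by (rule sum.swap)
    also have "\<dots> = (\<Sum>k<n. if k = n - 1 then \<iota> (of_nat n * of_real \<sigma> ^ n) \<odot> U (- (real n * t)) else 0)"
    proof (rule sum.cong[OF refl])
      fix k assume k: "k \<in> {..<n}"
      have s: "(\<Sum>j<n. d j ^ Suc k) = (\<Sum>j<n. \<omega> j ^ Suc k) * of_real \<sigma> ^ Suc k"
        unfolding d_def power_mult_distrib by (rule sum_distrib_right[symmetric])
      show "\<iota> (\<Sum>j<n. d j ^ Suc k) \<odot> U (- (real (Suc k) * t))
        = (if k = n - 1 then \<iota> (of_nat n * of_real \<sigma> ^ n) \<odot> U (- (real n * t)) else 0)"
      proof (cases "k = n - 1")
        case True
        then have "Suc k = n" using n(3) by simp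
        then show ?thesis unfolding s using True by (simp add: \<omega>n)
      next
        case False
        then have "Suc k < n" using k by auto
        then have "(\<Sum>j<n. d j ^ Suc k) = 0" unfolding s using \<omega>s[of "Suc k"] by simp
        then show ?thesis using False by (simp only: \<iota>_0 mul.zero_left if_False)
      qed
    qed
    also have "\<dots> = \<iota> (of_nat n * of_real \<sigma> ^ n) \<odot> U (- (real n * t))"
      using n(3) by (simp add: sum.delta)
    finally have "q (\<Sum>j<n. Y j) \<le> cmod (of_nat n * of_real \<sigma> ^ n)" using q_\<iota>_U by metis
    also have "\<dots> = real n * \<sigma> ^ n" using \<sigma> by (simp add: norm_mult norm_power)
    finally show ?thesis .
  qed
  \<comment> \<open>After multiplication by \<open>U t - \<iota> (c j)\<close> the constants -c and
    d of the two expansions nearly cancel. What remains is the two remainders, the gap |d - c| =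
    2\<eta>, and the gap times Y, for which Y is bounded first.\<close>
  have qXY: "q (X j + Y j) \<le> M' * (2 * \<rho> ^ n + \<sigma> ^ n + 2 * \<eta> + 4 * M' * \<eta>)" for j
  proof -
    have cj0: "c j \<noteq> 0" using nc[of j] \<eta>0 by auto
    have cw: "cmod (c j - \<omega> j) \<le> 1 / (2 * M)" "cmod (d j - \<omega> j) \<le> 1 / (2 * M)"
    proof -
      have "c j - \<omega> j = \<omega> j * of_real \<eta>" "d j - \<omega> j = - (\<omega> j * of_real \<eta>)"
        by (simp_all add: c_def d_def \<sigma>_def algebra_simps)
      then show "cmod (c j - \<omega> j) \<le> 1 / (2 * M)" "cmod (d j - \<omega> j) \<le> 1 / (2 * M)"
        using \<eta>0 \<eta>M \<omega>1[of j] by (simp_all add: norm_mult M'_def)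
    qed
    have low: "q b \<le> M' * q (b \<odot> (U t - \<iota> z))" if "cmod (z - \<omega> j) \<le> 1 / (2 * M)" "b \<in> car" for b z
      using bounded_below_perturb[OF M(1) M(2)[OF \<omega>1[of j]] that] by (simp add: M'_def)
    have dpow: "cmod (d j ^ Suc n) \<le> \<sigma> ^ n"
      unfolding norm_power nd using \<sigma> by (intro power_decreasing) auto
    have "q (Y j) \<le> M' * q (Y j \<odot> (U t - \<iota> (d j)))"
      by (rule low[OF cw(2) XY_car(2)])
    also have "q (Y j \<odot> (U t - \<iota> (d j))) \<le> q (\<iota> (d j)) + q (\<iota> (d j ^ Suc n) \<odot> U (- (real n * t)))"
      unfolding Y_def resolvent_sum_inner by (rule q_diff)
    also have "\<dots> \<le> 1 + 1"
    proof (rule add_mono)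
      show "q (\<iota> (d j)) \<le> 1" using q_\<iota>[of "d j"] nd[of j] \<sigma> by simp
      have "\<sigma> ^ n \<le> 1" using \<sigma> by (intro power_le_one) auto
      then show "q (\<iota> (d j ^ Suc n) \<odot> U (- (real n * t))) \<le> 1"
        using q_\<iota>_U[of "d j ^ Suc n" "- (real n * t)"] dpow by linarith
    qed
    finally have qY: "q (Y j) \<le> 2 * M'" using M' by simp
    have eq: "(X j + Y j) \<odot> (U t - \<iota> (c j)) = \<iota> (inverse (c j) ^ n * c j) \<odot> U (real n * t)
        - \<iota> (d j ^ Suc n) \<odot> U (- (real n * t)) + \<iota> (d j - c j) + \<iota> (d j - c j) \<odot> Y j"
    proof -
      have 1: "X j \<odot> (U t - \<iota> (c j)) = \<iota> (inverse (c j) ^ n * c j) \<odot> U (real n * t) - \<iota> (c j)"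
        unfolding X_def by (rule resolvent_sum_outer[OF cj0])
      have 2: "Y j \<odot> (U t - \<iota> (d j)) = \<iota> (d j) - \<iota> (d j ^ Suc n) \<odot> U (- (real n * t))"
        unfolding Y_def by (rule resolvent_sum_inner)
      have "Y j \<odot> (U t - \<iota> (c j)) = Y j \<odot> (U t - \<iota> (d j)) + Y j \<odot> \<iota> (d j - c j)"
        by (simp add: \<iota>_diff mul.diff_right)
      then have "Y j \<odot> (U t - \<iota> (c j)) = \<iota> (d j) - \<iota> (d j ^ Suc n) \<odot> U (- (real n * t)) + \<iota> (d j - c j) \<odot> Y j"
        unfolding 2 \<iota>_central[OF XY_car(2)] .
      then show ?thesis by (simp add: mul.add_left 1 \<iota>_diff del: power_Suc)
    qed
    have cd: "cmod (d j - c j) = 2 * \<eta>"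
    proof -
      have "d j - c j = - (\<omega> j * of_real (2 * \<eta>))" by (simp add: c_def d_def \<sigma>_def algebra_simps)
      then show ?thesis using \<eta>0 \<omega>1[of j] by (simp add: norm_mult)
    qed
    have c1: "cmod (inverse (c j) ^ n * c j) \<le> 2 * \<rho> ^ n"
    proof -
      have "cmod (inverse (c j) ^ n * c j) = \<rho> ^ n * (1 + \<eta>)"
        by (simp add: norm_mult norm_power norm_inverse nc \<rho>_def)
      also have "\<dots> \<le> \<rho> ^ n * 2" using \<rho> \<eta>1 by (intro mult_left_mono) auto
      finally show ?thesis by simp
    qed
    have "q (X j + Y j) \<le> M' * q ((X j + Y j) \<odot> (U t - \<iota> (c j)))"
      by (rule low[OF cw(1)]) (intro car_intros XY_car)
    also have "q ((X j + Y j) \<odot> (U t - \<iota> (c j))) \<le> 2 * \<rho> ^ n + \<sigma> ^ n + 2 * \<eta> + 4 * M' * \<eta>"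
      unfolding eq
    proof (intro order_trans[OF q_add] add_mono order_trans[OF q_diff])
      show "q (\<iota> (inverse (c j) ^ n * c j) \<odot> U (real n * t)) \<le> 2 * \<rho> ^ n"
        using q_\<iota>_U c1 by (rule order_trans)
      show "q (\<iota> (d j ^ Suc n) \<odot> U (- (real n * t))) \<le> \<sigma> ^ n"
        using q_\<iota>_U dpow by (rule order_trans)
      show "q (\<iota> (d j - c j)) \<le> 2 * \<eta>" using q_\<iota>[of "d j - c j"] cd by simp
      have "q (\<iota> (d j - c j) \<odot> Y j) \<le> 2 * \<eta> * q (Y j)" using q_\<iota>_mul[of "d j - c j" "Y j"] cd by simp
      also have "\<dots> \<le> 2 * \<eta> * (2 * M')" using \<eta>0 qY by (intro mult_left_mono) auto
      finally show "q (\<iota> (d j - c j) \<odot> Y j) \<le> 4 * M' * \<eta>" by (simp add: mult_ac)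
    qed
    finally show ?thesis using M' by simp
  qed
  \<comment> \<open>n times \<open>one\<close> is the sum of the \<open>X j + Y j\<close> minus the
    sum of the \<open>Y j\<close>; dividing the estimates by n leaves 1 \<le> 1/2 + 1/4.\<close>
  have "real n * 1 \<le> real n * q one" using q_one by (intro mult_left_mono) auto
  also have "\<dots> \<le> q (\<iota> (of_nat n))"
  proof -
    have "one = \<iota> (of_real (1 / real n)) \<odot> \<iota> (of_nat n)"
      using n(3) by (simp add: \<iota>_1 flip: \<iota>_mult)
    then have "q one \<le> cmod (of_real (1 / real n)) * q (\<iota> (of_nat n))" using q_\<iota>_mul by metis
    then show ?thesis using n(3) by (simp add: norm_divide field_simps)
  qed
  also have "\<iota> (of_nat n) = (\<Sum>j<n. X j + Y j) - (\<Sum>j<n. Y j)" by (simp add: sum.distrib sumX)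
  also have "q \<dots> \<le> (\<Sum>j<n. q (X j + Y j)) + real n * \<sigma> ^ n"
    by (rule order_trans[OF q_diff add_mono[OF q_sum[OF finite_lessThan] sumY]])
  also have "(\<Sum>j<n. q (X j + Y j)) \<le> (\<Sum>j<n. M' * (2 * \<rho> ^ n + \<sigma> ^ n + 2 * \<eta> + 4 * M' * \<eta>))"
    by (intro sum_mono qXY)
  finally have "real n * 1 \<le> real n * (M' * (2 * \<rho> ^ n + \<sigma> ^ n + 2 * \<eta> + 4 * M' * \<eta>) + \<sigma> ^ n)"
    by (simp add: algebra_simps)
  then have "1 \<le> M' * (2 * \<rho> ^ n + \<sigma> ^ n + 2 * \<eta> + 4 * M' * \<eta>) + \<sigma> ^ n"
    using n(3) by (simp only: mult_le_cancel_left)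
  also have "\<dots> = M' * (2 * \<rho> ^ n + \<sigma> ^ n) + \<sigma> ^ n + M' * (2 + 4 * M') * \<eta>" by (simp add: algebra_simps)
  also have "\<dots> \<le> M' * (2 * e + e) + e + 1/4"
    using n M' \<eta>s by (intro add_mono mult_left_mono) auto
  also have "M' * (2 * e + e) + e = 1/2" using M' by (simp add: e_def field_simps)
  finally show False by simp
qed

end

subsection \<open>Inversion by localization at the characters\<close>

text \<open>\<open>C\<close>, \<open>H\<close>, \<open>P\<close> and \<open>G\<close> stand for
  convolution with a box, pointwise application of That(l), the power (-A)^N and the geometric sum
  below it. In the approximation hypothesis both sums share the coefficients \<open>B j\<close>, so
  modulo L, where each \<open>U (\<sigma> j)\<close> is a scalar, they coincide as soon as these
  scalars are the values of the character at frequency l.\<close>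

lemma (in translation_algebra) left_invertible:
  fixes A P G :: 'b and C :: "real \<Rightarrow> 'b" and H :: "real \<Rightarrow> 'b"
  assumes A: "A \<in> car"
    and C: "\<And>\<tau>. 0 < \<tau> \<Longrightarrow> C \<tau> \<in> car" "\<And>\<tau>. 0 < \<tau> \<Longrightarrow> C \<tau> \<odot> A = A \<odot> C \<tau>"
      "\<And>\<tau>. 0 < \<tau> \<Longrightarrow> ((\<lambda>t. norm ((U t - one) \<odot> C \<tau>)) \<longlongrightarrow> 0) (at 0)"
    and H: "\<And>l. H l \<in> car" "\<And>\<tau> l. 0 < \<tau> \<Longrightarrow> C \<tau> \<odot> H l = H l \<odot> C \<tau>"
      "\<And>l. \<exists>h\<in>car. h \<odot> (one + H l) = one"
    and approx: "\<And>\<tau> l e. 0 < \<tau> \<Longrightarrow> 0 < e \<Longrightarrow> \<exists>(n::nat) \<sigma> B. (\<forall>j<n. B j \<in> car)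
        \<and> norm (C \<tau> \<odot> A - (\<Sum>j<n. U (\<sigma> j) \<odot> B j)) \<le> e
        \<and> norm (C \<tau> \<odot> H l - (\<Sum>j<n. \<iota> (exp (- \<i> * of_real l * of_real (\<sigma> j))) \<odot> B j)) \<le> e"
    and P: "P \<in> car" "\<And>\<tau>. 0 < \<tau> \<Longrightarrow> C \<tau> \<odot> P = P \<odot> C \<tau>"
      "\<And>e. 0 < e \<Longrightarrow> \<exists>\<tau>>0. norm (P - (1 / \<tau>) *\<^sub>R (C \<tau> \<odot> P)) \<le> e"
    and G: "G \<in> car" "G \<odot> (one + A) = one - P"
  shows "\<exists>y\<in>car. y \<odot> (one + A) = one"
proof (rule ccontr)
  assume no: "\<not> ?thesis"
  have MA: "one + A \<in> car" by (intro car_intros A)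
  from maximal_left_ideal_exists[OF MA no] obtain L where LM: "left_ideal L" "one + A \<in> L"
    "\<And>L'. left_ideal L' \<Longrightarrow> L \<subseteq> L' \<Longrightarrow> L' = L" by blast
  interpret maximal_left_ideal mul one car \<iota> U L
    using LM by unfold_locales auto
  have "\<forall>t. \<exists>c. cmod c = 1 \<and> U t - \<iota> c \<in> L" using U_scalar by blast
  from choice[OF this] obtain c where c: "\<And>t. cmod (c t) = 1" "\<And>t. U t - \<iota> (c t) \<in> L" by blast
  \<comment> \<open>A nonzero complex scalar is invertible in \<open>car\<close>, so it cannot move
    x into L.\<close>
  have zero: "z = 0" if "\<iota> z \<odot> x \<in> L" "x \<notin> L" for z x
  proof (rule ccontr)
    assume "z \<noteq> 0"
    have "\<iota> (1 / z) \<odot> (\<iota> z \<odot> x) \<in> L" by (intro L_mul \<iota>_car that)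
    moreover have "\<iota> (1 / z) \<odot> (\<iota> z \<odot> x) = x"
      using \<open>z \<noteq> 0\<close> by (simp add: \<iota>_1 flip: assoc \<iota>_mult)
    ultimately show False using that by simp
  qed
  \<comment> \<open>U(s+t) = U(s) U(t) is congruent modulo L to both scalars, and L contains no
    nonzero scalar.\<close>
  have hom: "c (s + t) = c s * c t" for s t
  proof -
    have "\<iota> (c s * c t - c (s + t)) = (U (s + t) - \<iota> (c (s + t)))
        - (U s \<odot> (U t - \<iota> (c t)) + \<iota> (c t) \<odot> (U s - \<iota> (c s)))"
      by (simp add: \<iota>_diff U_add mul.diff_right U_central[OF \<iota>_car] mult.commute[of "c s"] flip: \<iota>_mult)
    also have "\<dots> \<in> L" by (intro L_diff L_add L_mul c U_car \<iota>_car)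
    finally have "\<iota> (c s * c t - c (s + t)) \<odot> one \<in> L" by simp
    from zero[OF this one_L] show ?thesis by simp
  qed
  have CL: "C \<tau> \<in> L" if \<tau>: "0 < \<tau>" for \<tau>
  proof (rule ccontr)
    assume CnL: "C \<tau> \<notin> L"
    then have qC: "0 < q (C \<tau>)" using q_zero_imp q_nonneg by (metis less_eq_real_def)
    \<comment> \<open>Modulo L the scalar c(t) - 1 acts on \<open>C \<tau>\<close> as
      \<open>U t - one\<close>, whose product with \<open>C \<tau>\<close> is small; division by
      q(\<open>C \<tau>\<close>) > 0 transfers the smallness to c.\<close>
    have "(c \<longlongrightarrow> 1) (at 0)"
    proof (rule LIM_zero_cancel, rule Lim_null_comparison)
      have "((\<lambda>t. norm ((U t - one) \<odot> C \<tau>) / q (C \<tau>)) \<longlongrightarrow> 0 / q (C \<tau>)) (at 0)"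
        using qC by (intro tendsto_divide C(3) \<tau> tendsto_const) auto
      then show "((\<lambda>t. norm ((U t - one) \<odot> C \<tau>) / q (C \<tau>)) \<longlongrightarrow> 0) (at 0)" by simp
      show "\<forall>\<^sub>F t in at 0. norm (c t - 1) \<le> norm ((U t - one) \<odot> C \<tau>) / q (C \<tau>)"
      proof (intro always_eventually allI)
        fix t
        let ?z = "c t - 1"
        have "(U t - \<iota> (c t)) \<odot> C \<tau> = C \<tau> \<odot> (U t - \<iota> (c t))"
          by (simp add: mul.diff_left mul.diff_right U_central \<iota>_central C(1) \<tau>)
        also have "\<dots> \<in> L" by (intro L_mul C(1) \<tau> c)
        finally have l: "(U t - \<iota> (c t)) \<odot> C \<tau> \<in> L" .
        have "\<iota> ?z \<odot> C \<tau> = (U t - one) \<odot> C \<tau> - (U t - \<iota> (c t)) \<odot> C \<tau>"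
          by (simp add: \<iota>_diff \<iota>_1 mul.diff_left)
        then have 1: "q (\<iota> ?z \<odot> C \<tau>) \<le> norm ((U t - one) \<odot> C \<tau>)"
          using q_diff[of "(U t - one) \<odot> C \<tau>" "(U t - \<iota> (c t)) \<odot> C \<tau>"] L_q_zero[OF l]
            q_le_norm[of "(U t - one) \<odot> C \<tau>"] by simp
        have "cmod ?z * q (C \<tau>) \<le> q (\<iota> ?z \<odot> C \<tau>)"
        proof (cases "?z = 0")
          case False
          have "C \<tau> = \<iota> (1 / ?z) \<odot> (\<iota> ?z \<odot> C \<tau>)"
            using False by (simp add: \<iota>_1 flip: assoc \<iota>_mult)
          then have "q (C \<tau>) \<le> cmod (1 / ?z) * q (\<iota> ?z \<odot> C \<tau>)" using q_\<iota>_mul by metis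
          then show ?thesis using False by (simp add: norm_divide field_simps)
        qed (simp add: q_nonneg)
        with 1 show "norm (c t - 1) \<le> norm ((U t - one) \<odot> C \<tau>) / q (C \<tau>)"
          using qC by (simp add: pos_le_divide_eq)
      qed
    qed
    from continuous_character[OF hom c(1) this]
    obtain l where l: "\<And>t. c t = exp (- \<i> * of_real l * of_real t)" by blast
    have "C \<tau> \<odot> A - C \<tau> \<odot> H l \<in> L"
    proof (rule q_zero_imp, rule antisym[OF _ q_nonneg], rule field_le_epsilon)
      fix e :: real assume e: "0 < e"
      obtain n :: nat and \<sigma> B where B: "\<And>j. j < n \<Longrightarrow> B j \<in> car"
        "norm (C \<tau> \<odot> A - (\<Sum>j<n. U (\<sigma> j) \<odot> B j)) \<le> e/2"
        "norm (C \<tau> \<odot> H l - (\<Sum>j<n. \<iota> (c (\<sigma> j)) \<odot> B j)) \<le> e/2"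
        using approx[OF \<tau>, of "e/2" l] e unfolding l by auto
      \<comment> \<open>Moving the central factors to the right exhibits each difference as a left
        multiple of an element of L.\<close>
      have "(\<Sum>j<n. U (\<sigma> j) \<odot> B j) - (\<Sum>j<n. \<iota> (c (\<sigma> j)) \<odot> B j) = (\<Sum>j<n. B j \<odot> (U (\<sigma> j) - \<iota> (c (\<sigma> j))))"
        using B(1) by (simp add: sum_subtractf[symmetric] mul.diff_right U_central \<iota>_central)
      also have "\<dots> \<in> L" using B(1) c(2) by (intro L_sum L_mul) auto
      finally have D: "(\<Sum>j<n. U (\<sigma> j) \<odot> B j) - (\<Sum>j<n. \<iota> (c (\<sigma> j)) \<odot> B j) \<in> L" .
      let ?X = "C \<tau> \<odot> A - (\<Sum>j<n. U (\<sigma> j) \<odot> B j)" and ?Y = "C \<tau> \<odot> H l - (\<Sum>j<n. \<iota> (c (\<sigma> j)) \<odot> B j)"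
      have "q (C \<tau> \<odot> A - C \<tau> \<odot> H l) \<le> norm (C \<tau> \<odot> A - C \<tau> \<odot> H l
          - ((\<Sum>j<n. U (\<sigma> j) \<odot> B j) - (\<Sum>j<n. \<iota> (c (\<sigma> j)) \<odot> B j)))"
        by (rule q_le[OF D])
      also have "C \<tau> \<odot> A - C \<tau> \<odot> H l - ((\<Sum>j<n. U (\<sigma> j) \<odot> B j) - (\<Sum>j<n. \<iota> (c (\<sigma> j)) \<odot> B j)) = ?X - ?Y"
        by simp
      also have "norm (?X - ?Y) \<le> e/2 + e/2" using B(2,3) by (intro order_trans[OF norm_triangle_ineq4 add_mono])
      finally show "q (C \<tau> \<odot> A - C \<tau> \<odot> H l) \<le> 0 + e" by simp
    qed
    \<comment> \<open>C (one + A) and C A - C H(l) lie in L, hence so does C (one + H(l)). Commuting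
      the factors puts C on the right, where the left inverse of one + H(l) exposes it.\<close>
    from L_diff[OF L_mul[OF C(1)[OF \<tau>] LM(2)] this]
    have "(one + H l) \<odot> C \<tau> \<in> L"
      by (simp add: mul.add_right mul.add_left H(2) \<tau>)
    moreover obtain h where h: "h \<in> car" "h \<odot> (one + H l) = one" using H(3) by blast
    ultimately have "h \<odot> ((one + H l) \<odot> C \<tau>) \<in> L" using L_mul by blast
    then show False using CnL h(2) by (simp flip: assoc)
  qed
  have "P \<in> L"
  proof (rule q_zero_imp, rule antisym[OF _ q_nonneg], rule field_le_epsilon)
    fix e :: real assume "0 < e"
    from P(3)[OF this] obtain \<tau> where \<tau>: "\<tau> > 0" "norm (P - (1 / \<tau>) *\<^sub>R (C \<tau> \<odot> P)) \<le> e" by blast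
    \<comment> \<open>P is moved to the left of \<open>C \<tau>\<close>, because L absorbs only left
      factors.\<close>
    have "(1 / \<tau>) *\<^sub>R (C \<tau> \<odot> P) \<in> L"
      unfolding P(2)[OF \<tau>(1)] by (intro L_scale L_mul P(1) CL \<tau>)
    from q_le[OF this, of P] show "q P \<le> 0 + e" using \<tau>(2) by linarith
  qed
  moreover have "one - P \<in> L" using L_mul[OF G(1) LM(2)] by (simp add: G(2))
  ultimately have "(one - P) + P \<in> L" by (intro L_add)
  then show False using one_L by simp
qed

subsection \<open>Riemann sums\<close>

lemma bochner_integral_sum:
  fixes f :: "'i \<Rightarrow> real \<Rightarrow> 'b::banach"
  assumes "finite I" "\<And>i. i \<in> I \<Longrightarrow> L1_fun (f i)"
  shows "L1_fun (\<lambda>x. \<Sum>i\<in>I. f i x)"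
    and "bochner_integral (\<lambda>x. \<Sum>i\<in>I. f i x) = (\<Sum>i\<in>I. bochner_integral (f i))"
proof -
  have "L1_fun (\<lambda>x. \<Sum>i\<in>I. f i x) \<and> bochner_integral (\<lambda>x. \<Sum>i\<in>I. f i x) = (\<Sum>i\<in>I. bochner_integral (f i))"
    using assms
  proof (induction I rule: finite_induct)
    case empty
    have "bochner_integral (\<lambda>x. 0::'b) = sint (\<lambda>x. 0)"
      by (rule bochner_integral_sbi) (simp add: simple_bochner_integrable.simps)
    then show ?case by (simp add: L1_fun_zero simple_bochner_integral_def)
  next
    case (insert i I)
    then show ?case by (simp add: L1_fun_add bochner_integral_add)
  qed
  then show "L1_fun (\<lambda>x. \<Sum>i\<in>I. f i x)"
    "bochner_integral (\<lambda>x. \<Sum>i\<in>I. f i x) = (\<Sum>i\<in>I. bochner_integral (f i))" by auto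
qed

lemma bochner_integral_diff:
  fixes f g :: "real \<Rightarrow> 'b::banach"
  assumes "L1_fun f" "L1_fun g"
  shows "bochner_integral (\<lambda>x. f x - g x) = bochner_integral f - bochner_integral g"
  using bochner_integral_add[OF L1_fun_diff[OF assms] assms(2)] by simp

lemma norm_L1_tail: "norm (L1_tail R (abs_L1 f)) = (\<integral>y. indicator {y. R \<le> \<bar>y\<bar>} y * norm (f y) \<partial>lborel)"
  if f: "L1_fun f"
proof -
  have "L1_fun (\<lambda>x. indicator {x. R \<le> \<bar>x\<bar>} x *\<^sub>R f x)"
    by (rule L1_fun_indicator[OF f]) simp
  then show ?thesis
    by (simp add: L1_tail.abs_eq[OF L1_rel_refl[OF f]] norm_abs_L1)
qed

text \<open>The window [-R,R) is cut into n intervals of length h and the weight is frozen at left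
  endpoints: the Lipschitz bound costs K h on the window, the bound M costs the tail. The
  coefficients are the integrals of f over the intervals and do not involve \<Lambda>, so different
  weights share them.\<close>

lemma bochner_integral_riemann:
  fixes f :: "real \<Rightarrow> 'a::banach" and \<Lambda> :: "real \<Rightarrow> 'a \<Rightarrow> 'b::banach" and n :: nat
  assumes f: "L1_fun f" and \<Lambda>: "\<And>y. bounded_linear (\<Lambda> y)" "L1_fun (\<lambda>y. \<Lambda> y (f y))"
    and Lip: "\<And>y z v. norm (\<Lambda> y v - \<Lambda> z v) \<le> K * \<bar>y - z\<bar> * norm v"
    and M: "\<And>y v. norm (\<Lambda> y v) \<le> M * norm v"
    and K: "0 \<le> K" and M0: "0 \<le> M" and h: "0 < h" and R: "real n * h = 2 * R"
  defines "\<sigma> \<equiv> \<lambda>j. real j * h - R"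
  defines "I \<equiv> \<lambda>j. {\<sigma> j..<\<sigma> j + h}"
  shows "norm (bochner_integral (\<lambda>y. \<Lambda> y (f y))
      - (\<Sum>j<n. \<Lambda> (\<sigma> j) (bochner_integral (\<lambda>y. indicator (I j) y *\<^sub>R f y))))
    \<le> K * h * norm (abs_L1 f) + M * norm (L1_tail R (abs_L1 f))"
proof -
  have LI: "L1_fun (\<lambda>y. indicator (I j) y *\<^sub>R f y)" for j
    by (rule L1_fun_indicator[OF f]) (simp add: I_def)
  define s where "s j y = \<Lambda> (\<sigma> j) (indicator (I j) y *\<^sub>R f y)" for j y
  have Ls: "L1_fun (s j)" for j
    unfolding s_def[abs_def] by (rule L1_fun_bounded_linear[OF LI \<Lambda>(1)])
  have s: "bochner_integral (s j) = \<Lambda> (\<sigma> j) (bochner_integral (\<lambda>y. indicator (I j) y *\<^sub>R f y))" for j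
    unfolding s_def[abs_def] by (rule bochner_integral_bounded_linear[OF LI \<Lambda>(1)])
  note Ss = bochner_integral_sum[where I = "{..<n}" and f = s, OF finite_lessThan Ls]
  define D where "D y = \<Lambda> y (f y) - (\<Sum>j<n. s j y)" for y
  have LD: "L1_fun D" unfolding D_def[abs_def] by (rule L1_fun_diff[OF \<Lambda>(2) Ss(1)])
  have eq: "bochner_integral (\<lambda>y. \<Lambda> y (f y))
      - (\<Sum>j<n. \<Lambda> (\<sigma> j) (bochner_integral (\<lambda>y. indicator (I j) y *\<^sub>R f y))) = bochner_integral D"
    unfolding D_def[abs_def] bochner_integral_diff[OF \<Lambda>(2) Ss(1)] Ss(2) s ..
  have Dle: "norm (D y) \<le> K * h * norm (f y) + M * (indicator {y. R \<le> \<bar>y\<bar>} y * norm (f y))" for y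
  proof -
    \<comment> \<open>The index of the only interval that can contain y; if k is not among 0, ..., n
      - 1, the point lies in the tail.\<close>
    define k where "k = \<lfloor>(y + R) / h\<rfloor>"
    have mem: "y \<in> I j \<longleftrightarrow> int j = k" for j
    proof -
      have "int j = k \<longleftrightarrow> real j \<le> (y + R) / h \<and> (y + R) / h < real j + 1"
        unfolding k_def by (metis floor_eq_iff of_int_of_nat_eq)
      also have "\<dots> \<longleftrightarrow> real j * h \<le> y + R \<and> y + R < (real j + 1) * h"
        using h by (simp add: pos_le_divide_eq pos_divide_less_eq)
      also have "\<dots> \<longleftrightarrow> y \<in> I j" by (auto simp: I_def \<sigma>_def algebra_simps)
      finally show ?thesis by simp
    qed
    have l0: "\<Lambda> z 0 = 0" for z using linear_0[OF bounded_linear.linear[OF \<Lambda>(1)]] .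
    show ?thesis
    proof (cases "0 \<le> k \<and> k < int n")
      case True
      then have k: "int (nat k) = k" "nat k < n" by auto
      have "(\<Sum>j<n. s j y) = (\<Sum>j<n. if j = nat k then \<Lambda> (\<sigma> j) (f y) else 0)"
        using True by (intro sum.cong refl) (auto simp: s_def mem l0)
      also have "\<dots> = \<Lambda> (\<sigma> (nat k)) (f y)" using k(2) by (simp add: sum.delta)
      finally have "norm (D y) \<le> K * \<bar>y - \<sigma> (nat k)\<bar> * norm (f y)" unfolding D_def using Lip by simp
      also have "y \<in> I (nat k)" using mem k(1) by simp
      then have "\<bar>y - \<sigma> (nat k)\<bar> \<le> h" by (auto simp: I_def)
      then have "K * \<bar>y - \<sigma> (nat k)\<bar> * norm (f y) \<le> K * h * norm (f y)"
        using K by (intro mult_right_mono mult_left_mono) auto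
      finally show ?thesis using M0 by (simp add: add_increasing2)
    next
      case False
      have "s j y = 0" if "j < n" for j using False that by (auto simp: s_def mem l0 indicator_def)
      then have "norm (D y) \<le> M * norm (f y)" unfolding D_def using M by simp
      moreover have "R \<le> \<bar>y\<bar>"
      proof (rule ccontr)
        assume "\<not> R \<le> \<bar>y\<bar>"
        then have y: "0 \<le> y + R" "y + R < 2 * R" by auto
        have "0 \<le> k" unfolding k_def using y h by simp
        moreover have "(y + R) / h < real n" using y h R by (simp add: pos_divide_less_eq)
        then have "k < int n" unfolding k_def by (simp add: floor_less_iff)
        ultimately show False using False by simp
      qed
      ultimately show ?thesis using K h by (simp add: indicator_def add_increasing)
    qed
  qed
  have int1: "integrable lborel (\<lambda>y. norm (f y))" by (rule L1_fun_integrable_norm[OF f])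
  have int2: "integrable lborel (\<lambda>y. indicator {y. R \<le> \<bar>y\<bar>} y * norm (f y))"
    using L1_fun_integrable_norm[OF L1_fun_indicator[OF f, of "{y. R \<le> \<bar>y\<bar>}"]] by simp
  have "norm (bochner_integral D) \<le> (\<integral>y. norm (D y) \<partial>lborel)" by (rule norm_bochner_integral_le[OF LD])
  also have "\<dots> \<le> (\<integral>y. K * h * norm (f y) + M * (indicator {y. R \<le> \<bar>y\<bar>} y * norm (f y)) \<partial>lborel)"
    by (intro integral_mono Bochner_Integration.integrable_add integrable_mult_right int1 int2
        L1_fun_integrable_norm[OF LD] Dle)
  also have "\<dots> = K * h * norm (abs_L1 f) + M * norm (L1_tail R (abs_L1 f))"
    unfolding norm_abs_L1[OF f] norm_L1_tail[OF f]
    by (subst Bochner_Integration.integral_add) (auto intro!: integrable_mult_right int1 int2)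
  finally show ?thesis unfolding eq .
qed

section \<open>Averages over short intervals\<close>

lemma bochner_integral_indicator:
  fixes v :: "'a::banach"
  assumes E: "E \<in> fmeasurable lborel"
  shows "bochner_integral (\<lambda>y. indicator E y *\<^sub>R v) = measure lborel E *\<^sub>R v"
proof -
  have E': "E \<in> sets borel" using fmeasurableD[OF E] by simp
  have s: "sbi (indicator E :: real \<Rightarrow> real)" using sbi_indicator[OF E, of "1::real"] by simp
  have "bochner_integral (indicator E :: real \<Rightarrow> real) = measure lborel E"
    unfolding bochner_integral_sbi[OF s] simple_bochner_integrable_eq_integral[OF s] using E' by simp
  then show ?thesis
    using bochner_integral_bounded_linear[OF L1_fun_sbi[OF s] bounded_linear_scaleR_left[of v]] by simp
qed

lemma box_fmeasurable: "{a..<b} \<in> fmeasurable lborel" for a b :: real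
  by (cases "a \<le> b") (auto simp: fmeasurable_def)

text \<open>The normalized convolution is the mean of the translates by y in [0,\<tau>), so it
  deviates from h no more than they do. The bound is asked for y > 0 only, which fits a punctured
  limit at 0.\<close>

lemma indicator_conv_box_approx:
  fixes h :: "'a::cbanach L1"
  assumes \<tau>: "0 < \<tau>" and c: "\<And>y. 0 < y \<Longrightarrow> y < \<tau> \<Longrightarrow> norm (h - L1_translate y h) \<le> c" and c0: "0 \<le> c"
  shows "norm (h - (1 / \<tau>) *\<^sub>R indicator_conv {0..<\<tau>} h) \<le> c"
proof -
  note E = box_fmeasurable[of 0 \<tau>]
  have i1: "bochner_integral (\<lambda>y. indicator {0..<\<tau>} y *\<^sub>R h) = \<tau> *\<^sub>R h"
    using \<tau> by (simp add: bochner_integral_indicator[OF E])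
  have L: "L1_fun (\<lambda>y. indicator {0..<\<tau>} y *\<^sub>R h - indicator {0..<\<tau>} y *\<^sub>R L1_translate y h)"
    by (rule L1_fun_diff[OF L1_fun_indicator_const[OF E] L1_fun_indicator_translate[OF E]])
  have "\<tau> *\<^sub>R h - indicator_conv {0..<\<tau>} h
      = bochner_integral (\<lambda>y. indicator {0..<\<tau>} y *\<^sub>R h - indicator {0..<\<tau>} y *\<^sub>R L1_translate y h)"
    unfolding bochner_integral_diff[OF L1_fun_indicator_const[OF E] L1_fun_indicator_translate[OF E]]
      i1 indicator_conv_integral[OF E] ..
  then have "norm (\<tau> *\<^sub>R h - indicator_conv {0..<\<tau>} h)
      \<le> (\<integral>y. norm (indicator {0..<\<tau>} y *\<^sub>R h - indicator {0..<\<tau>} y *\<^sub>R L1_translate y h) \<partial>lborel)"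
    using norm_bochner_integral_le[OF L] by simp
  also have "\<dots> \<le> (\<integral>y. c * indicator {0..<\<tau>} y \<partial>lborel)"
  proof (rule integral_mono[OF L1_fun_integrable_norm[OF L]])
    show "integrable lborel (\<lambda>y. c * indicator {0..<\<tau>} y)"
      using E by (intro integrable_mult_right) (auto simp: fmeasurable_def)
    show "norm (indicator {0..<\<tau>} y *\<^sub>R h - indicator {0..<\<tau>} y *\<^sub>R L1_translate y h) \<le> c * indicator {0..<\<tau>} y" for y
      using c[of y] c0 by (cases "y = 0") (auto simp: indicator_def)
  qed
  also have "\<dots> = c * \<tau>" using \<tau> by simp
  finally have 1: "norm (\<tau> *\<^sub>R h - indicator_conv {0..<\<tau>} h) \<le> c * \<tau>" .
  have "h - (1 / \<tau>) *\<^sub>R indicator_conv {0..<\<tau>} h = (1 / \<tau>) *\<^sub>R (\<tau> *\<^sub>R h - indicator_conv {0..<\<tau>} h)"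
    using \<tau> by (simp add: scaleR_diff_right)
  then have "norm (h - (1 / \<tau>) *\<^sub>R indicator_conv {0..<\<tau>} h) = (1 / \<tau>) * norm (\<tau> *\<^sub>R h - indicator_conv {0..<\<tau>} h)"
    using \<tau> by simp
  also have "\<dots> \<le> (1 / \<tau>) * (c * \<tau>)" using \<tau> 1 by (intro mult_left_mono) auto
  finally show ?thesis using \<tau> by simp
qed

text \<open>The two boxes differ only within |t| of the endpoints 0 and \<tau>, that is, on two
  intervals of length 2|t|.\<close>

lemma norm_translate_box_diff:
  assumes "0 < \<tau>"
  shows "norm (L1_translate t (L1_indicator {0..<\<tau>} v) - L1_indicator {0..<\<tau>} v) \<le> 4 * \<bar>t\<bar> * norm v"
proof -
  note E = box_fmeasurable[of 0 \<tau>]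
  note Et = fmeasurable_translate(1)[OF E, of t]
  note i = L1_fun_indicator_const[OF Et] L1_fun_indicator_const[OF E]
  let ?g = "\<lambda>x. norm v * indicator {-\<bar>t\<bar>..\<bar>t\<bar>} x + norm v * indicator {\<tau> - \<bar>t\<bar>..\<tau> + \<bar>t\<bar>} x"
  have "norm (L1_translate t (L1_indicator {0..<\<tau>} v) - L1_indicator {0..<\<tau>} v)
      = (\<integral>x. norm (indicator {x. x - t \<in> {0..<\<tau>}} x *\<^sub>R v - indicator {0..<\<tau>} x *\<^sub>R v) \<partial>lborel)"
    unfolding L1_translate_indicator[OF E] unfolding L1_indicator_def
      minus_abs_L1[OF i] norm_abs_L1[OF L1_fun_diff[OF i]] ..
  also have "\<dots> \<le> (\<integral>x. ?g x \<partial>lborel)"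
  proof (rule integral_mono[OF L1_fun_integrable_norm[OF L1_fun_diff[OF i]]])
    show "integrable lborel ?g"
      by (intro Bochner_Integration.integrable_add integrable_mult_right) auto
    show "norm (indicator {x. x - t \<in> {0..<\<tau>}} x *\<^sub>R v - indicator {0..<\<tau>} x *\<^sub>R v) \<le> ?g x" for x
      by (auto simp: indicator_def)
  qed
  also have "\<dots> = 4 * \<bar>t\<bar> * norm v"
    by (subst Bochner_Integration.integral_add) auto
  finally show ?thesis .
qed

text \<open>The difference is the convolution operator of v \<mapsto> U_t \<chi> v - \<chi> v, which
  has norm at most 4|t|. Thus t \<mapsto> U_t C is Lipschitz in operator norm, although the
  translations themselves are only strongly continuous.\<close>

lemma norm_translate_conv_box_diff:
  fixes h :: "'a::cbanach L1"
  assumes \<tau>: "0 < \<tau>"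
  shows "norm (L1_translate t (indicator_conv {0..<\<tau>} h) - indicator_conv {0..<\<tau>} h) \<le> 4 * \<bar>t\<bar> * norm h"
proof -
  note E = box_fmeasurable[of 0 \<tau>]
  have bl: "bounded_linear (\<lambda>F. L1_translate t F - F)"
    by (intro bounded_linear_sub bounded_linear_translate bounded_linear_ident)
  have "L1_translate t (conv_op (L1_indicator {0..<\<tau>}) h) - conv_op (L1_indicator {0..<\<tau>}) h
      = conv_op (\<lambda>v. L1_translate t (L1_indicator {0..<\<tau>} v) - L1_indicator {0..<\<tau>} v) h"
    by (rule conv_op_commute[OF bounded_linear_L1_indicator[OF E] bl])
      (simp add: L1_translate_diff add.commute)
  also have "norm \<dots> \<le> 4 * \<bar>t\<bar> * norm h"
    by (rule norm_conv_op_le[OF bounded_linear_compose[OF bl bounded_linear_L1_indicator[OF E]]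
          norm_translate_box_diff[OF \<tau>]])
  finally show ?thesis unfolding indicator_conv_conv_op[OF E] .
qed

subsection \<open>Localization of a convolution operator\<close>

lemma wiener_fourier_eq:
  "wiener_fourier T l v = bochner_integral (\<lambda>x. exp (- \<i> * of_real l * of_real x) *\<^sub>C rep_L1 (T v) x)"
  unfolding wiener_fourier_def
  using L1_fourier.abs_eq[OF L1_rel_refl[OF L1_fun_rep[of "T v"]], of l] by (simp add: abs_rep_L1)

lemma cmod_exp_i: "cmod (exp (- \<i> * of_real l * of_real x)) = 1"
  by (simp add: norm_exp_eq_Re)

lemma exp_i_borel: "(\<lambda>x. exp (- \<i> * of_real l * of_real x)) \<in> borel_measurable borel"
  by measurable

text \<open>Uses |exp(i x) - 1| = 2 |sin(x/2)| \<le> |x|.\<close>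

lemma exp_i_lipschitz:
  "cmod (exp (- \<i> * of_real l * of_real y) - exp (- \<i> * of_real l * of_real z)) \<le> \<bar>l\<bar> * \<bar>y - z\<bar>"
proof -
  have "exp (- \<i> * of_real l * of_real y) - exp (- \<i> * of_real l * of_real z)
      = exp (- \<i> * of_real l * of_real z) * (exp (\<i> * of_real (l * (z - y))) - 1)"
    by (simp add: algebra_simps flip: exp_add)
  then have "cmod (exp (- \<i> * of_real l * of_real y) - exp (- \<i> * of_real l * of_real z))
      = 2 * \<bar>sin (l * (z - y) / 2)\<bar>"
    using dist_exp_i_1[of "l * (z - y)"] by (simp only: norm_mult cmod_exp_i)
  also have "\<dots> \<le> 2 * \<bar>l * (z - y) / 2\<bar>"
    by (intro mult_left_mono abs_sin_x_le_abs_x) simp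
  also have "\<dots> = \<bar>l\<bar> * \<bar>y - z\<bar>" by (simp add: abs_mult abs_minus_commute)
  finally show ?thesis .
qed

lemma bounded_clinear_wiener_fourier:
  fixes T :: "'a::cbanach \<Rightarrow> 'a L1"
  assumes "bounded_clinear T"
  shows "bounded_clinear (wiener_fourier T l)"
proof -
  have eq: "wiener_fourier T l = (\<lambda>v. L1_pair (\<lambda>x. exp (- \<i> * of_real l * of_real x)) (T v))"
    by (rule ext) (simp add: wiener_fourier_eq L1_pair_def)
  have "bounded_linear (L1_pair (\<lambda>x. exp (- \<i> * of_real l * of_real x)) :: 'a L1 \<Rightarrow> 'a)"
    by (rule bounded_linear_L1_pair[OF exp_i_borel, where C = 1]) (simp add: cmod_exp_i)
  moreover have "L1_pair (\<lambda>x. exp (- \<i> * of_real l * of_real x)) (c *\<^sub>C h)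
      = c *\<^sub>C L1_pair (\<lambda>x. exp (- \<i> * of_real l * of_real x)) h" for c and h :: "'a L1"
    by (rule L1_pair_scaleC[OF exp_i_borel, where C = 1]) (simp add: cmod_exp_i)
  ultimately show ?thesis
    using assms unfolding bounded_clinear_def eq by (auto intro: bounded_linear_compose)
qed

lemma bounded_linear_L1_tail: "bounded_linear (L1_tail R)"
proof (rule bounded_linear_intro)
  fix F G :: "'a L1" and r
  show "L1_tail R (F + G) = L1_tail R F + L1_tail R G"
  proof transfer
    fix R :: real and f g :: "real \<Rightarrow> 'a"
    assume "L1_rel f f" "L1_rel g g"
    then show "L1_rel (\<lambda>x. indicator {x. R \<le> \<bar>x\<bar>} x *\<^sub>R (f x + g x))
        (\<lambda>x. indicator {x. R \<le> \<bar>x\<bar>} x *\<^sub>R f x + indicator {x. R \<le> \<bar>x\<bar>} x *\<^sub>R g x)"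
      by (auto simp: L1_rel_def scaleR_add_right intro!: L1_fun_add L1_fun_indicator)
  qed
  show "L1_tail R (r *\<^sub>R F) = r *\<^sub>R L1_tail R F"
  proof transfer
    fix R r :: real and f :: "real \<Rightarrow> 'a"
    assume "L1_rel f f"
    then have "L1_fun (\<lambda>x. r *\<^sub>R indicator {x. R \<le> \<bar>x\<bar>} x *\<^sub>R f x)"
      by (intro L1_fun_bounded_linear[OF _ bounded_linear_scaleR_right] L1_fun_indicator) (auto simp: L1_rel_def)
    then show "L1_rel (\<lambda>x. indicator {x. R \<le> \<bar>x\<bar>} x *\<^sub>R r *\<^sub>R f x)
        (\<lambda>x. r *\<^sub>R indicator {x. R \<le> \<bar>x\<bar>} x *\<^sub>R f x)"
      by (simp add: L1_rel_def mult.commute)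
  qed
  show "norm (L1_tail R F) \<le> norm F * 1"
  proof (induction F rule: L1_induct)
    case (1 f)
    have "norm (L1_tail R (abs_L1 f)) \<le> (\<integral>y. norm (f y) \<partial>lborel)"
      unfolding norm_L1_tail[OF 1]
    proof (rule integral_mono)
      show "integrable lborel (\<lambda>y. indicator {y. R \<le> \<bar>y\<bar>} y * norm (f y))"
        using L1_fun_integrable_norm[OF L1_fun_indicator[OF 1, of "{y. R \<le> \<bar>y\<bar>}"]] by simp
    qed (auto simp: indicator_def L1_fun_integrable_norm[OF 1])
    then show ?case by (simp add: norm_abs_L1 1)
  qed
qed

text \<open>One choice of nodes and coefficients serves two integrals: C \<open>conv_op T\<close>
  integrates U_y C T(y) and That(l) integrates exp(-i l y) T(y), both approximated through the
  interval masses \<open>b j\<close> of T. Smoothing by C makes the first weight Lipschitz in norm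
  with constant 4; the character has constant |l|.\<close>

lemma conv_op_localization:
  fixes T :: "'a::cbanach \<Rightarrow> 'a L1"
  assumes T: "bounded_clinear T" and tail: "((\<lambda>R. onorm (\<lambda>f. L1_tail R (T f))) \<longlongrightarrow> 0) at_top"
    and \<tau>: "0 < \<tau>" and e: "0 < e"
  shows "\<exists>(n::nat) \<sigma> b. (\<forall>j. bounded_clinear (b j))
    \<and> (\<forall>g. norm (indicator_conv {0..<\<tau>} (conv_op T g)
        - (\<Sum>j<n. L1_translate (\<sigma> j) (indicator_conv {0..<\<tau>} (L1_map (b j) g)))) \<le> e * norm g)
    \<and> (\<forall>v. norm (wiener_fourier T l v - (\<Sum>j<n. exp (- \<i> * of_real l * of_real (\<sigma> j)) *\<^sub>C b j v)) \<le> e * norm v)"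
proof -
  have blT: "bounded_linear T" using T by (simp add: bounded_clinear_def)
  note E = box_fmeasurable[of 0 \<tau>]
  let ?C = "indicator_conv {0..<\<tau>} :: 'a L1 \<Rightarrow> 'a L1"
  have blC: "bounded_linear ?C" by (rule bounded_linear_indicator_conv[OF E])
  define \<kappa> where "\<kappa> = onorm T"
  have \<kappa>: "norm (T v) \<le> \<kappa> * norm v" for v unfolding \<kappa>_def by (rule onorm[OF blT])
  have \<kappa>0: "0 \<le> \<kappa>" unfolding \<kappa>_def by (rule onorm_pos_le[OF blT])
  \<comment> \<open>Makes both \<tau> e1 and e1 at most e/2: the box convolution has norm at most
    \<tau>, the character has modulus 1.\<close>
  define e1 where "e1 = e / (2 * (\<tau> + 1))"
  have e1: "0 < e1" using e \<tau> by (simp add: e1_def)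
  have "\<forall>\<^sub>F R in at_top. onorm (\<lambda>f. L1_tail R (T f)) < e1 \<and> R > 0"
    by (intro eventually_conj order_tendstoD(2)[OF tail e1] eventually_gt_at_top)
  then obtain R where R: "onorm (\<lambda>f. L1_tail R (T f)) < e1" "R > 0"
    by (auto simp: eventually_at_top_linorder)
  have tail_le: "norm (L1_tail R (T v)) \<le> e1 * norm v" for v
  proof -
    have "norm (L1_tail R (T v)) \<le> onorm (\<lambda>f. L1_tail R (T f)) * norm v"
      by (rule onorm[OF bounded_linear_compose[OF bounded_linear_L1_tail blT]])
    also have "\<dots> \<le> e1 * norm v" using R(1) by (intro mult_right_mono) auto
    finally show ?thesis .
  qed
  \<comment> \<open>A mesh so fine that (4 + |l|) h \<kappa> \<le> e/2; the sum of the two Lipschitz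
    constants serves both estimates.\<close>
  obtain n :: nat where n: "2 * R * (4 + \<bar>l\<bar>) * \<kappa> / (e / 2) < real n" using reals_Archimedean2 by blast
  have "0 \<le> 2 * R * (4 + \<bar>l\<bar>) * \<kappa> / (e / 2)" using R(2) \<kappa>0 e by simp
  then have n0: "0 < n" using n by (cases n) auto
  define h where "h = 2 * R / real n"
  have h: "0 < h" "real n * h = 2 * R" using R(2) n0 by (auto simp: h_def)
  have hk: "(4 + \<bar>l\<bar>) * h * \<kappa> \<le> e / 2"
    using n n0 e by (simp add: h_def field_simps)
  define \<sigma> where "\<sigma> j = real j * h - R" for j :: nat
  define I where "I j = {\<sigma> j..<\<sigma> j + h}" for j
  define b where "b j v = L1_pair (indicator (I j)) (T v)" for j v
  have Ib: "(indicator (I j) :: real \<Rightarrow> complex) \<in> borel_measurable borel" for j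
    by (simp add: I_def)
  have I1: "cmod (indicator (I j) x) \<le> 1" for j x by (simp add: indicator_def)
  have b_eq: "b j v = bochner_integral (\<lambda>y. indicator (I j) y *\<^sub>R rep_L1 (T v) y)" for j v
    by (simp add: b_def L1_pair_def scaleC_indicator)
  have b: "bounded_clinear (b j)" for j
    unfolding bounded_clinear_def b_def[abs_def]
    using T bounded_linear_compose[OF bounded_linear_L1_pair[OF Ib I1] blT] L1_pair_scaleC[OF Ib I1]
    by (auto simp: bounded_clinear_def)
  then have blb: "bounded_linear (b j)" for j by (simp add: bounded_clinear_def)
  have 1: "norm (?C (conv_op T g) - (\<Sum>j<n. L1_translate (\<sigma> j) (?C (L1_map (b j) g)))) \<le> e * norm g" for g
  proof (rule bounded_linear_L1_bound)
    show "bounded_linear (\<lambda>g. ?C (conv_op T g) - (\<Sum>j<n. L1_translate (\<sigma> j) (?C (L1_map (b j) g))))"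
      by (intro bounded_linear_sub bounded_linear_sum bounded_linear_compose[OF blC]
          bounded_linear_compose[OF bounded_linear_translate] bounded_linear_conv_op[OF blT]
          bounded_linear_L1_map[OF blb])
    fix F :: "real set" and v :: 'a assume F: "F \<in> fmeasurable lborel"
    define \<Lambda> where "\<Lambda> y w = L1_translate y (?C (L1_indicator F w))" for y and w :: 'a
    let ?m = "measure lborel F"
    note blF = bounded_linear_compose[OF blC bounded_linear_L1_indicator[OF F]]
    let ?f = "rep_L1 (T v)"
    \<comment> \<open>Convolution of T with \<chi> v is rewritten as convolution of \<chi> with T v,
      so that the integration variable is that of T v and the Riemann sum applies.\<close>
    have "?C (conv_op T (L1_indicator F v)) = ?C (conv_op (L1_indicator F) (T v))"
      by (simp add: conv_op_indicator[OF blT F] indicator_conv_conv_op[OF F])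
    also have "\<dots> = conv_op (\<lambda>w. ?C (L1_indicator F w)) (T v)"
      by (rule conv_op_commute[OF bounded_linear_L1_indicator[OF F] blC indicator_conv_translate[OF E]])
    also have "\<dots> = bochner_integral (\<lambda>y. \<Lambda> y (?f y))" by (simp add: conv_op_def \<Lambda>_def)
    finally have eq1: "?C (conv_op T (L1_indicator F v)) = bochner_integral (\<lambda>y. \<Lambda> y (?f y))" .
    have eq2: "L1_translate (\<sigma> j) (?C (L1_map (b j) (L1_indicator F v))) = \<Lambda> (\<sigma> j) (b j v)" for j
      by (simp add: \<Lambda>_def L1_map_indicator[OF blb F])
    have "norm (bochner_integral (\<lambda>y. \<Lambda> y (?f y))
      - (\<Sum>j<n. \<Lambda> (\<sigma> j) (bochner_integral (\<lambda>y. indicator (I j) y *\<^sub>R ?f y))))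
      \<le> (4 * ?m) * h * norm (abs_L1 ?f) + (\<tau> * ?m) * norm (L1_tail R (abs_L1 ?f))"
      unfolding I_def \<sigma>_def
    proof (rule bochner_integral_riemann[OF L1_fun_rep _ _ _ _ _ _ h])
      show "bounded_linear (\<Lambda> y)" for y
        unfolding \<Lambda>_def by (rule bounded_linear_compose[OF bounded_linear_translate blF])
      show "L1_fun (\<lambda>y. \<Lambda> y (?f y))"
        unfolding \<Lambda>_def by (rule L1_fun_translate_op[OF blF L1_fun_rep])
      fix y z :: real and w :: 'a
      have "norm (\<Lambda> y w - \<Lambda> z w)
          = norm (L1_translate z (L1_translate (y - z) (?C (L1_indicator F w)) - ?C (L1_indicator F w)))"
        by (simp add: \<Lambda>_def L1_translate_diff)
      also have "\<dots> \<le> 4 * \<bar>y - z\<bar> * norm (L1_indicator F w)"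
        unfolding norm_L1_translate by (rule norm_translate_conv_box_diff[OF \<tau>])
      finally show "norm (\<Lambda> y w - \<Lambda> z w) \<le> 4 * ?m * \<bar>y - z\<bar> * norm w"
        by (simp add: norm_L1_indicator[OF F] mult_ac)
      have "norm (?C (L1_indicator F w)) \<le> \<tau> * norm (L1_indicator F w)"
        using norm_indicator_conv_le[OF E, of "L1_indicator F w"] \<tau> by simp
      then show "norm (\<Lambda> y w) \<le> \<tau> * ?m * norm w"
        by (simp add: \<Lambda>_def norm_L1_indicator[OF F] mult_ac)
    qed (use \<tau> in auto)
    also have "\<dots> \<le> (4 * ?m) * h * (\<kappa> * norm v) + (\<tau> * ?m) * (e1 * norm v)"
      unfolding abs_rep_L1 using h \<tau> by (intro add_mono mult_left_mono \<kappa> tail_le) auto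
    also have "\<dots> = (4 * h * \<kappa> + \<tau> * e1) * (?m * norm v)" by (simp add: algebra_simps)
    also have "\<dots> \<le> (e/2 + e/2) * (?m * norm v)"
    proof (intro mult_right_mono add_mono)
      have "4 * h * \<kappa> \<le> (4 + \<bar>l\<bar>) * h * \<kappa>" using h \<kappa>0 by (intro mult_right_mono) auto
      then show "4 * h * \<kappa> \<le> e/2" using hk by linarith
      show "\<tau> * e1 \<le> e/2" using \<tau> e by (simp add: e1_def field_simps)
    qed auto
    finally show "norm (?C (conv_op T (L1_indicator F v))
        - (\<Sum>j<n. L1_translate (\<sigma> j) (?C (L1_map (b j) (L1_indicator F v))))) \<le> e * ?m * norm v"
      unfolding eq1 eq2 b_eq by (simp add: mult.assoc)
  qed
  have 2: "norm (wiener_fourier T l v - (\<Sum>j<n. exp (- \<i> * of_real l * of_real (\<sigma> j)) *\<^sub>C b j v)) \<le> e * norm v" for v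
  proof -
    let ?f = "rep_L1 (T v)"
    have "norm (bochner_integral (\<lambda>y. exp (- \<i> * of_real l * of_real y) *\<^sub>C ?f y)
      - (\<Sum>j<n. exp (- \<i> * of_real l * of_real (\<sigma> j)) *\<^sub>C (bochner_integral (\<lambda>y. indicator (I j) y *\<^sub>R ?f y))))
      \<le> \<bar>l\<bar> * h * norm (abs_L1 ?f) + 1 * norm (L1_tail R (abs_L1 ?f))"
      unfolding I_def \<sigma>_def
    proof (rule bochner_integral_riemann[OF L1_fun_rep _ _ _ _ _ _ h])
      show "bounded_linear (\<lambda>w::'a. exp (- \<i> * of_real l * of_real y) *\<^sub>C w)" for y
        by (rule bounded_linear_scaleC)
      show "L1_fun (\<lambda>y. exp (- \<i> * of_real l * of_real y) *\<^sub>C ?f y)"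
        by (rule L1_fun_mult[OF exp_i_borel _ L1_fun_rep, where C = 1]) (simp add: cmod_exp_i)
      fix y z :: real and w :: 'a
      have "exp (- \<i> * of_real l * of_real y) *\<^sub>C w - exp (- \<i> * of_real l * of_real z) *\<^sub>C w
          = (exp (- \<i> * of_real l * of_real y) - exp (- \<i> * of_real l * of_real z)) *\<^sub>C w"
        using scaleC_add_left[of "exp (- \<i> * of_real l * of_real y) - exp (- \<i> * of_real l * of_real z)"
            "exp (- \<i> * of_real l * of_real z)" w] by simp
      then show "norm (exp (- \<i> * of_real l * of_real y) *\<^sub>C w - exp (- \<i> * of_real l * of_real z) *\<^sub>C w)
          \<le> \<bar>l\<bar> * \<bar>y - z\<bar> * norm w"
        by (simp only: norm_scaleC) (intro mult_right_mono exp_i_lipschitz norm_ge_zero)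
      show "norm (exp (- \<i> * of_real l * of_real y) *\<^sub>C w) \<le> 1 * norm w"
        by (simp only: norm_scaleC cmod_exp_i order_refl)
    qed auto
    also have "\<dots> \<le> \<bar>l\<bar> * h * (\<kappa> * norm v) + 1 * (e1 * norm v)"
      unfolding abs_rep_L1 using h by (intro add_mono mult_left_mono \<kappa> tail_le) auto
    also have "\<dots> = (\<bar>l\<bar> * h * \<kappa> + e1) * norm v" by (simp add: algebra_simps)
    also have "\<dots> \<le> (e/2 + e/2) * norm v"
    proof (intro mult_right_mono add_mono)
      have "\<bar>l\<bar> * h * \<kappa> \<le> (4 + \<bar>l\<bar>) * h * \<kappa>" using h \<kappa>0 by (intro mult_right_mono) auto
      then show "\<bar>l\<bar> * h * \<kappa> \<le> e/2" using hk by linarith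
      show "e1 \<le> e/2" using \<tau> e by (simp add: e1_def field_simps)
    qed auto
    finally show ?thesis unfolding wiener_fourier_eq b_eq by simp
  qed
  show ?thesis using b 1 2 by blast
qed

subsection \<open>Operators commuting with translations\<close>

text \<open>Complex linearity is imposed separately, since the type of bounded operators is
  real-linear.\<close>

definition translation_commutant :: "('a::cbanach L1 \<Rightarrow>\<^sub>L 'a L1) set" where
  "translation_commutant = {P.
    (\<forall>d F. blinfun_apply P (L1_translate d F) = L1_translate d (blinfun_apply P F)) \<and>
    (\<forall>c F. blinfun_apply P (c *\<^sub>C F) = c *\<^sub>C blinfun_apply P F)}"

definition L1_scale :: "complex \<Rightarrow> 'a::cbanach L1 \<Rightarrow>\<^sub>L 'a L1" where
  "L1_scale c = Blinfun ((*\<^sub>C) c)"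

definition L1_shift :: "real \<Rightarrow> 'a::cbanach L1 \<Rightarrow>\<^sub>L 'a L1" where
  "L1_shift d = Blinfun (L1_translate d)"

lemma L1_scale_apply [simp]: "blinfun_apply (L1_scale c) F = c *\<^sub>C F"
  by (simp add: L1_scale_def bounded_linear_Blinfun_apply[OF bounded_linear_scaleC])

lemma L1_shift_apply [simp]: "blinfun_apply (L1_shift d) F = L1_translate d F"
  by (simp add: L1_shift_def bounded_linear_Blinfun_apply[OF bounded_linear_translate])

lemma translation_commutantI:
  assumes "bounded_linear f" "\<And>d F. f (L1_translate d F) = L1_translate d (f F)" "\<And>c F. f (c *\<^sub>C F) = c *\<^sub>C f F"
  shows "Blinfun f \<in> translation_commutant"
  using assms by (simp add: translation_commutant_def bounded_linear_Blinfun_apply)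

lemma scaleC_scaleR: "a *\<^sub>C (r *\<^sub>R x) = r *\<^sub>R (a *\<^sub>C (x :: 'a::complex_normed_vector))"
  using bounded_linear.linear[OF bounded_linear_scaleC, of a] by (rule linear_scale)

lemma scaleC_zero_right: "a *\<^sub>C (0 :: 'a::complex_normed_vector) = 0"
  using bounded_linear.linear[OF bounded_linear_scaleC, of a] by (rule linear_0)

lemma L1_translate_zero: "L1_translate d 0 = 0"
  using bounded_linear.linear[OF bounded_linear_translate] by (rule linear_0)

lemma subspace_translation_commutant: "subspace translation_commutant"
  by (auto simp: subspace_def translation_commutant_def blinfun.add_left blinfun.scaleR_left
      scaleC_add_right scaleC_scaleR scaleC_zero_right L1_translate_zero)

lemma closed_translation_commutant: "closed (translation_commutant :: ('a::cbanach L1 \<Rightarrow>\<^sub>L 'a L1) set)"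
proof -
  have c: "continuous_on UNIV (\<lambda>P :: 'a L1 \<Rightarrow>\<^sub>L 'a L1. f (blinfun_apply P F))" if "bounded_linear f"
    for f :: "'a L1 \<Rightarrow> 'a L1" and F
    using bounded_linear_compose[OF that blinfun.bounded_linear_left] by (rule linear_continuous_on)
  show ?thesis
    unfolding translation_commutant_def
    by (intro closed_Collect_conj closed_Collect_all closed_Collect_eq
        c[OF bounded_linear_ident] c[OF bounded_linear_translate] c[OF bounded_linear_scaleC])
qed

lemma norm_L1_scale: "norm (L1_scale z) \<le> cmod z"
  by (rule norm_blinfun_bound) (simp_all add: norm_scaleC)

lemma norm_L1_shift: "norm (L1_shift t) \<le> 1"
  by (rule norm_blinfun_bound) simp_all

lemma commutant_apply:
  assumes "P \<in> translation_commutant"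
  shows "blinfun_apply P (L1_translate d F) = L1_translate d (blinfun_apply P F)"
    "blinfun_apply P (c *\<^sub>C F) = c *\<^sub>C blinfun_apply P F"
  using assms by (auto simp: translation_commutant_def)

lemma translation_algebra_commutant:
  "translation_algebra (o\<^sub>L) id_blinfun (translation_commutant :: ('a::cbanach L1 \<Rightarrow>\<^sub>L 'a L1) set) L1_scale L1_shift"
proof (rule translation_algebra.intro)
  fix a b c :: "'a L1 \<Rightarrow>\<^sub>L 'a L1" and z w :: complex and r s t :: real
  show "bounded_bilinear ((o\<^sub>L) :: ('a L1 \<Rightarrow>\<^sub>L 'a L1) \<Rightarrow> _)" by (rule bounded_bilinear_blinfun_compose)
  show "norm (a o\<^sub>L b) \<le> norm a * norm b" by (rule norm_blinfun_compose)
  show "a o\<^sub>L b o\<^sub>L c = a o\<^sub>L (b o\<^sub>L c)" "id_blinfun o\<^sub>L a = a" "a o\<^sub>L id_blinfun = a"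
    by (rule blinfun_eqI, simp)+
  show "norm (id_blinfun :: 'a L1 \<Rightarrow>\<^sub>L 'a L1) \<le> 1" by (rule norm_blinfun_id_le)
  show "subspace (translation_commutant :: ('a L1 \<Rightarrow>\<^sub>L 'a L1) set)" by (rule subspace_translation_commutant)
  show "closed (translation_commutant :: ('a L1 \<Rightarrow>\<^sub>L 'a L1) set)" by (rule closed_translation_commutant)
  show "id_blinfun \<in> (translation_commutant :: ('a L1 \<Rightarrow>\<^sub>L 'a L1) set)"
    "L1_scale z \<in> (translation_commutant :: ('a L1 \<Rightarrow>\<^sub>L 'a L1) set)"
    "L1_shift t \<in> (translation_commutant :: ('a L1 \<Rightarrow>\<^sub>L 'a L1) set)"
    by (simp_all add: translation_commutant_def scaleC_scaleC mult.commute add.commute)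
  show "a o\<^sub>L b \<in> translation_commutant" if "a \<in> translation_commutant" "b \<in> translation_commutant"
    using that by (simp add: translation_commutant_def)
  show "(L1_scale (z + w) :: 'a L1 \<Rightarrow>\<^sub>L 'a L1) = L1_scale z + L1_scale w"
    by (rule blinfun_eqI) (simp add: blinfun.add_left scaleC_add_left)
  show "(L1_scale (z * w) :: 'a L1 \<Rightarrow>\<^sub>L 'a L1) = L1_scale z o\<^sub>L L1_scale w"
    by (rule blinfun_eqI) (simp add: scaleC_scaleC)
  show "(L1_scale (of_real r) :: 'a L1 \<Rightarrow>\<^sub>L 'a L1) = r *\<^sub>R id_blinfun"
    by (rule blinfun_eqI) (simp add: blinfun.scaleR_left scaleC_of_real)
  show "norm (L1_scale z :: 'a L1 \<Rightarrow>\<^sub>L 'a L1) \<le> cmod z" by (rule norm_L1_scale)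
  show "norm (L1_shift t :: 'a L1 \<Rightarrow>\<^sub>L 'a L1) \<le> 1" by (rule norm_L1_shift)
  show "L1_scale z o\<^sub>L a = a o\<^sub>L L1_scale z" "L1_shift t o\<^sub>L a = a o\<^sub>L L1_shift t"
    if "a \<in> translation_commutant"
    using that by (auto intro!: blinfun_eqI simp: commutant_apply)
  show "(L1_shift 0 :: 'a L1 \<Rightarrow>\<^sub>L 'a L1) = id_blinfun" by (rule blinfun_eqI) simp
  show "(L1_shift (s + t) :: 'a L1 \<Rightarrow>\<^sub>L 'a L1) = L1_shift s o\<^sub>L L1_shift t" by (rule blinfun_eqI) simp
qed

text \<open>The laws for \<open>\<iota>\<close> and \<open>U\<close> survive reversal because
  multiplication and addition of their arguments are commutative.\<close>

lemma translation_algebra_opposite: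
  assumes "translation_algebra mul one car \<iota> U"
  shows "translation_algebra (\<lambda>a b. mul b a) one car \<iota> U"
proof -
  interpret translation_algebra mul one car \<iota> U by fact
  show ?thesis
  proof (rule translation_algebra.intro)
    show "bounded_bilinear (\<lambda>a b. mul b a)" by (rule mul.flip)
    show "\<iota> (z * w) = mul (\<iota> w) (\<iota> z)" for z w using \<iota>_mult[of w z] by (simp add: mult.commute)
    show "U (s + t) = mul (U t) (U s)" for s t using U_add[of t s] by (simp add: add.commute)
    show "norm (mul b a) \<le> norm a * norm b" for a b using norm_mul[of b a] by (simp add: mult.commute)
  qed (simp_all add: assoc norm_one subspace_car closed_car one_car mul_car \<iota>_car \<iota>_add \<iota>_of_real norm_\<iota>
      \<iota>_central U_car U_0 U_central norm_U)
qed

text \<open>For x = -A this presents one - (-A)^n as a multiple of one + A from either side.\<close>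

lemma (in translation_algebra) pw_geometric:
  "(\<Sum>k<n. pw x k) \<odot> (one - x) = one - pw x n" "(one - x) \<odot> (\<Sum>k<n. pw x k) = one - pw x n"
proof (induction n)
  case (Suc n)
  { case 1 show ?case
      unfolding sum.lessThan_Suc mul.add_left Suc by (simp add: mul.diff_right pw_Suc2) }
  { case 2 show ?case
      unfolding sum.lessThan_Suc mul.add_right Suc by (simp add: mul.diff_left pw_Suc) }
qed (simp_all add: mul.zero_left mul.zero_right)

lemma conv_op_invertible:
  fixes T :: "'a::cbanach \<Rightarrow> 'a L1"
  assumes T: "bounded_clinear T"
    and N: "1 \<le> N"
    and C1: "((\<lambda>\<delta>. onorm (\<lambda>v. (conv_op T ^^ (N - 1)) (T v) - L1_translate \<delta> ((conv_op T ^^ (N - 1)) (T v)))) \<longlongrightarrow> 0) (at 0)"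
    and C2: "((\<lambda>R. onorm (\<lambda>f. L1_tail R (T f))) \<longlongrightarrow> 0) at_top"
    and inv: "\<And>\<xi>::real. invertible_op (\<lambda>f. f + wiener_fourier T \<xi> f)"
  shows "\<exists>Q\<in>translation_commutant. \<forall>g. blinfun_apply Q (g + conv_op T g) = g \<and> blinfun_apply Q g + conv_op T (blinfun_apply Q g) = g"
proof -
  have blT: "bounded_linear T" using T by (simp add: bounded_clinear_def)
  let ?\<C> = "translation_commutant :: ('a L1 \<Rightarrow>\<^sub>L 'a L1) set"
  define A where "A = Blinfun (conv_op T)"
  have A_apply [simp]: "blinfun_apply A g = conv_op T g" for g
    by (simp add: A_def bounded_linear_Blinfun_apply[OF bounded_linear_conv_op[OF blT]])
  have A: "A \<in> ?\<C>" unfolding A_def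
    by (intro translation_commutantI bounded_linear_conv_op conv_op_translate conv_op_scaleC blT T)
  define C where "C \<tau> = (Blinfun (indicator_conv {0..<\<tau>}) :: 'a L1 \<Rightarrow>\<^sub>L 'a L1)" for \<tau> :: real
  have C_apply [simp]: "blinfun_apply (C \<tau>) g = indicator_conv {0..<\<tau>} g" for \<tau> g
    by (simp add: C_def bounded_linear_Blinfun_apply[OF bounded_linear_indicator_conv[OF box_fmeasurable]])
  have C: "C \<tau> \<in> ?\<C>" for \<tau> unfolding C_def
    by (intro translation_commutantI bounded_linear_indicator_conv indicator_conv_translate
        indicator_conv_scaleC box_fmeasurable)
  have conv_commute: "blinfun_apply P (indicator_conv E g) = indicator_conv E (blinfun_apply P g)" if "P \<in> ?\<C>" "E \<in> fmeasurable lborel" for P E g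
    by (rule indicator_conv_commute[OF that(2) blinfun.bounded_linear_right commutant_apply(1)[OF that(1)]])
  have C_commute: "C \<tau> o\<^sub>L P = P o\<^sub>L C \<tau>" if "P \<in> ?\<C>" for P \<tau>
    by (rule blinfun_eqI) (simp add: conv_commute[OF that box_fmeasurable])
  define H where "H l = Blinfun (L1_map (wiener_fourier T l))" for l
  have F: "bounded_clinear (wiener_fourier T l)" for l by (rule bounded_clinear_wiener_fourier[OF T])
  then have blF: "bounded_linear (wiener_fourier T l)" for l by (simp add: bounded_clinear_def)
  have H_apply [simp]: "blinfun_apply (H l) g = L1_map (wiener_fourier T l) g" for l g
    by (simp add: H_def bounded_linear_Blinfun_apply[OF bounded_linear_L1_map[OF blF]])
  have H: "H l \<in> ?\<C>" for l unfolding H_def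
    by (intro translation_commutantI bounded_linear_L1_map L1_map_translate L1_map_scaleC F blF)
  \<comment> \<open>The inverse of I + That(l) in B(X), applied pointwise, inverts in the commutant;
    by density the identities are checked on indicator functions.\<close>
  have H_inv: "\<exists>h\<in>?\<C>. h o\<^sub>L (id_blinfun + H l) = id_blinfun \<and> (id_blinfun + H l) o\<^sub>L h = id_blinfun" for l
  proof -
    obtain B where B: "bounded_clinear B" "(\<lambda>f. f + wiener_fourier T l f) \<circ> B = id"
      "B \<circ> (\<lambda>f. f + wiener_fourier T l f) = id"
      using inv[of l] unfolding invertible_op_def by blast
    have blB: "bounded_linear B" using B(1) by (simp add: bounded_clinear_def)
    define h where "h = Blinfun (L1_map B)"
    have h_apply [simp]: "blinfun_apply h g = L1_map B g" for g
      by (simp add: h_def bounded_linear_Blinfun_apply[OF bounded_linear_L1_map[OF blB]])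
    have "h \<in> ?\<C>" unfolding h_def
      by (intro translation_commutantI bounded_linear_L1_map L1_map_translate L1_map_scaleC B(1) blB)
    moreover have "h o\<^sub>L (id_blinfun + H l) = id_blinfun"
    proof (rule blinfun_eqI)
      fix g
      have "blinfun_apply (h o\<^sub>L (id_blinfun + H l)) g = blinfun_apply id_blinfun g"
      proof (rule bounded_linear_L1_eqI[OF blinfun.bounded_linear_right blinfun.bounded_linear_right])
        fix E :: "real set" and v :: 'a assume E: "E \<in> fmeasurable lborel"
        have "blinfun_apply (h o\<^sub>L (id_blinfun + H l)) (L1_indicator E v) = L1_indicator E (B (v + wiener_fourier T l v))"
          by (simp add: blinfun.add_left L1_map_indicator[OF blF E] L1_map_indicator[OF blB E]
              linear_add[OF bounded_linear.linear[OF bounded_linear_L1_indicator[OF E]], symmetric])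
        also have "B (v + wiener_fourier T l v) = v" using fun_cong[OF B(3), of v] by simp
        finally show "blinfun_apply (h o\<^sub>L (id_blinfun + H l)) (L1_indicator E v) = blinfun_apply id_blinfun (L1_indicator E v)"
          by simp
      qed
      then show "blinfun_apply (h o\<^sub>L (id_blinfun + H l)) g = blinfun_apply id_blinfun g" .
    qed
    moreover have "(id_blinfun + H l) o\<^sub>L h = id_blinfun"
    proof (rule blinfun_eqI)
      fix g
      show "blinfun_apply ((id_blinfun + H l) o\<^sub>L h) g = blinfun_apply id_blinfun g"
      proof (rule bounded_linear_L1_eqI[OF blinfun.bounded_linear_right blinfun.bounded_linear_right])
        fix E :: "real set" and v :: 'a assume E: "E \<in> fmeasurable lborel"
        have "blinfun_apply ((id_blinfun + H l) o\<^sub>L h) (L1_indicator E v) = L1_indicator E (B v + wiener_fourier T l (B v))"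
          by (simp add: blinfun.add_left L1_map_indicator[OF blF E] L1_map_indicator[OF blB E]
              linear_add[OF bounded_linear.linear[OF bounded_linear_L1_indicator[OF E]]])
        also have "B v + wiener_fourier T l (B v) = v" using fun_cong[OF B(2), of v] by simp
        finally show "blinfun_apply ((id_blinfun + H l) o\<^sub>L h) (L1_indicator E v) = blinfun_apply id_blinfun (L1_indicator E v)"
          by simp
      qed
    qed
    ultimately show ?thesis by blast
  qed
  have C_cont: "((\<lambda>t. norm ((L1_shift t - id_blinfun) o\<^sub>L C \<tau>)) \<longlongrightarrow> 0) (at 0)" if "0 < \<tau>" for \<tau>
  proof (rule Lim_null_comparison)
    show "\<forall>\<^sub>F t in at 0. norm (norm ((L1_shift t - id_blinfun) o\<^sub>L C \<tau>)) \<le> 4 * \<bar>t\<bar>"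
    proof (intro always_eventually allI)
      fix t :: real
      have "norm ((L1_shift t - id_blinfun) o\<^sub>L C \<tau>) \<le> 4 * \<bar>t\<bar>"
        by (rule norm_blinfun_bound)
          (simp_all add: blinfun.diff_left norm_translate_conv_box_diff[OF that])
      then show "norm (norm ((L1_shift t - id_blinfun) o\<^sub>L C \<tau>)) \<le> 4 * \<bar>t\<bar>" by simp
    qed
    have "((\<lambda>t::real. 4 * \<bar>t\<bar>) \<longlongrightarrow> 4 * \<bar>0\<bar>) (at 0)" by (intro tendsto_intros)
    then show "((\<lambda>t::real. 4 * \<bar>t\<bar>) \<longlongrightarrow> 0) (at 0)" by simp
  qed
  have approx: "\<exists>(n::nat) \<sigma> B. (\<forall>j<n. B j \<in> ?\<C>)
      \<and> norm ((C \<tau> o\<^sub>L A) - (\<Sum>j<n. L1_shift (\<sigma> j) o\<^sub>L B j)) \<le> e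
      \<and> norm ((C \<tau> o\<^sub>L H l) - (\<Sum>j<n. L1_scale (exp (- \<i> * of_real l * of_real (\<sigma> j))) o\<^sub>L B j)) \<le> e"
    if \<tau>: "0 < \<tau>" and e: "0 < e" for \<tau> l e
  proof -
    \<comment> \<open>The estimate for That(l) is stated on X; composing with C costs a factor
      \<tau>, so both e' \<le> e and \<tau> e' \<le> e are needed.\<close>
    define e' where "e' = e / (\<tau> + 1)"
    have e': "0 < e'" "e' \<le> e" "\<tau> * e' \<le> e" using \<tau> e by (auto simp: e'_def field_simps)
    from conv_op_localization[OF T C2 \<tau> e'(1), of l] obtain n :: nat and \<sigma> b where
      b: "\<And>j. bounded_clinear (b j)"
      and b1: "\<And>g. norm (indicator_conv {0..<\<tau>} (conv_op T g)
          - (\<Sum>j<n. L1_translate (\<sigma> j) (indicator_conv {0..<\<tau>} (L1_map (b j) g)))) \<le> e' * norm g"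
      and b2: "\<And>v. norm (wiener_fourier T l v - (\<Sum>j<n. exp (- \<i> * of_real l * of_real (\<sigma> j)) *\<^sub>C b j v)) \<le> e' * norm v"
      by blast
    have blb: "bounded_linear (b j)" for j using b by (simp add: bounded_clinear_def)
    \<comment> \<open>The box convolution is absorbed into the coefficients, which therefore serve
      both sums.\<close>
    define B where "B j = C \<tau> o\<^sub>L Blinfun (L1_map (b j))" for j
    have B_apply [simp]: "blinfun_apply (B j) g = indicator_conv {0..<\<tau>} (L1_map (b j) g)" for j g
      by (simp add: B_def bounded_linear_Blinfun_apply[OF bounded_linear_L1_map[OF blb]])
    have "B j \<in> ?\<C>" for j
      using C[of \<tau>] translation_commutantI[OF bounded_linear_L1_map[OF blb] L1_map_translate[OF blb] L1_map_scaleC[OF b]]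
      unfolding B_def by (intro translation_algebra.mul_car[OF translation_algebra_commutant])
    moreover have "norm ((C \<tau> o\<^sub>L A) - (\<Sum>j<n. L1_shift (\<sigma> j) o\<^sub>L B j)) \<le> e"
    proof (rule norm_blinfun_bound)
      fix g
      have "norm (blinfun_apply ((C \<tau> o\<^sub>L A) - (\<Sum>j<n. L1_shift (\<sigma> j) o\<^sub>L B j)) g) \<le> e' * norm g"
        using b1[of g] by (simp add: blinfun.diff_left blinfun.sum_left)
      also have "\<dots> \<le> e * norm g" using e' by (intro mult_right_mono) auto
      finally show "norm (blinfun_apply ((C \<tau> o\<^sub>L A) - (\<Sum>j<n. L1_shift (\<sigma> j) o\<^sub>L B j)) g) \<le> e * norm g" .
    qed (use e in simp)
    moreover have "norm ((C \<tau> o\<^sub>L H l) - (\<Sum>j<n. L1_scale (exp (- \<i> * of_real l * of_real (\<sigma> j))) o\<^sub>L B j)) \<le> e"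
    proof (rule norm_blinfun_bound, use e in simp, rule bounded_linear_L1_bound[OF blinfun.bounded_linear_right])
      fix E :: "real set" and v :: 'a assume E: "E \<in> fmeasurable lborel"
      let ?w = "wiener_fourier T l v - (\<Sum>j<n. exp (- \<i> * of_real l * of_real (\<sigma> j)) *\<^sub>C b j v)"
      interpret Eb: bounded_linear "L1_indicator E :: 'a \<Rightarrow> 'a L1" by (rule bounded_linear_L1_indicator[OF E])
      interpret Cb: bounded_linear "indicator_conv {0..<\<tau>} :: 'a L1 \<Rightarrow> 'a L1"
        by (rule bounded_linear_indicator_conv[OF box_fmeasurable])
      have "blinfun_apply ((C \<tau> o\<^sub>L H l) - (\<Sum>j<n. L1_scale (exp (- \<i> * of_real l * of_real (\<sigma> j))) o\<^sub>L B j)) (L1_indicator E v)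
          = indicator_conv {0..<\<tau>} (L1_indicator E ?w)"
        by (simp add: blinfun.diff_left blinfun.sum_left L1_map_indicator[OF blF E] L1_map_indicator[OF blb E]
            Eb.diff Eb.sum Cb.diff Cb.sum L1_indicator_scaleC[OF E] indicator_conv_scaleC[OF box_fmeasurable])
      also have "norm \<dots> \<le> \<tau> * (measure lborel E * norm ?w)"
        using norm_indicator_conv_le[OF box_fmeasurable[of 0 \<tau>], of "L1_indicator E ?w"] \<tau>
        by (simp add: norm_L1_indicator[OF E])
      also have "\<dots> \<le> \<tau> * (measure lborel E * (e' * norm v))"
        using \<tau> by (intro mult_left_mono b2) auto
      also have "\<dots> = (\<tau> * e') * (measure lborel E * norm v)" by (simp add: mult_ac)
      also have "\<dots> \<le> e * (measure lborel E * norm v)" using e'(3) by (intro mult_right_mono) auto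
      finally show "norm (blinfun_apply ((C \<tau> o\<^sub>L H l) - (\<Sum>j<n. L1_scale (exp (- \<i> * of_real l * of_real (\<sigma> j))) o\<^sub>L B j))
          (L1_indicator E v)) \<le> e * measure lborel E * norm v" by (simp add: mult.assoc)
    qed
    ultimately show ?thesis by blast
  qed
  interpret alg: translation_algebra "(o\<^sub>L)" id_blinfun ?\<C> L1_scale L1_shift
    by (rule translation_algebra_commutant)
  interpret opp: translation_algebra "\<lambda>a b. b o\<^sub>L a" id_blinfun ?\<C> L1_scale L1_shift
    by (rule translation_algebra_opposite[OF translation_algebra_commutant])
  define P where "P = alg.pw (- A) N"
  define G where "G = (\<Sum>k<N. alg.pw (- A) k)"
  have mA: "- A \<in> ?\<C>" using subspace_neg[OF subspace_translation_commutant A] .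
  have P: "P \<in> ?\<C>" unfolding P_def by (rule alg.pw_car[OF mA])
  have G: "G \<in> ?\<C>" unfolding G_def by (intro alg.car_intros alg.pw_car mA)
  have GA: "G o\<^sub>L (id_blinfun + A) = id_blinfun - P" "(id_blinfun + A) o\<^sub>L G = id_blinfun - P"
    using alg.pw_geometric[of "- A" N] by (simp_all add: G_def P_def)
  have P_apply: "blinfun_apply (alg.pw (- A) k) g = (- 1) ^ k *\<^sub>R (conv_op T ^^ k) g" for k g
  proof (induction k)
    case (Suc k)
    then show ?case
      using linear_scale[OF bounded_linear.linear[OF bounded_linear_conv_op[OF blT]]]
      by (simp add: alg.pw_Suc blinfun.minus_left)
  qed simp
  \<comment> \<open>The value at v of the N-th power in the algebra: one factor T takes v into L^1,
    and N - 1 convolutions follow.\<close>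
  define W where "W v = (conv_op T ^^ (N - 1)) (T v)" for v
  have pow_bl: "bounded_linear (conv_op T ^^ k)" for k
    by (induction k) (auto intro: bounded_linear_compose[OF bounded_linear_conv_op[OF blT]]
        simp: id_def bounded_linear_ident o_def)
  have W: "bounded_linear W" unfolding W_def[abs_def] by (rule bounded_linear_compose[OF pow_bl blT])
  have pow_conv: "(conv_op T ^^ k) (indicator_conv E g) = indicator_conv E ((conv_op T ^^ k) g)"
    if "E \<in> fmeasurable lborel" for k E g
  proof (induction k)
    case (Suc k)
    then show ?case using conv_commute[OF A that] by simp
  qed simp
  \<comment> \<open>On \<chi> v the N-th operator power acts as convolution of \<chi> with the N-th
    algebra power of T at v; this connects P with (C1).\<close>
  have P_ind: "blinfun_apply P (L1_indicator E v) = (- 1) ^ N *\<^sub>R indicator_conv E (W v)" if "E \<in> fmeasurable lborel" for E v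
  proof -
    obtain M where M: "N = Suc M" using N by (cases N) auto
    have "(conv_op T ^^ N) (L1_indicator E v) = (conv_op T ^^ M) (conv_op T (L1_indicator E v))"
      unfolding M by (simp add: funpow_swap1)
    also have "\<dots> = indicator_conv E (W v)"
      by (simp add: conv_op_indicator[OF blT that] pow_conv[OF that] W_def M)
    finally show ?thesis by (simp add: P_def P_apply)
  qed
  have high: "\<exists>\<tau>>0. norm (P - (1 / \<tau>) *\<^sub>R (C \<tau> o\<^sub>L P)) \<le> e" if e: "0 < e" for e
  proof -
    \<comment> \<open>(C1) bounds the displacement of \<open>W v\<close> under every shift in
      (0,\<tau>), so averaging over [0,\<tau>) moves it by at most e |v|.\<close>
    from LIM_D[OF C1 e] obtain \<tau> where \<tau>: "\<tau> > 0"
      "\<And>y. y \<noteq> 0 \<Longrightarrow> \<bar>y\<bar> < \<tau> \<Longrightarrow> \<bar>onorm (\<lambda>v. W v - L1_translate y (W v))\<bar> < e"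
      unfolding W_def by auto
    have Wle: "norm (W v - (1 / \<tau>) *\<^sub>R indicator_conv {0..<\<tau>} (W v)) \<le> e * norm v" for v
    proof (rule indicator_conv_box_approx[OF \<tau>(1)])
      fix y :: real assume y: "0 < y" "y < \<tau>"
      have "norm (W v - L1_translate y (W v)) \<le> onorm (\<lambda>v. W v - L1_translate y (W v)) * norm v"
        by (rule onorm[OF bounded_linear_sub[OF W bounded_linear_compose[OF bounded_linear_translate W]]])
      also have "\<dots> \<le> e * norm v" using \<tau>(2)[of y] y by (intro mult_right_mono) auto
      finally show "norm (W v - L1_translate y (W v)) \<le> e * norm v" .
    qed (use e in simp)
    have "norm (P - (1 / \<tau>) *\<^sub>R (C \<tau> o\<^sub>L P)) \<le> e"
    proof (rule norm_blinfun_bound, use e in simp, rule bounded_linear_L1_bound[OF blinfun.bounded_linear_right])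
      fix E :: "real set" and v :: 'a assume E: "E \<in> fmeasurable lborel"
      interpret Eb: bounded_linear "indicator_conv E :: 'a L1 \<Rightarrow> 'a L1" by (rule bounded_linear_indicator_conv[OF E])
      interpret Cb: bounded_linear "indicator_conv {0..<\<tau>} :: 'a L1 \<Rightarrow> 'a L1"
        by (rule bounded_linear_indicator_conv[OF box_fmeasurable])
      have "blinfun_apply (P - (1 / \<tau>) *\<^sub>R (C \<tau> o\<^sub>L P)) (L1_indicator E v)
          = (- 1) ^ N *\<^sub>R indicator_conv E (W v - (1 / \<tau>) *\<^sub>R indicator_conv {0..<\<tau>} (W v))"
        using conv_commute[OF C[of \<tau>] E, of "W v"]
        by (simp add: blinfun.diff_left blinfun.scaleR_left P_ind[OF E] Eb.diff Eb.scaleR Cb.scaleR scaleR_diff_right)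
      also have "norm \<dots> \<le> measure lborel E * norm (W v - (1 / \<tau>) *\<^sub>R indicator_conv {0..<\<tau>} (W v))"
        using norm_indicator_conv_le[OF E] by simp
      also have "\<dots> \<le> measure lborel E * (e * norm v)" by (intro mult_left_mono Wle) simp
      finally show "norm (blinfun_apply (P - (1 / \<tau>) *\<^sub>R (C \<tau> o\<^sub>L P)) (L1_indicator E v)) \<le> e * measure lborel E * norm v"
        by (simp add: mult_ac)
    qed
    then show ?thesis using \<tau>(1) by blast
  qed
  obtain Q where Q: "Q \<in> ?\<C>" "Q o\<^sub>L (id_blinfun + A) = id_blinfun"
    using alg.left_invertible[where A = A and C = C and H = H and P = P and G = G]
      A C C_commute C_cont H H_inv approx P high G GA by blast
  obtain Q' where Q': "Q' \<in> ?\<C>" "(id_blinfun + A) o\<^sub>L Q' = id_blinfun"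
  proof -
    have flip: "P o\<^sub>L C \<tau> = C \<tau> o\<^sub>L P" if "P \<in> ?\<C>" for P \<tau> using C_commute[OF that] by simp
    \<comment> \<open>A left inverse in the opposite algebra is a right inverse here. The hypotheses
      carry over because C commutes with the whole commutant, while shifts and scalars are
      central.\<close>
    have "\<exists>y\<in>?\<C>. (id_blinfun + A) o\<^sub>L y = id_blinfun"
    proof (rule opp.left_invertible[where A = A and C = C and H = H and P = P and G = G])
      show "((\<lambda>t. norm (C \<tau> o\<^sub>L (L1_shift t - id_blinfun))) \<longlongrightarrow> 0) (at 0)" if "0 < \<tau>" for \<tau>
        using C_cont[OF that] C_commute by (simp add: alg.car_intros)
      show "\<exists>(n::nat) \<sigma> B. (\<forall>j<n. B j \<in> ?\<C>)
        \<and> norm ((A o\<^sub>L C \<tau>) - (\<Sum>j<n. B j o\<^sub>L L1_shift (\<sigma> j))) \<le> e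
        \<and> norm ((H l o\<^sub>L C \<tau>) - (\<Sum>j<n. B j o\<^sub>L L1_scale (exp (- \<i> * of_real l * of_real (\<sigma> j))))) \<le> e"
        if "0 < \<tau>" "0 < e" for \<tau> l e
      proof -
        from approx[OF that, of l] obtain n :: nat and \<sigma> B where B: "\<forall>j<n. B j \<in> ?\<C>"
          "norm ((C \<tau> o\<^sub>L A) - (\<Sum>j<n. L1_shift (\<sigma> j) o\<^sub>L B j)) \<le> e"
          "norm ((C \<tau> o\<^sub>L H l) - (\<Sum>j<n. L1_scale (exp (- \<i> * of_real l * of_real (\<sigma> j))) o\<^sub>L B j)) \<le> e"
          by blast
        have s1: "(\<Sum>j<n. L1_shift (\<sigma> j) o\<^sub>L B j) = (\<Sum>j<n. B j o\<^sub>L L1_shift (\<sigma> j))"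
          using B(1) by (intro sum.cong refl alg.U_central) auto
        have s2: "(\<Sum>j<n. L1_scale (exp (- \<i> * of_real l * of_real (\<sigma> j))) o\<^sub>L B j)
            = (\<Sum>j<n. B j o\<^sub>L L1_scale (exp (- \<i> * of_real l * of_real (\<sigma> j))))"
          using B(1) by (intro sum.cong refl alg.\<iota>_central) auto
        show ?thesis using B unfolding s1 s2 C_commute[OF A] C_commute[OF H] by blast
      qed
      show "\<exists>\<tau>>0. norm (P - (1 / \<tau>) *\<^sub>R (P o\<^sub>L C \<tau>)) \<le> e" if "0 < e" for e
        using high[OF that] unfolding C_commute[OF P] .
      show "\<exists>h\<in>?\<C>. (id_blinfun + H l) o\<^sub>L h = id_blinfun" for l using H_inv by blast
    qed (simp_all add: A C H P G GA flip)
    then show ?thesis using that by blast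
  qed
  have "Q = Q o\<^sub>L ((id_blinfun + A) o\<^sub>L Q')" by (simp add: Q')
  also have "\<dots> = Q'" by (simp add: Q(2) flip: alg.assoc)
  finally have QQ': "Q' = Q" by simp
  have "blinfun_apply Q (g + conv_op T g) = g" "blinfun_apply Q g + conv_op T (blinfun_apply Q g) = g" for g
    using arg_cong[OF Q(2), of "\<lambda>X. blinfun_apply X g"] arg_cong[OF Q'(2), of "\<lambda>X. blinfun_apply X g"]
    by (simp_all add: blinfun.add_left QQ')
  then show ?thesis using Q(1) by blast
qed

theorem theorem3:
  fixes T :: "'a::cbanach \<Rightarrow> 'a L1"
  assumes T: "T \<in> wiener"
    and C1: "\<exists>N\<ge>1. ((\<lambda>\<delta>. onorm (\<lambda>f. wiener_power T N f - L1_translate \<delta> (wiener_power T N f)))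
                 \<longlongrightarrow> 0) (at 0)"
    and C2: "((\<lambda>R. onorm (\<lambda>f. L1_tail R (T f))) \<longlongrightarrow> 0) at_top"
    and inv: "\<And>\<xi>::real. invertible_op (\<lambda>f. f + wiener_fourier T \<xi> f)"
  shows "\<exists>S\<in>wiener. unit_mult (1, T) (1, S) = unit_one \<and> unit_mult (1, S) (1, T) = unit_one"
proof -
  have bcT: "bounded_clinear T" and blT: "bounded_linear T"
    using T by (auto simp: wiener_def bounded_clinear_def)
  have act: "wiener_act T = conv_op T" by (rule wiener_act_eq[OF T])
  obtain N where N: "1 \<le> N"
    "((\<lambda>\<delta>. onorm (\<lambda>f. wiener_power T N f - L1_translate \<delta> (wiener_power T N f))) \<longlongrightarrow> 0) (at 0)"
    using C1 by blast
  have "((\<star>) T ^^ k) T v = (conv_op T ^^ k) (T v)" for k v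
    by (induction k) (simp_all add: wiener_mult_def act)
  then have "wiener_power T N v = (conv_op T ^^ (N - 1)) (T v)" for v
    by (simp add: wiener_power_def)
  with conv_op_invertible[OF bcT N(1) _ C2 inv] N(2)
  obtain Q where Q: "Q \<in> translation_commutant" "\<And>g. blinfun_apply Q (g + conv_op T g) = g"
    "\<And>g. blinfun_apply Q g + conv_op T (blinfun_apply Q g) = g" by auto
  \<comment> \<open>Q (I + conv_op T) = I gives Q = I - Q conv_op T, so for Q to be the operator of
    1 + S, the element S has to be -Q o T.\<close>
  define S where "S v = - blinfun_apply Q (T v)" for v
  have S: "S \<in> wiener"
  proof -
    have "bounded_linear S" unfolding S_def[abs_def]
      by (intro bounded_linear_minus bounded_linear_compose[OF blinfun.bounded_linear_right blT])
    moreover have "S (c *\<^sub>C v) = c *\<^sub>C S v" for c v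
      using bcT linear_neg[OF bounded_linear.linear[OF bounded_linear_scaleC], of c "blinfun_apply Q (T v)"]
      by (simp add: S_def bounded_clinear_def commutant_apply[OF Q(1)])
    ultimately show ?thesis by (simp add: wiener_def bounded_clinear_def)
  qed
  \<comment> \<open>Q commutes with translations and so passes inside the convolution integral, onto
    the values of T.\<close>
  have Qc: "conv_op S g = - blinfun_apply Q (conv_op T g)" for g
  proof -
    have "- blinfun_apply Q (conv_op T g) = conv_op (\<lambda>v. - blinfun_apply Q (T v)) g"
      by (rule conv_op_commute[OF blT bounded_linear_minus[OF blinfun.bounded_linear_right]])
        (simp add: commutant_apply[OF Q(1)] linear_neg[OF bounded_linear.linear[OF bounded_linear_translate]])
    then show ?thesis by (simp add: S_def[abs_def])
  qed
  have "S v + T v + (T \<star> S) v = 0" for v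
  proof -
    have "conv_op T (S v) = - conv_op T (blinfun_apply Q (T v))"
      unfolding S_def by (rule linear_neg[OF bounded_linear.linear[OF bounded_linear_conv_op[OF blT]]])
    then show ?thesis using Q(3)[of "T v"] by (simp add: wiener_mult_def act S_def algebra_simps)
  qed
  moreover have "T v + S v + (S \<star> T) v = 0" for v
  proof -
    have "(S \<star> T) v = - blinfun_apply Q (conv_op T (T v))"
      by (simp add: wiener_mult_def wiener_act_eq[OF S] Qc)
    then show ?thesis using Q(2)[of "T v"] by (simp add: S_def blinfun.add_right algebra_simps)
  qed
  ultimately show ?thesis
    using S by (intro bexI[of _ S]) (simp_all add: unit_one_def scaleC_one)
qed

end
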